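(* Let $K$ be a field, $S=K[t_1,\dots,t_s]$, let $(0)\neq I\subset S$ be an unmixed graded ideal, let $\prec$ be a monomial order on $S$, and let $d\ge 1$, $r\ge 1$ be integers. The following hold. (a) $\mathrm{fp}_I(d,r)\le \delta_I(d,r)$ for $1\le r\le H_I(d)$. (b) $\delta_I(d,r)\ge 1$. (c) $\mathrm{fp}_I(d,r)\ge 1$ if $\mathrm{in}_\prec(I)$ is unmixed. (d) $\delta_I(d,r)\le \delta_I(d,r+1)$. (e) If there is $h\in S_1$ that is regular on $S/I$, then $\delta_I(d,r)\ge \delta_I(d+1,r)\ge 1$.
   Context: $S=K[t_1,\dots,t_s]=\bigoplus_{d\ge0}S_d$ has the standard grading; $K$ is an arbitrary field. An ideal $I$ is unmixed if it is proper and all associated primes of $S/I$ have the same height. $H_I(d)=\dim_K(S_d/I_d)$ is the Hilbert function of $S/I$. The degree $\deg(S/I)$, with $k=\dim(S/I)$ the Krull dimension, is $(k-1)!\lim_{d\to\infty}H_I(d)/d^{k-1}$ if $k\ge1$ and $\dim_K(S/I)$ if $k=0$. An element $h$ is regular on $S/I$ if $(I:h)=I$. Generalized minimum distance function: for $d,r\ge 1$ let $\mathcal F_{d,r}$ be the set of all $F=\{f_1,\dots,f_r\}\subset S_d$ such that the classes $\overline f_1,\dots,\overline f_r$ in $S/I$ are linearly independent over $K$ and $(I:(f_1,\dots,f_r))\ne I$. Put $\delta_I(d,r)=\deg(S/I)-\max\{\deg(S/(I,F)) : F\in\mathcal F_{d,r}\}$ if $\mathcal F_{d,r}\neq\emptyset$,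 and $\delta_I(d,r)=\deg(S/I)$ if $\mathcal F_{d,r}=\emptyset$. Generalized footprint function (with respect to $\prec$): $\mathrm{in}_\prec(I)$ is the initial ideal of $I$, and $\Delta_\prec(I)_d$ is the set of monomials of degree $d$ not in $\mathrm{in}_\prec(I)$. Let $\mathcal M_{\prec,d,r}$ be the set of all subsets $M\subset\Delta_\prec(I)_d$ with $r$ distinct elements such that $(\mathrm{in}_\prec(I):(M))\ne\mathrm{in}_\prec(I)$. Put $\mathrm{fp}_I(d,r)=\deg(S/I)-\max\{\deg(S/(\mathrm{in}_\prec(I),M)) : M\in\mathcal M_{\prec,d,r}\}$ if $\mathcal M_{\prec,d,r}\ne\emptyset$, and $\mathrm{fp}_I(d,r)=\deg(S/I)$ otherwise. *)

theory Defs
  imports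
    Complex_Main
    "HOL-Library.Poly_Mapping"
    "HOL-Library.Extended_Nat"
    "HOL-Algebra.QuotRing"
    "HOL-Algebra.Algebraic_Closure_Type"
begin

subsection \<open>The polynomial ring\<close>

text \<open>
  \<open>('n, 'k) mpoly\<close> is the polynomial ring over the field \<open>'k\<close> in the \<open>CARD('n)\<close> variables indexed
  by the finite type \<open>'n\<close>; a monomial is represented by its exponent vector, so the product of
  monomials is the sum of exponent vectors.
\<close>

type_synonym 'n mon = "'n \<Rightarrow>\<^sub>0 nat"
type_synonym ('n, 'k) mpoly = "'n mon \<Rightarrow>\<^sub>0 'k"

abbreviation poly_ring :: "('n, 'k::field) mpoly ring"
  where "poly_ring \<equiv> ring_of_type_algebra"

definition monom_poly :: "'n mon \<Rightarrow> ('n, 'k::field) mpoly"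
  where "monom_poly m = Poly_Mapping.single m 1"

definition scale_poly :: "'k::field \<Rightarrow> ('n, 'k) mpoly \<Rightarrow> ('n, 'k) mpoly"
  where "scale_poly c f = Poly_Mapping.single 0 c * f"

definition mon_deg :: "'n::finite mon \<Rightarrow> nat"
  where "mon_deg m = (\<Sum>i\<in>UNIV. Poly_Mapping.lookup m i)"

text \<open>The graded piece of degree \<open>d\<close>, containing \<open>0\<close>.\<close>

definition homog :: "nat \<Rightarrow> ('n::finite, 'k::field) mpoly set"
  where "homog d = {f. \<forall>m\<in>Poly_Mapping.keys f. mon_deg m = d}"

definition homog_part :: "nat \<Rightarrow> ('n::finite, 'k::field) mpoly \<Rightarrow> ('n, 'k) mpoly"
  where "homog_part d f = (\<Sum>m | m \<in> Poly_Mapping.keys f \<and> mon_deg m = d. Poly_Mapping.single m (Poly_Mapping.lookup f m))"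


subsection \<open>Ideals\<close>

definition graded_ideal :: "('n::finite, 'k::field) mpoly set \<Rightarrow> bool"
  where "graded_ideal I \<longleftrightarrow> ideal I poly_ring \<and> (\<forall>f\<in>I. \<forall>d. homog_part d f \<in> I)"

definition ideal_gen :: "('n, 'k::field) mpoly set \<Rightarrow> ('n, 'k) mpoly set"
  where "ideal_gen A = genideal poly_ring A"

definition colon :: "('n, 'k::field) mpoly set \<Rightarrow> ('n, 'k) mpoly set \<Rightarrow> ('n, 'k) mpoly set"
  where "colon I J = {f. \<forall>g\<in>J. f * g \<in> I}"

text \<open>A prime \<open>P\<close> is associated to \<open>S/I\<close> if it is the annihilator of the class of some \<open>f\<close>.\<close>

definition assoc_primes :: "('n, 'k::field) mpoly set \<Rightarrow> ('n, 'k) mpoly set set"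
  where "assoc_primes I = {P. primeideal P poly_ring \<and> (\<exists>f. P = {g. g * f \<in> I})}"

definition prime_chain :: "('a, 'b) ring_scheme \<Rightarrow> nat \<Rightarrow> (nat \<Rightarrow> 'a set) \<Rightarrow> bool"
  where "prime_chain R n p \<longleftrightarrow> (\<forall>i\<le>n. primeideal (p i) R) \<and> (\<forall>i<n. p i \<subset> p (Suc i))"

definition height :: "('a, 'b) ring_scheme \<Rightarrow> 'a set \<Rightarrow> enat"
  where "height R P = (SUP n \<in> {n. \<exists>p. prime_chain R n p \<and> p n = P}. enat n)"

definition krull_dim :: "('a, 'b) ring_scheme \<Rightarrow> enat"
  where "krull_dim R = (SUP n \<in> {n. \<exists>p. prime_chain R n p}. enat n)"

definition unmixed :: "('n, 'k::field) mpoly set \<Rightarrow> bool"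
  where "unmixed I \<longleftrightarrow> ideal I poly_ring \<and> I \<noteq> UNIV \<and>
     (\<forall>P\<in>assoc_primes I. \<forall>Q\<in>assoc_primes I. height poly_ring P = height poly_ring Q)"


subsection \<open>Dimension of quotient spaces, Hilbert function and degree\<close>

text \<open>
  A basis of a quotient space \<open>V/W\<close> is given by representatives: \<open>indep_mod W B\<close> says that the
  elements of \<open>B\<close> have pairwise distinct and linearly independent classes modulo \<open>W\<close>.
\<close>

definition indep_mod :: "('n, 'k::field) mpoly set \<Rightarrow> ('n, 'k) mpoly set \<Rightarrow> bool"
  where "indep_mod W B \<longleftrightarrow>
    (\<forall>T c. finite T \<and> T \<subseteq> B \<and> (\<Sum>b\<in>T. scale_poly (c b) b) \<in> W \<longrightarrow> (\<forall>b\<in>T. c b = 0))"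

definition basis_mod ::
    "('n, 'k::field) mpoly set \<Rightarrow> ('n, 'k) mpoly set \<Rightarrow> ('n, 'k) mpoly set \<Rightarrow> bool"
  where "basis_mod V W B \<longleftrightarrow> B \<subseteq> V \<and> indep_mod W B \<and>
    (\<forall>v\<in>V. \<exists>T c. finite T \<and> T \<subseteq> B \<and> v - (\<Sum>b\<in>T. scale_poly (c b) b) \<in> W)"

text \<open>The dimension of \<open>V/W\<close>; infinite dimension yields \<open>0\<close>, as for \<open>card\<close>.\<close>

definition quot_dim :: "('n, 'k::field) mpoly set \<Rightarrow> ('n, 'k) mpoly set \<Rightarrow> nat"
  where "quot_dim V W = card (SOME B. basis_mod V W B)"

definition hilbert_fun :: "('n::finite, 'k::field) mpoly set \<Rightarrow> nat \<Rightarrow> nat"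
  where "hilbert_fun I d = quot_dim (homog d) (I \<inter> homog d)"

text \<open>The degree of \<open>S/I\<close>, as a function of \<open>I\<close>.\<close>

definition quot_degree :: "('n::finite, 'k::field) mpoly set \<Rightarrow> real"
  where "quot_degree I =
    (let k = the_enat (krull_dim (poly_ring Quot I)) in
     if k \<ge> 1 then fact (k - 1) * lim (\<lambda>d. real (hilbert_fun I d) / real d ^ (k - 1))
     else real (quot_dim UNIV I))"


subsection \<open>Generalized minimum distance function\<close>

definition gmd_sets :: "('n::finite, 'k::field) mpoly set \<Rightarrow> nat \<Rightarrow> nat \<Rightarrow> ('n, 'k) mpoly set set"
  where "gmd_sets I d r =
    {F. F \<subseteq> homog d \<and> finite F \<and> card F = r \<and> indep_mod I F \<and> colon I (ideal_gen F) \<noteq> I}"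

definition gmd :: "('n::finite, 'k::field) mpoly set \<Rightarrow> nat \<Rightarrow> nat \<Rightarrow> real"
  where "gmd I d r =
    (if gmd_sets I d r \<noteq> {}
     then quot_degree I - Max ((\<lambda>F. quot_degree (ideal_gen (I \<union> F))) ` gmd_sets I d r)
     else quot_degree I)"


subsection \<open>Monomial orders and the generalized footprint function\<close>

text \<open>The argument is the strict order; \<open>0\<close> is the exponent vector of the monomial \<open>1\<close>.\<close>

definition monomial_order :: "('n mon \<Rightarrow> 'n mon \<Rightarrow> bool) \<Rightarrow> bool"
  where "monomial_order lt \<longleftrightarrow> irreflp lt \<and> transp lt \<and> totalp lt \<and>
    (\<forall>u. u \<noteq> 0 \<longrightarrow> lt 0 u) \<and> (\<forall>u v w. lt u v \<longrightarrow> lt (u + w) (v + w))"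

text \<open>The initial monomial, meaningful for \<open>f \<noteq> 0\<close>.\<close>

definition init_mon :: "('n mon \<Rightarrow> 'n mon \<Rightarrow> bool) \<Rightarrow> ('n, 'k::field) mpoly \<Rightarrow> 'n mon"
  where "init_mon lt f = (THE m. m \<in> Poly_Mapping.keys f \<and> (\<forall>m'\<in>Poly_Mapping.keys f. m' \<noteq> m \<longrightarrow> lt m' m))"

definition init_ideal ::
    "('n mon \<Rightarrow> 'n mon \<Rightarrow> bool) \<Rightarrow> ('n, 'k::field) mpoly set \<Rightarrow> ('n, 'k) mpoly set"
  where "init_ideal lt I = ideal_gen {monom_poly (init_mon lt f) | f. f \<in> I \<and> f \<noteq> 0}"

definition std_monoms ::
    "('n::finite mon \<Rightarrow> 'n mon \<Rightarrow> bool) \<Rightarrow> ('n, 'k::field) mpoly set \<Rightarrow> nat \<Rightarrow> ('n, 'k) mpoly set"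
  where "std_monoms lt I d = {monom_poly m | m. mon_deg m = d} - init_ideal lt I"

definition fp_sets :: "('n::finite mon \<Rightarrow> 'n mon \<Rightarrow> bool) \<Rightarrow> ('n, 'k::field) mpoly set \<Rightarrow>
    nat \<Rightarrow> nat \<Rightarrow> ('n, 'k) mpoly set set"
  where "fp_sets lt I d r =
    {M. M \<subseteq> std_monoms lt I d \<and> finite M \<and> card M = r \<and>
        colon (init_ideal lt I) (ideal_gen M) \<noteq> init_ideal lt I}"

definition footprint :: "('n::finite mon \<Rightarrow> 'n mon \<Rightarrow> bool) \<Rightarrow> ('n, 'k::field) mpoly set \<Rightarrow>
    nat \<Rightarrow> nat \<Rightarrow> real"
  where "footprint lt I d r =
    (if fp_sets lt I d r \<noteq> {}
     then quot_degree I -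
       Max ((\<lambda>M. quot_degree (ideal_gen (init_ideal lt I \<union> M))) ` fp_sets lt I d r)
     else quot_degree I)"

end

theory Submission
  imports Defs
begin

text \<open>
  All dimensions and degrees are read off from initial monomials. For an order refining the total
  degree, the monomials of degree at most \<open>n\<close> outside the initial ideal of \<open>J\<close> form a basis of
  \<open>S/J\<close> in degree at most \<open>n\<close>; their number grows like \<open>D n ^ k / k!\<close>, where \<open>k\<close> is the largest
  number of variables that are algebraically independent modulo \<open>J\<close> and \<open>D \<ge> 1\<close> is an integer.
  If \<open>P \<subset> Q\<close> with \<open>P\<close> prime, multiplication by an element of \<open>Q - P\<close> shows that \<open>k\<close> drops.
  Conversely, extending \<open>P \<inter> K[V]\<close> to \<open>S\<close> for growing \<open>V\<close> gives a chain of primes of length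
  \<open>s - k\<close> below \<open>P\<close>, and adding variables to graded primes gives a chain of length \<open>k\<close> above a graded
  ideal. Hence \<open>k = dim S/J\<close>, \<open>ht P = s - k\<close>, and \<open>D = deg S/J\<close> for graded \<open>J\<close>.

  If \<open>I\<close> is unmixed and \<open>(I : F) \<noteq> I\<close>, then \<open>(I, F)\<close> lies in an associated prime of \<open>I\<close>, so
  \<open>S/(I, F)\<close> has the dimension of \<open>S/I\<close> and degrees are monotone in \<open>F\<close>; the kernel \<open>(I, F)/I\<close>
  contains a copy of \<open>S/P\<close> with \<open>P\<close> associated, so it has full dimension too and the degree drops
  strictly. For the footprint bound, replace \<open>F\<close> by initial monomials of the span of its normal forms.
\<close>

text \<open>Chains of primes may contain ideals that are not graded, so dimension cannot be measured
  in one degree at a time. Monomials are therefore counted up to degree \<open>n\<close>; the same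
  cones also yield the count in exact degree \<open>n\<close> on which the degree is based. The
  given order need not respect the total degree, so it is replaced by \<open>deg_refine\<close>,
  which compares degrees first. On homogeneous polynomials both orders select the same initial
  monomial, hence a graded ideal keeps its initial ideal. Growth and independence of variables match
  because a set of variables whose monomials all avoid the initial ideal is independent modulo
  \<open>J\<close>, while \<open>a\<close> independent variables force growth of order at least
  \<open>n ^ a\<close>. This takes the place of Noether normalization and makes the dimension
  monotone in the ideal. In (a) the initial ideal is not assumed to be unmixed, so its associated
  primes say nothing about the dimension of \<open>S/(in(I), M)\<close>. That dimension is squeezed
  between those of \<open>S/(I, F)\<close> and \<open>S/in(I)\<close>, which agree because
  \<open>I\<close> is unmixed.\<close>

abbreviation "lookup \<equiv> Poly_Mapping.lookup"
abbreviation "keys \<equiv> Poly_Mapping.keys"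
abbreviation "single \<equiv> Poly_Mapping.single"

\<comment> \<open>As a destruction rule it loops with \<open>in_keys_iff\<close> as a simplification rule.\<close>
declare lookup_eq_zero_in_keys_contradict [rule del]

subsection \<open>Ideals\<close>

text \<open>Stated with type class operations so that their simplification rules apply;
  \<open>ideal_iff\<close> and \<open>primeideal_iff\<close> translate from the notions of the
  theorem.\<close>

definition is_ideal :: "'a::comm_ring_1 set \<Rightarrow> bool"
  where "is_ideal I \<longleftrightarrow> 0 \<in> I \<and> (\<forall>a\<in>I. \<forall>b\<in>I. a + b \<in> I) \<and> (\<forall>a\<in>I. \<forall>r. r * a \<in> I)"

definition is_prime :: "'a::comm_ring_1 set \<Rightarrow> bool"
  where "is_prime P \<longleftrightarrow> is_ideal P \<and> P \<noteq> UNIV \<and> (\<forall>a b. a * b \<in> P \<longrightarrow> a \<in> P \<or> b \<in> P)"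

lemma ring_of_type_algebra_simps [simp]:
  "carrier (ring_of_type_algebra :: 'a::comm_ring_1 ring) = UNIV"
  "monoid.mult (ring_of_type_algebra :: 'a ring) = (*)"
  "add (ring_of_type_algebra :: 'a ring) = (+)"
  "one (ring_of_type_algebra :: 'a ring) = 1"
  "zero (ring_of_type_algebra :: 'a ring) = 0"
  by (simp_all add: ring_of_type_algebra_def)

lemma is_idealD:
  assumes "is_ideal I"
  shows "0 \<in> I" "a \<in> I \<Longrightarrow> b \<in> I \<Longrightarrow> a + b \<in> I" "a \<in> I \<Longrightarrow> r * a \<in> I" "a \<in> I \<Longrightarrow> a * r \<in> I"
    "a \<in> I \<Longrightarrow> - a \<in> I" "a \<in> I \<Longrightarrow> b \<in> I \<Longrightarrow> a - b \<in> I"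
proof -
  show 1: "0 \<in> I" "a \<in> I \<Longrightarrow> b \<in> I \<Longrightarrow> a + b \<in> I" "a \<in> I \<Longrightarrow> r * a \<in> I" for a b r
    using assms by (auto simp: is_ideal_def)
  show 2: "- a \<in> I" if "a \<in> I" for a using 1(3)[OF that, of "- 1"] by simp
  show "a \<in> I \<Longrightarrow> a * r \<in> I" using 1(3) by (simp add: mult.commute)
  show "a \<in> I \<Longrightarrow> b \<in> I \<Longrightarrow> a - b \<in> I" using 1(2)[of a "- b"] 2[of b] by simp
qed

lemma is_ideal_sum: "is_ideal I \<Longrightarrow> (\<And>i. i \<in> A \<Longrightarrow> f i \<in> I) \<Longrightarrow> sum f A \<in> I"
  by (induction A rule: infinite_finite_induct) (auto intro: is_idealD(1,2))

lemma is_ideal_UNIV_iff: "is_ideal I \<Longrightarrow> I = UNIV \<longleftrightarrow> 1 \<in> I"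
  using is_idealD(3)[of I 1] by (metis UNIV_I UNIV_eq_I mult.right_neutral)

lemma ideal_iff: "ideal I (ring_of_type_algebra :: 'a::comm_ring_1 ring) \<longleftrightarrow> is_ideal I"
proof
  assume "ideal I (ring_of_type_algebra :: 'a ring)"
  then interpret ideal I "ring_of_type_algebra :: 'a ring" .
  show "is_ideal I" unfolding is_ideal_def
    using I_l_closed additive_subgroup.a_closed[OF is_additive_subgroup]
      additive_subgroup.zero_closed[OF is_additive_subgroup] by simp
next
  assume I: "is_ideal I"
  show "ideal I (ring_of_type_algebra :: 'a ring)"
  proof (rule idealI[OF ring_from_type_algebra])
    show "subgroup I (add_monoid (ring_of_type_algebra :: 'a ring))"
    proof
      fix x assume "x \<in> I"
      have "inv\<^bsub>add_monoid (ring_of_type_algebra :: 'a ring)\<^esub> x = - x"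
        using abelian_group.minus_equality[OF ring.is_abelian_group[OF ring_from_type_algebra], of "- x" x]
        by (simp add: a_inv_def)
      then show "inv\<^bsub>add_monoid (ring_of_type_algebra :: 'a ring)\<^esub> x \<in> I"
        using is_idealD[OF I] \<open>x \<in> I\<close> by simp
    qed (use is_idealD[OF I] in auto)
  qed (use is_idealD[OF I] in auto)
qed

lemma primeideal_iff: "primeideal P (ring_of_type_algebra :: 'a::comm_ring_1 ring) \<longleftrightarrow> is_prime P"
proof
  assume "primeideal P (ring_of_type_algebra :: 'a ring)"
  then interpret primeideal P "ring_of_type_algebra :: 'a ring" .
  show "is_prime P" unfolding is_prime_def
    using I_notcarr I_prime is_ideal ideal_iff by auto
next
  assume P: "is_prime P"
  show "primeideal P (ring_of_type_algebra :: 'a ring)"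
    by (rule primeidealI) (use P in \<open>auto simp: is_prime_def ideal_iff cring_from_type_algebra\<close>)
qed

lemma ideal_gen:
  shows is_ideal_ideal_gen: "is_ideal (ideal_gen A)"
    and ideal_gen_superset: "A \<subseteq> ideal_gen A"
    and ideal_gen_least: "is_ideal J \<Longrightarrow> A \<subseteq> J \<Longrightarrow> ideal_gen A \<subseteq> J"
  unfolding ideal_gen_def
  using ring.genideal_ideal[OF ring_from_type_algebra, of A]
    ring.genideal_self[OF ring_from_type_algebra, of A]
    ring.genideal_minimal[OF ring_from_type_algebra, of J A]
  by (simp_all add: ideal_iff)

lemma is_ideal_colon: "is_ideal I \<Longrightarrow> is_ideal {g. g * f \<in> I}"
  unfolding is_ideal_def by (auto simp: algebra_simps)

lemma ideal_gen_insert: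
  assumes "is_ideal P"
  shows "ideal_gen (P \<union> {f}) = {p + g * f | p g. p \<in> P}"
proof
  have "is_ideal {p + g * f | p g. p \<in> P}"
    unfolding is_ideal_def
  proof (safe, goal_cases)
    case 1
    have "0 = 0 + 0 * f" by simp
    then show ?case using is_idealD(1)[OF assms] by blast
  next
    case (2 a b p p' g g')
    have "p + g * f + (p' + g' * f) = (p + p') + (g + g') * f" by (simp add: algebra_simps)
    then show ?case using is_idealD(2)[OF assms 2] by blast
  next
    case (3 a p g r)
    have "r * (p + g * f) = r * p + (r * g) * f" by (simp add: algebra_simps)
    then show ?case using is_idealD(3)[OF assms 3] by blast
  qed
  moreover have "p = p + 0 * f" "f = 0 + 1 * f" for p by simp_all
  then have "P \<subseteq> {p + g * f | p g. p \<in> P}" "f \<in> {p + g * f | p g. p \<in> P}"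
    using is_idealD(1)[OF assms] by blast+
  ultimately show "ideal_gen (P \<union> {f}) \<subseteq> {p + g * f | p g. p \<in> P}"
    by (intro ideal_gen_least) auto
  show "{p + g * f | p g. p \<in> P} \<subseteq> ideal_gen (P \<union> {f})"
    using ideal_gen_superset[of "P \<union> {f}"]
      is_idealD(2,3)[OF is_ideal_ideal_gen[of "P \<union> {f}"]] by auto
qed

text \<open>For fixed \<open>f\<close> the \<open>g\<close> with \<open>f * g\<close> in
  \<open>I\<close> form an ideal, so a condition on generators extends to the ideal they
  generate.\<close>

lemma colon_ideal_gen:
  assumes "is_ideal I"
  shows "colon I (ideal_gen A) = colon I A"
proof
  show "colon I (ideal_gen A) \<subseteq> colon I A"
    using ideal_gen_superset[of A] by (auto simp: colon_def)
  show "colon I A \<subseteq> colon I (ideal_gen A)"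
  proof
    fix f assume "f \<in> colon I A"
    then have "ideal_gen A \<subseteq> {g. g * f \<in> I}"
      by (intro ideal_gen_least is_ideal_colon assms) (auto simp: colon_def mult.commute)
    then show "f \<in> colon I (ideal_gen A)" by (auto simp: colon_def mult.commute)
  qed
qed

subsection \<open>Polynomials as a vector space\<close>

lemma lookup_scale_poly [simp]: "lookup (scale_poly c f) m = c * lookup f m"
  unfolding scale_poly_def mult_map_scale_conv_mult[symmetric]
  by (simp add: Poly_Mapping.map.rep_eq when_def)

lemma is_ideal_scale: "is_ideal I \<Longrightarrow> f \<in> I \<Longrightarrow> scale_poly c f \<in> I"
  by (simp add: scale_poly_def is_idealD)

lemma lookup_monom_poly [simp]: "lookup (monom_poly m) m' = (if m' = m then 1 else 0)"
  by (simp add: monom_poly_def lookup_single when_def)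

lemma keys_monom_poly [simp]: "keys (monom_poly m :: ('n,'k::field) mpoly) = {m}"
  by (simp add: monom_poly_def)

interpretation pvs: vector_space "scale_poly :: 'k::field \<Rightarrow> ('n, 'k) mpoly \<Rightarrow> ('n, 'k) mpoly"
  by standard (auto intro!: poly_mapping_eqI simp: lookup_add algebra_simps)

lemma scale_poly_mult_left: "scale_poly c (f * g) = scale_poly c f * g"
  by (simp add: scale_poly_def mult.assoc)

lemma scale_poly_mult_right: "scale_poly c (f * g) = f * scale_poly c g"
  by (simp add: scale_poly_def mult.left_commute)

lemma keys_scale_poly: "keys (scale_poly c f) \<subseteq> keys f"
  by (auto simp: in_keys_iff)

lemma mult_delta_right: "a * (if P then 1 else 0) = (if P then a else (0::'a::semiring_1))"
  by simp

lemma keys_sum_subset: "keys (sum f A) \<subseteq> (\<Union>i\<in>A. keys (f i))"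
proof
  fix m assume "m \<in> keys (sum f A)"
  then have "(\<Sum>i\<in>A. lookup (f i) m) \<noteq> 0" by (simp add: in_keys_iff lookup_sum)
  then obtain i where "i \<in> A" "lookup (f i) m \<noteq> 0" by (rule sum.not_neutral_contains_not_neutral)
  then show "m \<in> (\<Union>i\<in>A. keys (f i))" by (auto simp: lookup_not_eq_zero_eq_in_keys)
qed

lemma poly_expansion:
  assumes "finite Z" "keys f \<subseteq> Z"
  shows "f = (\<Sum>m\<in>Z. scale_poly (lookup f m) (monom_poly m))"
proof (rule poly_mapping_eqI)
  fix m
  have "lookup (\<Sum>m\<in>Z. scale_poly (lookup f m) (monom_poly m)) m
      = (\<Sum>u\<in>Z. if m = u then lookup f u else 0)"
    by (simp only: lookup_sum lookup_scale_poly lookup_monom_poly mult_delta_right)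
  also have "\<dots> = lookup f m"
    using assms by (cases "m \<in> Z") (auto simp: not_in_keys_iff_lookup_eq_zero[symmetric])
  finally show "lookup f m = lookup (\<Sum>m\<in>Z. scale_poly (lookup f m) (monom_poly m)) m" ..
qed

text \<open>The independence assumption also excludes repetitions in the family \<open>b\<close>.\<close>

lemma family_card_le:
  fixes b :: "'i \<Rightarrow> ('n, 'k::field) mpoly" and q :: "'j \<Rightarrow> ('n, 'k) mpoly"
  assumes fin: "finite S" "finite T"
    and ind: "\<And>c. (\<Sum>i\<in>S. scale_poly (c i) (b i)) = 0 \<Longrightarrow> \<forall>i\<in>S. c i = 0"
    and span: "\<And>i. i \<in> S \<Longrightarrow> \<exists>c. b i = (\<Sum>j\<in>T. scale_poly (c j) (q j))"
  shows "card S \<le> card T"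
proof -
  have inj: "inj_on b S"
  proof (rule inj_onI, rule ccontr)
    fix i j assume ij: "i \<in> S" "j \<in> S" "b i = b j" "i \<noteq> j"
    define c :: "'i \<Rightarrow> 'k" where "c = (\<lambda>k. if k = i then 1 else if k = j then - 1 else 0)"
    have "(\<Sum>k\<in>S. scale_poly (c k) (b k)) = (\<Sum>k\<in>{i,j}. scale_poly (c k) (b k))"
      using ij fin by (intro sum.mono_neutral_right) (auto simp: c_def)
    also have "\<dots> = 0" using ij by (simp add: c_def)
    finally have "c i = 0" using ind ij by blast
    then show False by (simp add: c_def)
  qed
  have "pvs.independent (b ` S)"
    unfolding pvs.independent_explicit_finite_subsets
  proof (intro allI impI ballI)
    fix B u v assume B: "B \<subseteq> b ` S" "finite B" and s: "(\<Sum>v\<in>B. scale_poly (u v) v) = 0" and v: "v \<in> B"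
    define c where "c = (\<lambda>i. if b i \<in> B then u (b i) else 0)"
    have "(\<Sum>i\<in>S. scale_poly (c i) (b i)) = (\<Sum>v\<in>b ` S. scale_poly (if v \<in> B then u v else 0) v)"
      by (simp add: sum.reindex[OF inj] c_def)
    also have "\<dots> = (\<Sum>v\<in>B. scale_poly (u v) v)"
      using B fin by (intro sum.mono_neutral_cong_right) auto
    finally have "\<forall>i\<in>S. c i = 0" using ind s by metis
    then show "u v = 0" using v B by (auto simp: c_def split: if_splits)
  qed
  moreover have "b ` S \<subseteq> pvs.span (q ` T)"
  proof clarify
    fix i assume "i \<in> S"
    then obtain c where c: "b i = (\<Sum>j\<in>T. scale_poly (c j) (q j))" using span by blast
    show "b i \<in> pvs.span (q ` T)" unfolding c
      by (intro pvs.span_sum pvs.span_scale pvs.span_base) auto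
  qed
  ultimately have "card (b ` S) \<le> card (q ` T)"
    using pvs.independent_span_bound fin by blast
  then show ?thesis using card_image[OF inj] card_image_le[OF fin(2), of q] by simp
qed

text \<open>One operation covers homogeneous components, truncations at a degree and components of
  other gradings. Applied to an exponent vector, \<open>part V m\<close> keeps the exponents of the
  variables in \<open>V\<close>.\<close>

definition part :: "'a set \<Rightarrow> ('a \<Rightarrow>\<^sub>0 'b::comm_monoid_add) \<Rightarrow> 'a \<Rightarrow>\<^sub>0 'b"
  where "part Z f = (\<Sum>m\<in>keys f \<inter> Z. single m (lookup f m))"

lemma lookup_part [simp]: "lookup (part Z f) m = (if m \<in> Z then lookup f m else 0)"
proof -
  have "lookup (part Z f) m = (\<Sum>u\<in>keys f \<inter> Z. if u = m then lookup f u else 0)"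
    by (simp only: part_def lookup_sum lookup_single when_def)
  then show ?thesis by (simp add: in_keys_iff)
qed

lemma keys_part: "keys (part Z f) = keys f \<inter> Z"
  by (auto simp: in_keys_iff split: if_splits)

lemma part_add [simp]: "part Z (f + g) = part Z f + part Z g"
  by (auto intro!: poly_mapping_eqI simp: lookup_add)

lemma part_minus: "part Z (f - g) = part Z f - part Z (g :: 'a \<Rightarrow>\<^sub>0 'b::ab_group_add)"
  by (auto intro!: poly_mapping_eqI simp: lookup_minus)

lemma part_scale: "part Z (scale_poly c f) = scale_poly c (part Z f)"
  by (auto intro!: poly_mapping_eqI)

lemma part_sum: "part Z (sum f A) = (\<Sum>i\<in>A. part Z (f i))"
  by (auto intro!: poly_mapping_eqI simp: lookup_sum)

lemma part_id: "keys f \<subseteq> Z \<Longrightarrow> part Z f = f"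
  by (rule poly_mapping_eqI) (auto simp: in_keys_iff)

lemma part_0: "keys f \<inter> Z = {} \<Longrightarrow> part Z f = 0"
  by (rule poly_mapping_eqI) (auto simp: in_keys_iff)

lemma homog_part_eq: "homog_part d f = part {m. mon_deg m = d} f"
  unfolding homog_part_def part_def by (rule sum.cong) auto

text \<open>Reading off the coefficients at \<open>Y\<close> is linear, and the hypothesis makes it
  injective on combinations of the family.\<close>

lemma card_le_by_coeffs:
  fixes b :: "'i \<Rightarrow> ('n, 'k::field) mpoly"
  assumes "finite S" "finite Y"
    and ind: "\<And>c. (\<And>m. m \<in> Y \<Longrightarrow> lookup (\<Sum>i\<in>S. scale_poly (c i) (b i)) m = 0) \<Longrightarrow> \<forall>i\<in>S. c i = 0"
  shows "card S \<le> card Y"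
proof (rule family_card_le[where b="\<lambda>i. part Y (b i)" and q="monom_poly"])
  fix c assume "(\<Sum>i\<in>S. scale_poly (c i) (part Y (b i))) = 0"
  then have z: "part Y (\<Sum>i\<in>S. scale_poly (c i) (b i)) = 0" by (simp add: part_sum part_scale)
  have "lookup (\<Sum>i\<in>S. scale_poly (c i) (b i)) m = 0" if "m \<in> Y" for m
    using arg_cong[OF z, of "\<lambda>p. lookup p m"] that by simp
  then show "\<forall>i\<in>S. c i = 0" by (rule ind)
next
  fix i show "\<exists>c. part Y (b i) = (\<Sum>j\<in>Y. scale_poly (c j) (monom_poly j))"
    using poly_expansion[OF assms(2), of "part Y (b i)"] keys_part[of Y "b i"] by blast
qed (use assms in auto)

lemma lookup_sum_monom:
  assumes "finite S" "m \<in> S"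
  shows "lookup (\<Sum>u\<in>S. scale_poly (c u) (monom_poly u)) m = c m"
proof -
  have "lookup (\<Sum>u\<in>S. scale_poly (c u) (monom_poly u)) m = (\<Sum>u\<in>S. if m = u then c u else 0)"
    by (simp only: lookup_sum lookup_scale_poly lookup_monom_poly mult_delta_right)
  then show ?thesis using assms by simp
qed

lemma sum_monom_eq_0D:
  assumes "finite S" "(\<Sum>u\<in>S. scale_poly (c u) (monom_poly u)) = 0"
  shows "\<forall>u\<in>S. c u = 0"
  using lookup_sum_monom[OF assms(1), where c=c] unfolding assms(2) by simp

lemma inj_monom_poly: "inj (monom_poly :: 'n mon \<Rightarrow> ('n, 'k::field) mpoly)"
proof (rule injI)
  fix x y :: "'n mon" assume "(monom_poly x :: ('n, 'k) mpoly) = monom_poly y"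
  then have "keys (monom_poly x :: ('n, 'k) mpoly) = keys (monom_poly y :: ('n, 'k) mpoly)" by simp
  then show "x = y" by simp
qed

lemma keys_linear_combination:
  assumes "\<And>i. i \<in> T \<Longrightarrow> keys (b i) \<subseteq> Z"
  shows "keys (\<Sum>i\<in>T. scale_poly (c i) (b i)) \<subseteq> Z"
  using keys_sum_subset[of "\<lambda>i. scale_poly (c i) (b i)" T] keys_scale_poly assms by blast

text \<open>\<open>quot_dim\<close> uses an arbitrary basis, so every basis has to be compared with
  the standard monomials. Replacing its elements by representatives supported on \<open>Std\<close>
  turns congruence modulo \<open>W\<close> into equality, and both inequalities become linear
  algebra in the span of \<open>Std\<close>.\<close>

lemma quot_dim_eqI:
  fixes V W :: "('n, 'k::field) mpoly set"
  assumes W: "pvs.subspace W" and fin: "finite Std" and std: "monom_poly ` Std \<subseteq> V"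
    and red: "\<And>v. v \<in> V \<Longrightarrow> \<exists>v'. v - v' \<in> W \<and> keys v' \<subseteq> Std"
    and indep: "\<And>w. w \<in> W \<Longrightarrow> keys w \<subseteq> Std \<Longrightarrow> w = 0"
  shows "quot_dim V W = card Std"
proof -
  define nf where "nf v = (SOME v'. v - v' \<in> W \<and> keys v' \<subseteq> Std)" for v
  have nf: "v - nf v \<in> W" "keys (nf v) \<subseteq> Std" if "v \<in> V" for v
    using someI_ex[OF red[OF that]] unfolding nf_def by auto
  have comb: "(\<Sum>b\<in>T. scale_poly (c b) b) - (\<Sum>b\<in>T. scale_poly (c b) (nf b)) \<in> W"
    if "T \<subseteq> V" for T and c :: "_ \<Rightarrow> 'k"
  proof -
    have "(\<Sum>b\<in>T. scale_poly (c b) b) - (\<Sum>b\<in>T. scale_poly (c b) (nf b))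
        = (\<Sum>b\<in>T. scale_poly (c b) (b - nf b))"
      by (simp add: pvs.scale_right_diff_distrib sum_subtractf)
    also have "\<dots> \<in> W"
      using that nf by (intro pvs.subspace_sum[OF W] pvs.subspace_scale[OF W]) auto
    finally show ?thesis .
  qed
  have card_eq: "card B = card Std" if B: "basis_mod V W B" for B
  proof (rule antisym)
    have BV: "B \<subseteq> V" and Bi: "indep_mod W B"
      and Bs: "\<And>v. v \<in> V \<Longrightarrow> \<exists>T c. finite T \<and> T \<subseteq> B \<and> v - (\<Sum>b\<in>T. scale_poly (c b) b) \<in> W"
      using B by (auto simp: basis_mod_def)
    \<comment> \<open>The basis is not known to be finite yet; a uniform bound on its finite subsets
      makes it so.\<close>
    have "card T \<le> card Std" if T: "T \<subseteq> B" "finite T" for T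
    proof (rule card_le_by_coeffs[where b=nf, OF T(2) fin])
      fix c assume z: "\<And>m. m \<in> Std \<Longrightarrow> lookup (\<Sum>b\<in>T. scale_poly (c b) (nf b)) m = 0"
      have k: "keys (\<Sum>b\<in>T. scale_poly (c b) (nf b)) \<subseteq> Std"
        using T BV by (intro keys_linear_combination nf(2)) auto
      have "(\<Sum>b\<in>T. scale_poly (c b) (nf b)) = 0"
      proof (rule poly_mapping_eqI)
        fix m
        show "lookup (\<Sum>b\<in>T. scale_poly (c b) (nf b)) m = lookup 0 m"
          using z[of m] subsetD[OF k, of m] by (cases "m \<in> Std") (simp_all only: lookup_zero in_keys_iff, blast)
      qed
      then have "(\<Sum>b\<in>T. scale_poly (c b) b) \<in> W"
        using comb[OF subset_trans[OF T(1) BV], of c] by (metis diff_zero)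
      then show "\<forall>b\<in>T. c b = 0" using Bi T by (auto simp: indep_mod_def)
    qed
    then have finB: "finite B" and "card B \<le> card Std"
      using finite_if_finite_subsets_card_bdd[of B "card Std"] by auto
    then show "card B \<le> card Std" by simp
    show "card Std \<le> card B"
    proof (rule family_card_le[where b="monom_poly :: _ \<Rightarrow> ('n, 'k) mpoly" and q=nf, OF fin finB])
      fix c :: "'n mon \<Rightarrow> 'k" assume "(\<Sum>m\<in>Std. scale_poly (c m) (monom_poly m)) = 0"
      then show "\<forall>i\<in>Std. c i = 0" by (rule sum_monom_eq_0D[OF fin])
    next
      fix m assume m: "m \<in> Std"
      then obtain T c where T: "finite T" "T \<subseteq> B" "monom_poly m - (\<Sum>b\<in>T. scale_poly (c b) b) \<in> W"
        using Bs[of "monom_poly m"] std by blast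
      define c' where "c' b = (if b \<in> T then c b else 0)" for b
      have eq: "(\<Sum>b\<in>B. scale_poly (c' b) (nf b)) = (\<Sum>b\<in>T. scale_poly (c b) (nf b))"
        using T finB by (intro sum.mono_neutral_cong_right) (auto simp: c'_def)
      have "(monom_poly m - (\<Sum>b\<in>T. scale_poly (c b) b))
          + ((\<Sum>b\<in>T. scale_poly (c b) b) - (\<Sum>b\<in>T. scale_poly (c b) (nf b))) \<in> W"
        using T BV by (intro pvs.subspace_add[OF W] comb) auto
      then have "monom_poly m - (\<Sum>b\<in>T. scale_poly (c b) (nf b)) \<in> W" by simp
      moreover have "keys (\<Sum>b\<in>T. scale_poly (c b) (nf b)) \<subseteq> Std"
        using T BV by (intro keys_linear_combination nf(2)) auto
      then have "keys (monom_poly m - (\<Sum>b\<in>T. scale_poly (c b) (nf b))) \<subseteq> Std"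
        using m keys_diff[of "monom_poly m :: ('n, 'k) mpoly" "\<Sum>b\<in>T. scale_poly (c b) (nf b)"] by auto
      ultimately have "monom_poly m - (\<Sum>b\<in>T. scale_poly (c b) (nf b)) = 0" by (rule indep)
      then have "monom_poly m = (\<Sum>b\<in>B. scale_poly (c' b) (nf b))" unfolding eq by (simp only: right_minus_eq)
      then show "\<exists>c. monom_poly m = (\<Sum>b\<in>B. scale_poly (c b) (nf b))" by blast
    qed
  qed
  have ex: "basis_mod V W (monom_poly ` Std)"
    unfolding basis_mod_def indep_mod_def
  proof (intro conjI allI impI ballI)
    fix T and c :: "_ \<Rightarrow> 'k" and b
    assume "finite T \<and> T \<subseteq> monom_poly ` Std \<and> (\<Sum>b\<in>T. scale_poly (c b) b) \<in> W" and bT: "b \<in> T"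
    then have T: "finite T" "T \<subseteq> monom_poly ` Std" "(\<Sum>b\<in>T. scale_poly (c b) b) \<in> W" by auto
    then obtain S where S: "S \<subseteq> Std" "T = monom_poly ` S" by (meson subset_imageE)
    have finS: "finite S" using S fin finite_subset by blast
    have eq: "(\<Sum>b\<in>T. scale_poly (c b) b) = (\<Sum>m\<in>S. scale_poly (c (monom_poly m)) (monom_poly m))"
      unfolding S by (subst sum.reindex) (auto intro: inj_on_subset[OF inj_monom_poly])
    have "keys (\<Sum>b\<in>T. scale_poly (c b) b) \<subseteq> Std"
      unfolding eq using S by (intro keys_linear_combination) auto
    then have "(\<Sum>b\<in>T. scale_poly (c b) b) = 0" using indep T by blast
    then show "c b = 0" using lookup_sum_monom[OF finS, of _ "\<lambda>m. c (monom_poly m)"] eq bT S by auto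
  next
    fix v assume "v \<in> V"
    then obtain v' where v': "v - v' \<in> W" "keys v' \<subseteq> Std" using red by blast
    have "(\<Sum>b\<in>monom_poly ` Std. scale_poly (lookup v' (inv_into UNIV monom_poly b)) b)
        = (\<Sum>m\<in>Std. scale_poly (lookup v' m) (monom_poly m))"
      by (subst sum.reindex) (auto intro: inj_on_subset[OF inj_monom_poly] simp: inv_f_f[OF inj_monom_poly])
    also have "\<dots> = v'" using poly_expansion[OF fin v'(2)] ..
    finally show "\<exists>T c. finite T \<and> T \<subseteq> monom_poly ` Std \<and> v - (\<Sum>b\<in>T. scale_poly (c b) b) \<in> W"
      using v' fin by (intro exI[of _ "monom_poly ` Std"] exI[of _ "\<lambda>b. lookup v' (inv_into UNIV monom_poly b)"]) auto
  qed (use std in auto)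
  show ?thesis unfolding quot_dim_def by (rule card_eq) (rule someI[of "basis_mod V W", OF ex])
qed

section \<open>Total degree of monomials\<close>

lemma mon_deg_add [simp]: "mon_deg (u + v) = mon_deg u + mon_deg v"
  by (simp add: mon_deg_def lookup_add sum.distrib)

lemma mon_deg_zero [simp]: "mon_deg 0 = 0"
  by (simp add: mon_deg_def)

lemma lookup_le_mon_deg: "lookup m i \<le> mon_deg (m :: 'n::finite mon)"
  unfolding mon_deg_def by (rule member_le_sum) auto

lemma mon_deg_eq_0_iff [simp]: "mon_deg (m :: 'n::finite mon) = 0 \<longleftrightarrow> m = 0"
  by (metis lookup_le_mon_deg lookup_zero le_zero_eq mon_deg_zero poly_mapping_eqI)

lemma finite_mon_deg_le [simp]: "finite {m :: 'n::finite mon. mon_deg m \<le> n}"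
proof (rule finite_imageD)
  show "finite (lookup ` {m :: 'n mon. mon_deg m \<le> n})"
  proof (rule finite_subset)
    show "lookup ` {m :: 'n mon. mon_deg m \<le> n} \<subseteq> PiE UNIV (\<lambda>_. {..n})"
      by (auto simp: PiE_def Pi_def) (metis lookup_le_mon_deg le_trans)
    show "finite (PiE (UNIV :: 'n set) (\<lambda>_. {..n}))" by (simp add: finite_PiE)
  qed
qed (auto intro: inj_onI poly_mapping_eqI)

lemma finite_mon_deg_eq [simp]: "finite {m :: 'n::finite mon. mon_deg m = n}"
  by (rule finite_subset[OF _ finite_mon_deg_le[of n]]) auto

lemma keys_mult_subset: "keys f \<subseteq> A \<Longrightarrow> keys g \<subseteq> B \<Longrightarrow> keys (f * g) \<subseteq> {a + b | a b. a \<in> A \<and> b \<in> B}"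
  using keys_mult[of f g] by blast

lemma keys_mult_deg_le:
  fixes f g :: "('n::finite, 'k::field) mpoly"
  assumes "keys f \<subseteq> {m. mon_deg m \<le> a}" "keys g \<subseteq> {m. mon_deg m \<le> b}"
  shows "keys (f * g) \<subseteq> {m. mon_deg m \<le> a + b}"
  using keys_mult_subset[OF assms] by auto

lemma homog_iff: "f \<in> homog d \<longleftrightarrow> keys f \<subseteq> {m. mon_deg m = d}"
  by (auto simp: homog_def)

subsection \<open>Monomial ideals\<close>

definition up_closed :: "'n mon set \<Rightarrow> bool"
  where "up_closed U \<longleftrightarrow> (\<forall>u\<in>U. \<forall>w. u + w \<in> U)"

definition mon_ideal :: "'n mon set \<Rightarrow> ('n, 'k::field) mpoly set"
  where "mon_ideal U = {f. keys f \<subseteq> U}"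

lemma is_ideal_mon_ideal: "up_closed U \<Longrightarrow> is_ideal (mon_ideal U :: ('n, 'k::field) mpoly set)"
  unfolding is_ideal_def mon_ideal_def
proof (intro conjI ballI allI)
  fix a b :: "('n, 'k) mpoly" assume ab: "a \<in> {f. keys f \<subseteq> U}" "b \<in> {f. keys f \<subseteq> U}"
  then show "a + b \<in> {f. keys f \<subseteq> U}" using keys_add[of a b] by blast
next
  fix a r :: "('n, 'k) mpoly" assume U: "up_closed U" and a: "a \<in> {f. keys f \<subseteq> U}"
  have "m \<in> U" if m: "m \<in> keys (r * a)" for m
  proof -
    obtain x y where "y \<in> keys a" "m = x + y" using keys_mult[of r a] m by auto
    then show ?thesis using U a by (metis add.commute mem_Collect_eq subsetD up_closed_def)
  qed
  then show "r * a \<in> {f. keys f \<subseteq> U}" by blast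
qed simp

lemma ideal_gen_monoms:
  assumes "up_closed U"
  shows "ideal_gen (monom_poly ` U) = (mon_ideal U :: ('n, 'k::field) mpoly set)"
proof
  show "ideal_gen (monom_poly ` U) \<subseteq> (mon_ideal U :: ('n, 'k) mpoly set)"
    by (rule ideal_gen_least[OF is_ideal_mon_ideal[OF assms]]) (auto simp: mon_ideal_def)
  show "(mon_ideal U :: ('n, 'k) mpoly set) \<subseteq> ideal_gen (monom_poly ` U)"
  proof
    fix f :: "('n, 'k) mpoly" assume "f \<in> mon_ideal U"
    then have "f = (\<Sum>m\<in>keys f. scale_poly (lookup f m) (monom_poly m))" "keys f \<subseteq> U"
      using poly_expansion[of "keys f" f] by (auto simp: mon_ideal_def)
    then show "f \<in> ideal_gen (monom_poly ` U)"
      using ideal_gen_superset[of "monom_poly ` U :: ('n, 'k) mpoly set"]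
      by (metis (no_types, lifting) image_subset_iff in_mono is_ideal_ideal_gen is_ideal_scale is_ideal_sum)
  qed
qed

lemma graded_idealI:
  "is_ideal I \<Longrightarrow> (\<And>f d. f \<in> I \<Longrightarrow> part {m. mon_deg m = d} f \<in> I) \<Longrightarrow> graded_ideal I"
  by (simp add: graded_ideal_def ideal_iff homog_part_eq)

lemma graded_idealD:
  assumes "graded_ideal I"
  shows "is_ideal I" "f \<in> I \<Longrightarrow> part {m. mon_deg m = d} f \<in> I"
  using assms by (auto simp: graded_ideal_def ideal_iff homog_part_eq)

lemma graded_mon_ideal: "up_closed U \<Longrightarrow> graded_ideal (mon_ideal U)"
  by (rule graded_idealI) (auto simp: is_ideal_mon_ideal, auto simp: mon_ideal_def keys_part)

subsection \<open>Initial monomials\<close>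

lemma finite_strict_max:
  assumes "\<And>a b c. prec a b \<Longrightarrow> prec b c \<Longrightarrow> prec a c" "\<And>a b. a \<noteq> b \<Longrightarrow> prec a b \<or> prec b a"
    and "finite A" "A \<noteq> {}"
  obtains m where "m \<in> A" "\<And>x. x \<in> A \<Longrightarrow> x \<noteq> m \<Longrightarrow> prec x m"
proof -
  have "\<exists>m\<in>A. \<forall>x\<in>A. x \<noteq> m \<longrightarrow> prec x m"
    using assms(3,4)
  proof (induction rule: finite_ne_induct)
    case (insert a A)
    then obtain m where m: "m \<in> A" "\<forall>x\<in>A. x \<noteq> m \<longrightarrow> prec x m" by blast
    show ?case
    proof (cases "prec m a")
      case True
      then have "\<forall>x\<in>insert a A. x \<noteq> a \<longrightarrow> prec x a" using m assms(1) True by (metis insertE)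
      then show ?thesis by blast
    next
      case False
      then have "\<forall>x\<in>insert a A. x \<noteq> m \<longrightarrow> prec x m" using m assms(2) by blast
      then show ?thesis using m by blast
    qed
  qed simp
  then show ?thesis using that by blast
qed

definition init_mons :: "('n mon \<Rightarrow> 'n mon \<Rightarrow> bool) \<Rightarrow> ('n, 'k::field) mpoly set \<Rightarrow> 'n mon set"
  where "init_mons lt J = {init_mon lt f | f. f \<in> J \<and> f \<noteq> 0}"

locale mon_order =
  fixes lt :: "'n mon \<Rightarrow> 'n mon \<Rightarrow> bool"
  assumes monomial_order: "monomial_order lt"
begin

lemma lt_irrefl [simp]: "\<not> lt u u"
  and lt_trans: "lt u v \<Longrightarrow> lt v w \<Longrightarrow> lt u w"
  and lt_total: "u \<noteq> v \<Longrightarrow> lt u v \<or> lt v u"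
  and lt_zero: "u \<noteq> 0 \<Longrightarrow> lt 0 u"
  and lt_add: "lt u v \<Longrightarrow> lt (u + w) (v + w)"
  and lt_add': "lt u v \<Longrightarrow> lt (w + u) (w + v)"
  using monomial_order unfolding monomial_order_def
  by (auto simp: irreflp_def add.commute dest: transpD totalpD)

lemma finite_max_exists:
  assumes "finite A" "A \<noteq> {}"
  obtains m where "m \<in> A" "\<And>x. x \<in> A \<Longrightarrow> x \<noteq> m \<Longrightarrow> lt x m"
  using finite_strict_max[of lt A] lt_trans lt_total assms by blast

lemma init_mon_eqI:
  assumes "m \<in> keys f" "\<And>m'. m' \<in> keys f \<Longrightarrow> m' \<noteq> m \<Longrightarrow> lt m' m"
  shows "init_mon lt f = m"
  unfolding init_mon_def
proof (rule the_equality)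
  fix x assume x: "x \<in> keys f \<and> (\<forall>m'\<in>keys f. m' \<noteq> x \<longrightarrow> lt m' x)"
  show "x = m" using assms x lt_trans lt_irrefl by metis
qed (use assms in auto)

lemma init_mon:
  assumes "f \<noteq> 0"
  shows init_mon_in_keys: "init_mon lt f \<in> keys f"
    and init_mon_max: "m \<in> keys f \<Longrightarrow> m \<noteq> init_mon lt f \<Longrightarrow> lt m (init_mon lt f)"
proof -
  have "keys f \<noteq> {}" using assms by (metis in_keys_iff empty_iff lookup_zero poly_mapping_eqI)
  then obtain m where m: "m \<in> keys f" "\<And>x. x \<in> keys f \<Longrightarrow> x \<noteq> m \<Longrightarrow> lt x m"
    using finite_max_exists[OF finite_keys] by metis
  then have "init_mon lt f = m" by (rule init_mon_eqI)
  then show "init_mon lt f \<in> keys f" "m' \<in> keys f \<Longrightarrow> m' \<noteq> init_mon lt f \<Longrightarrow> lt m' (init_mon lt f)" for m'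
    using m by auto
qed

lemma init_mon_monom [simp]: "init_mon lt (monom_poly m :: ('n, 'k::field) mpoly) = m"
  by (rule init_mon_eqI) auto

lemma monom_poly_nonzero [simp]: "(monom_poly m :: ('n, 'k::field) mpoly) \<noteq> 0"
  by (metis keys_monom_poly keys_zero insert_not_empty)

text \<open>No other pair of exponents has the same sum, since replacing either initial monomial by
  another exponent makes the sum strictly smaller.\<close>

lemma lookup_mult_init_mon:
  fixes f g :: "('n, 'k::field) mpoly"
  assumes "f \<noteq> 0" "g \<noteq> 0"
  shows "lookup (f * g) (init_mon lt f + init_mon lt g)
    = lookup f (init_mon lt f) * lookup g (init_mon lt g)"
proof -
  define a b where "a = init_mon lt f" and "b = init_mon lt g"
  have a: "\<And>m. m \<in> keys f \<Longrightarrow> m \<noteq> a \<Longrightarrow> lt m a" and b: "\<And>m. m \<in> keys g \<Longrightarrow> m \<noteq> b \<Longrightarrow> lt m b"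
    using init_mon assms by (auto simp: a_def b_def)
  define f' g' where "f' = part (- {a}) f" and "g' = part (- {b}) g"
  have f: "f = single a (lookup f a) + f'" and g: "g = single b (lookup g b) + g'"
    by (auto intro!: poly_mapping_eqI simp: f'_def g'_def lookup_add lookup_single when_def)
  have fa: "lt m a" if "m \<in> keys f'" for m using that a by (auto simp: f'_def keys_part)
  have gb: "lt m b" if "m \<in> keys g'" for m using that b by (auto simp: g'_def keys_part)
  have "a + b \<notin> keys (single a (lookup f a) * g')"
  proof
    assume "a + b \<in> keys (single a (lookup f a) * g')"
    then obtain y where "y \<in> keys g'" "a + b = a + y"
      using keys_mult[of "single a (lookup f a)" g'] by (auto split: if_splits)
    then show False using gb by fastforce
  qed
  moreover have "a + b \<notin> keys (f' * g)"
  proof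
    assume "a + b \<in> keys (f' * g)"
    then obtain x y where xy: "x \<in> keys f'" "y \<in> keys g" "a + b = x + y"
      using keys_mult[of f' g] by auto
    have "lt (x + y) (a + y)" using fa[OF xy(1)] lt_add by blast
    moreover have "y = b \<or> lt (a + y) (a + b)" using b xy(2) lt_add' by blast
    ultimately show False using xy(3) lt_trans lt_irrefl by metis
  qed
  moreover have "f * g = single a (lookup f a) * single b (lookup g b)
      + (single a (lookup f a) * g' + f' * g)"
    using f g by (metis add.assoc distrib_left distrib_right)
  then have "f * g = single (a + b) (lookup f a * lookup g b)
      + (single a (lookup f a) * g' + f' * g)" by (simp add: mult_single)
  ultimately show ?thesis
    unfolding a_def[symmetric] b_def[symmetric]
    by (simp add: lookup_add not_in_keys_iff_lookup_eq_zero)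
qed

lemma poly_no_zero_divisors:
  fixes f g :: "('n, 'k::field) mpoly"
  assumes "f \<noteq> 0" "g \<noteq> 0"
  shows "f * g \<noteq> 0"
  using lookup_mult_init_mon[OF assms] init_mon_in_keys[OF assms(1)] init_mon_in_keys[OF assms(2)]
  by (auto simp: in_keys_iff)

lemma init_mon_mult:
  fixes f g :: "('n, 'k::field) mpoly"
  assumes "f \<noteq> 0" "g \<noteq> 0"
  shows "init_mon lt (f * g) = init_mon lt f + init_mon lt g"
proof (rule init_mon_eqI)
  show "init_mon lt f + init_mon lt g \<in> keys (f * g)"
    using lookup_mult_init_mon[OF assms] init_mon_in_keys[OF assms(1)] init_mon_in_keys[OF assms(2)]
    by (simp add: in_keys_iff)
next
  fix m assume "m \<in> keys (f * g)" and ne: "m \<noteq> init_mon lt f + init_mon lt g"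
  then obtain x y where xy: "x \<in> keys f" "y \<in> keys g" "m = x + y"
    using keys_mult[of f g] by auto
  have "x = init_mon lt f \<or> lt (x + y) (init_mon lt f + y)"
    using init_mon_max[OF assms(1) xy(1)] lt_add by blast
  moreover have "y = init_mon lt g \<or> lt (init_mon lt f + y) (init_mon lt f + init_mon lt g)"
    using init_mon_max[OF assms(2) xy(2)] lt_add' by blast
  ultimately show "lt m (init_mon lt f + init_mon lt g)" using ne xy(3) lt_trans by metis
qed

lemma init_monsI: "f \<in> J \<Longrightarrow> f \<noteq> 0 \<Longrightarrow> init_mon lt f \<in> init_mons lt J"
  by (auto simp: init_mons_def)

lemma init_mons_mono: "I \<subseteq> J \<Longrightarrow> init_mons lt I \<subseteq> init_mons lt J"
  by (auto simp: init_mons_def)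

lemma up_closed_init_mons:
  fixes J :: "('n, 'k::field) mpoly set"
  assumes "is_ideal J"
  shows "up_closed (init_mons lt J)"
  unfolding up_closed_def
proof (intro ballI allI)
  fix u w assume "u \<in> init_mons lt J"
  then obtain f where f: "u = init_mon lt f" "f \<in> J" "f \<noteq> 0" by (auto simp: init_mons_def)
  have "init_mon lt (f * monom_poly w) = u + w" "f * monom_poly w \<noteq> 0"
    using init_mon_mult[OF f(3) monom_poly_nonzero] poly_no_zero_divisors[OF f(3) monom_poly_nonzero] f(1)
    by auto
  then show "u + w \<in> init_mons lt J"
    using init_monsI[of "f * monom_poly w" J] f is_idealD[OF assms] by auto
qed

text \<open>A nonzero element of \<open>J\<close> would have its own initial monomial among its
  exponents. This is what makes normal forms unique.\<close>

lemma init_mons_eq_0: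
  assumes "f \<in> J" "keys f \<inter> init_mons lt J = {}"
  shows "f = 0"
  using assms init_monsI init_mon_in_keys by blast

lemma init_mons_mon_ideal [simp]: "init_mons lt (mon_ideal U :: ('n, 'k::field) mpoly set) = U"
proof
  show "init_mons lt (mon_ideal U :: ('n, 'k) mpoly set) \<subseteq> U"
    using init_mon_in_keys by (auto simp: init_mons_def mon_ideal_def)
  show "U \<subseteq> init_mons lt (mon_ideal U :: ('n, 'k) mpoly set)"
  proof
    fix u assume "u \<in> U"
    then show "u \<in> init_mons lt (mon_ideal U :: ('n, 'k) mpoly set)"
      using init_monsI[of "monom_poly u :: ('n, 'k) mpoly" "mon_ideal U"] by (simp add: mon_ideal_def)
  qed
qed

lemma init_ideal_eq:
  fixes I :: "('n, 'k::field) mpoly set"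
  assumes "is_ideal I"
  shows "init_ideal lt I = mon_ideal (init_mons lt I)"
proof -
  have "{monom_poly (init_mon lt f) | f. f \<in> I \<and> f \<noteq> 0} = (monom_poly ` init_mons lt I :: ('n, 'k) mpoly set)"
    by (auto simp: init_mons_def)
  then show ?thesis
    unfolding init_ideal_def using ideal_gen_monoms[OF up_closed_init_mons[OF assms]] by simp
qed

lemma init_mons_UNIV [simp]: "init_mons lt (UNIV :: ('n, 'k::field) mpoly set) = UNIV"
  using init_mons_mon_ideal[of UNIV, where 'k='k] by (simp add: mon_ideal_def)

text \<open>The exponent \<open>0\<close> is the least monomial, so a polynomial with this initial
  monomial is a nonzero constant, hence a unit.\<close>

lemma zero_in_init_mons_iff:
  fixes J :: "('n, 'k::field) mpoly set"
  assumes "is_ideal J"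
  shows "0 \<in> init_mons lt J \<longleftrightarrow> J = UNIV"
proof
  assume "0 \<in> init_mons lt J"
  then obtain f where f: "f \<in> J" "f \<noteq> 0" "init_mon lt f = 0" by (auto simp: init_mons_def)
  have "m = 0" if "m \<in> keys f" for m
    using init_mon_max[OF f(2) that] f(3) lt_zero[of m] lt_trans[of 0 m 0] by auto
  moreover have "lookup f 0 \<noteq> 0" using init_mon_in_keys[OF f(2)] f(3) by (simp add: in_keys_iff)
  ultimately have "single 0 (inverse (lookup f 0)) * f = 1"
    unfolding mult_map_scale_conv_mult[symmetric]
    by (intro poly_mapping_eqI) (auto simp: Poly_Mapping.map.rep_eq lookup_one when_def in_keys_iff)
  then have "1 \<in> J" using is_idealD(3)[OF assms f(1)] by metis
  then show "J = UNIV" using is_ideal_UNIV_iff[OF assms] by blast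
qed simp

end

text \<open>The Hilbert functions are compared through orders that refine the total degree: then reduction
  modulo an ideal does not increase the degree, and every monomial has finitely many predecessors.\<close>

locale deg_order = mon_order lt for lt :: "'n::finite mon \<Rightarrow> 'n mon \<Rightarrow> bool" +
  assumes deg_mono: "lt u v \<Longrightarrow> mon_deg u \<le> mon_deg v"
begin

text \<open>Every monomial has finitely many predecessors, so the order embeds into the naturals and
  reduction can proceed by ordinary induction.\<close>

definition rank :: "'n mon \<Rightarrow> nat"
  where "rank m = card {x. lt x m}"

lemma finite_below: "finite {x. lt x m}"
  by (rule finite_subset[OF _ finite_mon_deg_le[of "mon_deg m"]]) (auto dest: deg_mono)

lemma rank_mono: "lt u v \<Longrightarrow> rank u < rank v"
  unfolding rank_def by (rule psubset_card_mono[OF finite_below]) (use lt_trans lt_irrefl in blast)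

lemma rank_inj: "rank u = rank v \<Longrightarrow> u = v"
  using lt_total rank_mono by fastforce

text \<open>Cancelling the largest reducible exponent \<open>m\<close> against an element of
  \<open>P\<close> with initial monomial \<open>m\<close> introduces only smaller exponents, so the
  bound \<open>N\<close> on the ranks of reducible exponents drops. Smaller exponents have no larger
  degree, which preserves every degree bound.\<close>

lemma reduction_exists:
  fixes P :: "('n, 'k::field) mpoly set"
  assumes P: "is_ideal P"
  shows "\<exists>v'. v - v' \<in> P \<and> keys v' \<inter> init_mons lt P = {} \<and>
    (\<forall>n. keys v \<subseteq> {m. mon_deg m \<le> n} \<longrightarrow> keys v' \<subseteq> {m. mon_deg m \<le> n})"
proof -
  have "\<exists>v'. v - v' \<in> P \<and> keys v' \<inter> init_mons lt P = {} \<and>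
    (\<forall>n. keys v \<subseteq> {m. mon_deg m \<le> n} \<longrightarrow> keys v' \<subseteq> {m. mon_deg m \<le> n})"
    if "\<forall>m\<in>keys v \<inter> init_mons lt P. rank m < N" for N v
    using that
  proof (induction N arbitrary: v)
    case 0
    then show ?case using is_idealD(1)[OF P] by (intro exI[of _ v]) auto
  next
    case (Suc N)
    show ?case
    proof (cases "\<exists>m\<in>keys v \<inter> init_mons lt P. rank m = N")
      case False
      then have "\<forall>m\<in>keys v \<inter> init_mons lt P. rank m < N" using Suc.prems by (metis less_SucE)
      then show ?thesis by (rule Suc.IH)
    next
      case True
      then obtain m where m: "m \<in> keys v" "m \<in> init_mons lt P" "rank m = N" by blast
      then obtain f where f: "f \<in> P" "f \<noteq> 0" "init_mon lt f = m" by (auto simp: init_mons_def)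
      define c where "c = lookup v m / lookup f m"
      define w where "w = v - scale_poly c f"
      have "lookup f m \<noteq> 0" using init_mon_in_keys[OF f(2)] f(3) by (simp add: in_keys_iff)
      then have "lookup w m = 0" by (simp add: w_def c_def lookup_minus)
      then have mw: "m \<notin> keys w" by (simp add: in_keys_iff)
      have kw: "x \<in> keys v \<or> lt x m" if "x \<in> keys w" for x
      proof -
        have "x \<in> keys v \<or> x \<in> keys f" "x \<noteq> m"
          using that keys_diff[of v "scale_poly c f"] keys_scale_poly[of c f] mw by (auto simp: w_def)
        then show ?thesis using init_mon_max[OF f(2)] f(3) by blast
      qed
      have "\<forall>x\<in>keys w \<inter> init_mons lt P. rank x < N"
      proof
        fix x assume x: "x \<in> keys w \<inter> init_mons lt P"
        then consider "x \<in> keys v" "x \<noteq> m" | "lt x m" using kw mw by blast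
        then show "rank x < N"
        proof cases
          case 1
          then show ?thesis using Suc.prems x m(3) rank_inj by (metis IntD2 IntI less_SucE)
        qed (use rank_mono m in auto)
      qed
      then obtain v' where v': "w - v' \<in> P" "keys v' \<inter> init_mons lt P = {}"
        "\<And>n. keys w \<subseteq> {m. mon_deg m \<le> n} \<Longrightarrow> keys v' \<subseteq> {m. mon_deg m \<le> n}"
        using Suc.IH by blast
      have "v - v' = (w - v') + scale_poly c f" by (simp add: w_def)
      then have "v - v' \<in> P" using is_idealD(2)[OF P v'(1)] is_ideal_scale[OF P f(1)] by metis
      moreover have "keys w \<subseteq> {m. mon_deg m \<le> n}" if "keys v \<subseteq> {m. mon_deg m \<le> n}" for n
      proof
        fix x assume "x \<in> keys w"
        then have "x \<in> keys v \<or> mon_deg x \<le> mon_deg m" using kw deg_mono by blast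
        then show "x \<in> {m. mon_deg m \<le> n}" using that m(1) by fastforce
      qed
      ultimately show ?thesis using v' by (intro exI[of _ v']) auto
    qed
  qed
  moreover have "\<forall>m\<in>keys v \<inter> init_mons lt P. rank m < Suc (Max (rank ` keys v))"
    by (auto simp: less_Suc_eq_le)
  ultimately show ?thesis by blast
qed

definition nf :: "('n, 'k::field) mpoly set \<Rightarrow> ('n, 'k) mpoly \<Rightarrow> ('n, 'k) mpoly"
  where "nf P v = (SOME v'. v - v' \<in> P \<and> keys v' \<inter> init_mons lt P = {} \<and>
    (\<forall>n. keys v \<subseteq> {m. mon_deg m \<le> n} \<longrightarrow> keys v' \<subseteq> {m. mon_deg m \<le> n}))"

lemma nf:
  fixes P :: "('n, 'k::field) mpoly set"
  assumes "is_ideal P"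
  shows nf_cong: "v - nf P v \<in> P"
    and keys_nf: "keys (nf P v) \<inter> init_mons lt P = {}"
    and nf_deg: "keys v \<subseteq> {m. mon_deg m \<le> n} \<Longrightarrow> keys (nf P v) \<subseteq> {m. mon_deg m \<le> n}"
  using someI_ex[OF reduction_exists[OF assms, of v]] unfolding nf_def by blast+

lemma nf_unique:
  fixes P :: "('n, 'k::field) mpoly set"
  assumes P: "is_ideal P" and "v - w \<in> P" "keys w \<inter> init_mons lt P = {}"
  shows "nf P v = w"
proof -
  have "(v - w) - (v - nf P v) \<in> P" using is_idealD(6)[OF P] assms nf_cong[OF P] by blast
  then have "nf P v - w \<in> P" by simp
  moreover have "keys (nf P v - w) \<inter> init_mons lt P = {}"
    using keys_diff[of "nf P v" w] keys_nf[OF P, of v] assms(3) by blast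
  ultimately show ?thesis using init_mons_eq_0 by (metis eq_iff_diff_eq_0)
qed

lemma nf_eq_0_iff:
  fixes P :: "('n, 'k::field) mpoly set"
  assumes "is_ideal P"
  shows "nf P v = 0 \<longleftrightarrow> v \<in> P"
  using nf_cong[OF assms, of v] nf_unique[OF assms, of v 0] by auto

lemma nf_diff_eq:
  fixes P :: "('n, 'k::field) mpoly set"
  assumes "is_ideal P" "v - w \<in> P"
  shows "nf P v = nf P w"
proof (rule nf_unique[OF assms(1)])
  have "(v - w) + (w - nf P w) \<in> P" using assms nf_cong is_idealD(2) by blast
  then show "v - nf P w \<in> P" by simp
qed (rule keys_nf[OF assms(1)])

lemma nf_linear:
  fixes P :: "('n, 'k::field) mpoly set"
  assumes P: "is_ideal P"
  shows "nf P (\<Sum>i\<in>T. scale_poly (c i) (b i)) = (\<Sum>i\<in>T. scale_poly (c i) (nf P (b i)))"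
proof (rule nf_unique[OF P])
  have "(\<Sum>i\<in>T. scale_poly (c i) (b i)) - (\<Sum>i\<in>T. scale_poly (c i) (nf P (b i)))
      = (\<Sum>i\<in>T. scale_poly (c i) (b i - nf P (b i)))"
    by (simp add: pvs.scale_right_diff_distrib sum_subtractf)
  also have "\<dots> \<in> P" by (intro is_ideal_sum is_ideal_scale nf_cong P)
  finally show "(\<Sum>i\<in>T. scale_poly (c i) (b i)) - (\<Sum>i\<in>T. scale_poly (c i) (nf P (b i))) \<in> P" .
  have "keys (\<Sum>i\<in>T. scale_poly (c i) (nf P (b i))) \<subseteq> - init_mons lt P"
    using keys_nf[OF P] by (intro keys_linear_combination) blast
  then show "keys (\<Sum>i\<in>T. scale_poly (c i) (nf P (b i))) \<inter> init_mons lt P = {}" by blast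
qed

text \<open>The normal form modulo \<open>P\<close> of an element of \<open>Q\<close> lies in
  \<open>Q\<close> but avoids every initial monomial of \<open>Q\<close>, so it vanishes.\<close>

lemma ideal_eq_of_init_mons_eq:
  fixes P Q :: "('n, 'k::field) mpoly set"
  assumes "is_ideal P" "is_ideal Q" "P \<subseteq> Q" "init_mons lt Q \<subseteq> init_mons lt P"
  shows "P = Q"
proof
  show "Q \<subseteq> P"
  proof
    fix q assume q: "q \<in> Q"
    have "q - (q - nf P q) \<in> Q" using q nf_cong[OF assms(1)] assms is_idealD(6)[OF assms(2)] by blast
    then have "nf P q = 0"
      using keys_nf[OF assms(1), of q] assms(4) by (intro init_mons_eq_0[of _ Q]) auto
    then show "q \<in> P" using nf_eq_0_iff[OF assms(1)] by blast
  qed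
qed (rule assms)

text \<open>Take normal forms modulo \<open>P\<close> of the family. A nonzero combination of them
  lies in \<open>Q\<close> and has its initial monomial in the set on the right, so its coefficients
  there cannot all vanish.\<close>

lemma card_le_init_mons_diff:
  fixes P Q :: "('n, 'k::field) mpoly set" and b :: "'i \<Rightarrow> ('n, 'k) mpoly"
  assumes PQ: "is_ideal P" "is_ideal Q" "P \<subseteq> Q" and "finite T"
    and b: "\<And>i. i \<in> T \<Longrightarrow> b i \<in> Q" "\<And>i. i \<in> T \<Longrightarrow> keys (b i) \<subseteq> {m. mon_deg m \<le> n}"
    and ind: "\<And>c. (\<Sum>i\<in>T. scale_poly (c i) (b i)) \<in> P \<Longrightarrow> \<forall>i\<in>T. c i = 0"
  shows "card T \<le> card {m. mon_deg m \<le> n \<and> m \<in> init_mons lt Q - init_mons lt P}"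
proof (rule card_le_by_coeffs[where b="\<lambda>i. nf P (b i)", OF \<open>finite T\<close>])
  show "finite {m. mon_deg m \<le> n \<and> m \<in> init_mons lt Q - init_mons lt P}"
    by (rule finite_subset[OF _ finite_mon_deg_le[of n]]) auto
  fix c
  let ?v = "\<Sum>i\<in>T. scale_poly (c i) (nf P (b i))"
  assume z: "\<And>m. m \<in> {m. mon_deg m \<le> n \<and> m \<in> init_mons lt Q - init_mons lt P} \<Longrightarrow> lookup ?v m = 0"
  have "b i - (b i - nf P (b i)) \<in> Q" if "i \<in> T" for i
    using b(1)[OF that] nf_cong[OF PQ(1)] PQ(3) is_idealD(6)[OF PQ(2)] by blast
  then have vQ: "?v \<in> Q" by (intro is_ideal_sum is_ideal_scale PQ(2)) simp
  have vn: "keys ?v \<subseteq> {m. mon_deg m \<le> n}" by (intro keys_linear_combination nf_deg PQ(1) b(2))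
  have vP: "keys ?v \<subseteq> - init_mons lt P" using keys_nf[OF PQ(1)] by (intro keys_linear_combination) blast
  have "?v = 0"
  proof (rule ccontr)
    assume "?v \<noteq> 0"
    then have "init_mon lt ?v \<in> keys ?v" "init_mon lt ?v \<in> init_mons lt Q"
      using init_mon_in_keys init_monsI vQ by blast+
    then show False using z vn vP by (force simp: in_keys_iff)
  qed
  then have "nf P (\<Sum>i\<in>T. scale_poly (c i) (b i)) = 0" using nf_linear[OF PQ(1)] by metis
  then show "\<forall>i\<in>T. c i = 0" using nf_eq_0_iff[OF PQ(1)] ind by blast
qed

text \<open>Dual to \<open>card_le_init_mons_diff\<close>: elements of \<open>Q\<close> with
  distinct initial monomials outside \<open>init_mons lt P\<close> are independent modulo
  \<open>P\<close>, so a family that spans modulo \<open>P\<close> bounds their number.\<close>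

lemma init_mons_diff_card_le:
  fixes P Q :: "('n, 'k::field) mpoly set" and b :: "'i \<Rightarrow> ('n, 'k) mpoly"
  assumes PQ: "is_ideal P" and "finite T"
    and sp: "\<And>q. q \<in> Q \<Longrightarrow> keys q \<subseteq> {m. mon_deg m \<le> n} \<Longrightarrow> \<exists>c. q - (\<Sum>i\<in>T. scale_poly (c i) (b i)) \<in> P"
  shows "card {m. mon_deg m \<le> n \<and> m \<in> init_mons lt Q - init_mons lt P} \<le> card T"
proof -
  let ?Y = "{m. mon_deg m \<le> n \<and> m \<in> init_mons lt Q - init_mons lt P}"
  have finY: "finite ?Y" by (rule finite_subset[OF _ finite_mon_deg_le[of n]]) auto
  define q where "q m = (SOME f. f \<in> Q \<and> f \<noteq> 0 \<and> init_mon lt f = m)" for m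
  have "q m \<in> Q \<and> q m \<noteq> 0 \<and> init_mon lt (q m) = m" if "m \<in> init_mons lt Q" for m
  proof -
    have "\<exists>f. f \<in> Q \<and> f \<noteq> 0 \<and> init_mon lt f = m" using that by (auto simp: init_mons_def)
    then show ?thesis unfolding q_def by (rule someI_ex)
  qed
  then have q: "\<And>m. m \<in> ?Y \<Longrightarrow> q m \<in> Q" "\<And>m. m \<in> ?Y \<Longrightarrow> q m \<noteq> 0"
    "\<And>m. m \<in> ?Y \<Longrightarrow> init_mon lt (q m) = m" by blast+
  show ?thesis
  proof (rule family_card_le[where b="\<lambda>m. nf P (q m)" and q="\<lambda>i. nf P (b i)", OF finY \<open>finite T\<close>])
    fix c assume "(\<Sum>m\<in>?Y. scale_poly (c m) (nf P (q m))) = 0"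
    then have gP: "(\<Sum>m\<in>?Y. scale_poly (c m) (q m)) \<in> P"
      using nf_linear[OF PQ, of c q ?Y] nf_eq_0_iff[OF PQ] by simp
    show "\<forall>m\<in>?Y. c m = 0"
    proof (rule ccontr)
      assume "\<not> (\<forall>m\<in>?Y. c m = 0)"
      then have "{m\<in>?Y. c m \<noteq> 0} \<noteq> {}" by blast
      moreover have "finite {m\<in>?Y. c m \<noteq> 0}" by (rule finite_subset[OF _ finY]) blast
      ultimately have "finite {m\<in>?Y. c m \<noteq> 0}" "{m\<in>?Y. c m \<noteq> 0} \<noteq> {}" by blast+
      \<comment> \<open>\<open>a\<close> will be the initial monomial of the combination, as every
        other \<open>q m\<close> that occurs has a smaller one. The combination lies in
        \<open>P\<close>, which contradicts \<open>a\<close> being in \<open>?Y\<close>.\<close>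
      then obtain a where a: "a \<in> {m\<in>?Y. c m \<noteq> 0}"
        and amax: "\<And>x. x \<in> {m\<in>?Y. c m \<noteq> 0} \<Longrightarrow> x \<noteq> a \<Longrightarrow> lt x a"
        by (rule finite_max_exists) (rule that)
      let ?g = "\<Sum>m\<in>?Y. scale_poly (c m) (q m)"
      have small: "lookup (q m) a = 0" if "m \<in> ?Y" "c m \<noteq> 0" "m \<noteq> a" for m
      proof (rule ccontr)
        assume "lookup (q m) a \<noteq> 0"
        then have "a \<in> keys (q m)" by (simp add: in_keys_iff)
        then have "a = m \<or> lt a m" using init_mon_max[OF q(2)[OF that(1)]] q(3)[OF that(1)] by metis
        then show False using amax[of m] that lt_trans[of a m a] by auto
      qed
      have "lookup ?g a = (\<Sum>m\<in>?Y. c m * lookup (q m) a)" by (simp add: lookup_sum)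
      also have "\<dots> = (\<Sum>m\<in>{a}. c m * lookup (q m) a)"
      proof (rule sum.mono_neutral_right[OF finY])
        show "\<forall>m\<in>?Y - {a}. c m * lookup (q m) a = 0"
        proof
          fix m assume "m \<in> ?Y - {a}"
          then have "c m = 0 \<or> lookup (q m) a = 0" using small[of m] by blast
          then show "c m * lookup (q m) a = 0" by auto
        qed
      qed (use a in blast)
      finally have la: "lookup ?g a \<noteq> 0"
        using a init_mon_in_keys[OF q(2), of a] q(3)[of a] by (auto simp: in_keys_iff)
      have "init_mon lt ?g = a"
      proof (rule init_mon_eqI)
        show "a \<in> keys ?g" using la by (simp add: in_keys_iff)
        fix x assume "x \<in> keys ?g" "x \<noteq> a"
        then have "lookup ?g x \<noteq> 0" by (simp add: in_keys_iff)
        then have "(\<Sum>m\<in>?Y. c m * lookup (q m) x) \<noteq> 0" by (simp add: lookup_sum)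
        then obtain m where m: "m \<in> ?Y" "c m * lookup (q m) x \<noteq> 0"
          by (rule sum.not_neutral_contains_not_neutral)
        then have xm: "x \<in> keys (q m)" and cm: "c m \<noteq> 0" by (auto simp: in_keys_iff)
        have "x = m \<or> lt x m" using init_mon_max[OF q(2)[OF m(1)] xm] q(3)[OF m(1)] by metis
        moreover have "m = a \<or> lt m a" using amax[of m] m(1) cm by blast
        ultimately show "lt x a" using \<open>x \<noteq> a\<close> lt_trans by blast
      qed
      moreover have "?g \<noteq> 0"
      proof
        assume "?g = 0"
        then show False using la by (simp only: lookup_zero) blast
      qed
      ultimately have "a \<in> init_mons lt P" using init_monsI[OF gP] by argo
      then show False using a by blast
    qed
  next
    fix m assume m: "m \<in> ?Y"
    have "keys (q m) \<subseteq> {m. mon_deg m \<le> n}"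
    proof
      fix x assume "x \<in> keys (q m)"
      then have "x = m \<or> lt x m" using init_mon_max[OF q(2)[OF m], of x] q(3)[OF m] by metis
      then show "x \<in> {m. mon_deg m \<le> n}" using m deg_mono[of x m] by auto
    qed
    then obtain c where "q m - (\<Sum>i\<in>T. scale_poly (c i) (b i)) \<in> P" using sp q(1)[OF m] by blast
    then have "nf P (q m) = (\<Sum>i\<in>T. scale_poly (c i) (nf P (b i)))"
      using nf_diff_eq[OF PQ] nf_linear[OF PQ] by metis
    then show "\<exists>c. nf P (q m) = (\<Sum>i\<in>T. scale_poly (c i) (nf P (b i)))" by blast
  qed
qed

lemma subspace_ideal: "is_ideal (I :: ('n, 'k::field) mpoly set) \<Longrightarrow> pvs.subspace I"
  by (auto intro!: pvs.subspaceI intro: is_idealD is_ideal_scale)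

lemma subspace_homog: "pvs.subspace (homog d :: ('n, 'k::field) mpoly set)"
  using keys_scale_poly keys_add by (intro pvs.subspaceI) (fastforce simp: homog_iff)+

lemma hilbert_fun_eq:
  fixes I :: "('n, 'k::field) mpoly set"
  assumes "graded_ideal I"
  shows "hilbert_fun I d = card {m. mon_deg m = d \<and> m \<notin> init_mons lt I}"
  unfolding hilbert_fun_def
proof (rule quot_dim_eqI)
  note I = graded_idealD[OF assms]
  show "pvs.subspace (I \<inter> homog d)" by (intro pvs.subspace_inter subspace_ideal subspace_homog I)
  show "finite {m. mon_deg m = d \<and> m \<notin> init_mons lt I}"
    by (rule finite_subset[OF _ finite_mon_deg_eq[of d]]) auto
  show "monom_poly ` {m. mon_deg m = d \<and> m \<notin> init_mons lt I} \<subseteq> homog d" by (auto simp: homog_iff)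
  fix v :: "('n, 'k) mpoly"
  {
    assume v: "v \<in> homog d"
    \<comment> \<open>\<open>nf\<close> is only known to respect upper bounds on the degree; its
      component of degree \<open>d\<close> still represents \<open>v\<close> because
      \<open>I\<close> is graded.\<close>
    let ?w = "part {m. mon_deg m = d} (nf I v)"
    have "v - ?w = part {m. mon_deg m = d} (v - nf I v)"
      using v by (simp add: part_minus part_id homog_iff)
    also have "\<dots> \<in> I" using nf_cong[OF I(1)] I(2) by blast
    finally have "v - ?w \<in> I" .
    moreover have "v - ?w \<in> homog d"
      using v keys_diff[of v ?w] by (auto simp: homog_iff keys_part)
    ultimately show "\<exists>v'. v - v' \<in> I \<inter> homog d \<and> keys v' \<subseteq> {m. mon_deg m = d \<and> m \<notin> init_mons lt I}"
      using keys_nf[OF I(1), of v] by (intro exI[of _ ?w]) (auto simp: keys_part)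
  }
  {
    assume "v \<in> I \<inter> homog d" "keys v \<subseteq> {m. mon_deg m = d \<and> m \<notin> init_mons lt I}"
    then show "v = 0" using init_mons_eq_0 by blast
  }
qed

lemma quot_dim_UNIV_eq:
  fixes I :: "('n, 'k::field) mpoly set"
  assumes I: "is_ideal I" and fin: "finite (- init_mons lt I)"
  shows "quot_dim UNIV I = card (- init_mons lt I)"
proof (rule quot_dim_eqI[OF subspace_ideal[OF I] fin])
  show "\<exists>v'. v - v' \<in> I \<and> keys v' \<subseteq> - init_mons lt I" for v
    using nf_cong[OF I, of v] keys_nf[OF I, of v] by blast
  show "w = 0" if "w \<in> I" "keys w \<subseteq> - init_mons lt I" for w
    using init_mons_eq_0[OF that(1)] that(2) by blast
qed simp

end

subsection \<open>Dickson's lemma and counting monomials outside an up-closed set\<close>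

text \<open>A monotone subsequence exists; if it decreases, it is constant once it has reached its
  minimum.\<close>

lemma nat_incseq_subsequence: "\<exists>s. strict_mono s \<and> incseq (\<lambda>i. h (s i))" for h :: "nat \<Rightarrow> nat"
proof -
  obtain f where f: "strict_mono f" "monoseq (\<lambda>n. h (f n))" using seq_monosub by blast
  show ?thesis
  proof (cases "incseq (\<lambda>n. h (f n))")
    case False
    then have dec: "h (f n) \<le> h (f m)" if "m \<le> n" for m n
      using f(2) that by (auto simp: monoseq_def incseq_def)
    define k where "k = (LEAST k. \<exists>N. h (f N) = k)"
    have "\<exists>N. h (f N) = k" unfolding k_def by (rule LeastI_ex) blast
    then obtain N where N: "h (f N) = k" ..
    have "k \<le> h (f n)" for n unfolding k_def by (rule Least_le) blast
    then have "h (f (N + n)) = k" for n using dec[of N "N + n"] N by (simp add: antisym)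
    then have "incseq (\<lambda>i. h (f (N + i)))" by (simp add: incseq_def)
    moreover have "strict_mono (\<lambda>i. f (N + i))" using f(1) by (simp add: strict_mono_def)
    ultimately show ?thesis by (intro exI[of _ "\<lambda>i. f (N + i)"]) auto
  qed (use f in blast)
qed

text \<open>Passing to subsequences for one variable after the other makes all exponents weakly
  increasing; then each member divides the later ones.\<close>

lemma dickson:
  fixes g :: "nat \<Rightarrow> 'n::finite mon"
  obtains i j w where "i < j" "g j = g i + w"
proof -
  have "\<exists>s. strict_mono s \<and> (\<forall>x\<in>V. incseq (\<lambda>i. lookup (g (s i)) x))" if "finite V" for V
    using that
  proof induction
    case empty
    then show ?case by (intro exI[of _ id]) (auto simp: strict_mono_def)
  next
    case (insert x V)
    then obtain s where s: "strict_mono s" "\<forall>x\<in>V. incseq (\<lambda>i. lookup (g (s i)) x)" by blast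
    obtain t where t: "strict_mono t" "incseq (\<lambda>i. lookup (g (s (t i))) x)"
      using nat_incseq_subsequence[of "\<lambda>i. lookup (g (s i)) x"] by blast
    have "incseq (\<lambda>i. lookup (g (s (t i))) y)" if "y \<in> V" for y
      using s(2) that t(1) by (auto simp: incseq_def strict_mono_less_eq)
    then show ?case using s t by (intro exI[of _ "\<lambda>i. s (t i)"]) (auto simp: strict_mono_def)
  qed
  from this[of UNIV] obtain s where s: "strict_mono s" "\<And>x. incseq (\<lambda>i. lookup (g (s i)) x)" by auto
  have "lookup (g (s 0)) x \<le> lookup (g (s 1)) x" for x using s(2)[of x] by (simp add: incseq_def)
  then have "g (s 1) = g (s 0) + (g (s 1) - g (s 0))"
    by (intro poly_mapping_eqI) (simp add: lookup_add lookup_minus)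
  moreover have "s 0 < s 1" using s(1) by (simp add: strict_mono_def)
  ultimately show ?thesis using that by blast
qed

text \<open>The ascending chain condition for monomial ideals. If the chain kept growing, some
  monomial that enters late would be a multiple of one that entered earlier, and so would have been
  there already.\<close>

lemma up_closed_chain_stable:
  fixes U :: "nat \<Rightarrow> 'n::finite mon set"
  assumes up: "\<And>i. up_closed (U i)" and inc: "incseq U"
  obtains N where "\<And>n. n \<ge> N \<Longrightarrow> U n = U N"
proof (rule ccontr)
  assume "\<not> thesis"
  then have "\<forall>N. \<exists>n m. n > N \<and> m \<in> U n \<and> m \<notin> U N"
    using that inc unfolding incseq_def by (metis le_neq_implies_less subset_antisym subset_iff)
  then obtain nx mm where nm: "\<And>N. nx N > N" "\<And>N. mm N \<in> U (nx N)" "\<And>N. mm N \<notin> U N" by metis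
  \<comment> \<open>The monomial \<open>mm (s k)\<close> is missing at stage \<open>s k\<close> and
    present at stage \<open>s (Suc k)\<close>.\<close>
  define s where "s k = (nx ^^ k) 0" for k
  have sS: "s (Suc k) = nx (s k)" for k by (simp add: s_def)
  have "strict_mono s" unfolding strict_mono_Suc_iff sS using nm by blast
  obtain i j w where ij: "i < j" "mm (s j) = mm (s i) + w" using dickson[of "\<lambda>k. mm (s k)"] by blast
  have "s (Suc i) \<le> s j" using \<open>strict_mono s\<close> ij(1) by (simp add: strict_mono_less_eq)
  then have "mm (s i) \<in> U (s j)" using nm(2)[of "s i"] inc sS by (auto simp: incseq_def)
  then have "mm (s j) \<in> U (s j)" using up[of "s j"] ij(2) by (auto simp: up_closed_def)
  then show False using nm(3) by blast
qed

lemma mon_deg_single [simp]: "mon_deg (single x i) = i"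
  by (simp add: mon_deg_def lookup_single when_def)

lemma split_variable:
  fixes m :: "'n mon"
  assumes "keys m \<subseteq> insert x V"
  obtains m' where "m = m' + single x (lookup m x)" "keys m' \<subseteq> V"
proof
  let ?m' = "m - single x (lookup m x)"
  show "m = ?m' + single x (lookup m x)"
    by (rule poly_mapping_eqI) (simp add: lookup_add lookup_minus lookup_single when_def)
  have "lookup ?m' x = 0" by (simp add: lookup_minus)
  moreover have "lookup ?m' y = lookup m y" if "y \<noteq> x" for y
    using that by (simp add: lookup_minus lookup_single when_def)
  ultimately show "keys ?m' \<subseteq> V" using assms by (metis in_keys_iff insertE subsetD subsetI)
qed

definition mon_count :: "'n::finite set \<Rightarrow> 'n mon set \<Rightarrow> nat \<Rightarrow> nat"
  where "mon_count V U n = card {m. keys m \<subseteq> V \<and> mon_deg m = n \<and> m \<notin> U}"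

lemma finite_mon_count_set: "finite {m :: 'n::finite mon. keys m \<subseteq> V \<and> mon_deg m = n \<and> m \<notin> U}"
  by (rule finite_subset[OF _ finite_mon_deg_eq[of n]]) auto

lemma mon_count_insert:
  fixes x :: "'n::finite"
  assumes x: "x \<notin> V"
  shows "mon_count (insert x V) U n = (\<Sum>i\<le>n. mon_count V {m. m + single x i \<in> U} (n - i))"
proof -
  define S where "S i = {m. keys m \<subseteq> V \<and> mon_deg m = n - i \<and> m \<notin> {m. m + single x i \<in> U}}" for i
  have lx: "lookup m x = 0" if "keys m \<subseteq> V" for m using that x by (metis in_keys_iff subsetD)
  have "{m. keys m \<subseteq> insert x V \<and> mon_deg m = n \<and> m \<notin> U} = (\<Union>i\<in>{..n}. (\<lambda>m. m + single x i) ` S i)"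
  proof (intro equalityI subsetI)
    fix m assume "m \<in> {m. keys m \<subseteq> insert x V \<and> mon_deg m = n \<and> m \<notin> U}"
    then have m: "keys m \<subseteq> insert x V" "mon_deg m = n" "m \<notin> U" by auto
    then obtain m' i where eq: "m = m' + single x i" and "keys m' \<subseteq> V" using split_variable by metis
    moreover have "mon_deg m = mon_deg m' + i" by (subst eq) simp
    ultimately have "m' \<in> S i" "i \<le> n" using m eq by (auto simp: S_def)
    then show "m \<in> (\<Union>i\<in>{..n}. (\<lambda>m. m + single x i) ` S i)" using eq by blast
  next
    fix m assume "m \<in> (\<Union>i\<in>{..n}. (\<lambda>m. m + single x i) ` S i)"
    then obtain i m' where "i \<le> n" "m' \<in> S i" "m = m' + single x i" by auto
    then show "m \<in> {m. keys m \<subseteq> insert x V \<and> mon_deg m = n \<and> m \<notin> U}"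
      using keys_add[of m' "single x i"] by (auto simp: S_def split: if_splits)
  qed
  moreover have "card (\<Union>i\<in>{..n}. (\<lambda>m. m + single x i) ` S i) = (\<Sum>i\<le>n. card ((\<lambda>m. m + single x i) ` S i))"
  proof (rule card_UN_disjoint)
    show "\<forall>i\<in>{..n}. finite ((\<lambda>m. m + single x i) ` S i)"
      unfolding S_def using finite_mon_count_set by blast
    show "\<forall>i\<in>{..n}. \<forall>j\<in>{..n}. i \<noteq> j \<longrightarrow> (\<lambda>m. m + single x i) ` S i \<inter> (\<lambda>m. m + single x j) ` S j = {}"
    proof (intro ballI impI equals0I)
      fix i j m assume ij: "i \<noteq> j" and "m \<in> (\<lambda>m. m + single x i) ` S i \<inter> (\<lambda>m. m + single x j) ` S j"
      then obtain a b where "a \<in> S i" "b \<in> S j" "m = a + single x i" "m = b + single x j" by auto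
      then have "lookup m x = lookup a x + i" "lookup m x = lookup b x + j" "lookup a x = 0" "lookup b x = 0"
        using lx[of a] lx[of b] lookup_add[of a "single x i" x] lookup_add[of b "single x j" x]
        by (simp_all add: S_def)
      then show False using ij by simp
    qed
  qed simp
  moreover have "card ((\<lambda>m. m + single x i) ` S i) = mon_count V {m. m + single x i \<in> U} (n - i)" for i
    unfolding mon_count_def S_def[symmetric] by (rule card_image) (auto intro: inj_onI)
  ultimately show ?thesis by (simp add: mon_count_def)
qed

text \<open>The number of monomials of degree \<open>n\<close> in \<open>a\<close> variables.\<close>

definition pcount :: "nat \<Rightarrow> nat \<Rightarrow> nat"
  where "pcount a n = (case a of 0 \<Rightarrow> if n = 0 then 1 else 0 | Suc b \<Rightarrow> (n + b) choose b)"

lemma pcount_0 [simp]: "pcount 0 n = (if n = 0 then 1 else 0)"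
  and pcount_Suc [simp]: "pcount (Suc b) n = (n + b) choose b"
  by (simp_all add: pcount_def)

text \<open>The hockey-stick identity; zero variables are a separate case because
  \<open>pcount 0\<close> is not a binomial coefficient.\<close>

lemma sum_pcount: "(\<Sum>i\<le>n. pcount a i) = pcount (Suc a) n"
proof (cases a)
  case (Suc b)
  then show ?thesis by (induction n) simp_all
qed (induction n, auto)

text \<open>A pair \<open>(c, b)\<close> stands for the translate of a \<open>b\<close>-dimensional coordinate cone whose apex
  has degree \<open>c\<close>.\<close>

definition cone_count :: "(nat \<times> nat) list \<Rightarrow> nat \<Rightarrow> nat"
  where "cone_count L n = (\<Sum>(c, b)\<leftarrow>L. if c \<le> n then pcount b (n - c) else 0)"

lemma cone_count_Nil [simp]: "cone_count [] n = 0"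
  and cone_count_Cons [simp]: "cone_count ((c, b) # L) n = (if c \<le> n then pcount b (n - c) else 0) + cone_count L n"
  and cone_count_append [simp]: "cone_count (L @ L') n = cone_count L n + cone_count L' n"
  by (simp_all add: cone_count_def)

lemma sum_shift: "(\<Sum>i\<le>(n::nat). if c \<le> i then f (i - c) else (0::nat)) = (if c \<le> n then (\<Sum>i\<le>n - c. f i) else 0)"
proof (cases "c \<le> n")
  case True
  have "(\<Sum>i\<le>n. if c \<le> i then f (i - c) else 0) = (\<Sum>i\<in>{c..n}. f (i - c))"
    by (rule sum.mono_neutral_cong_right) auto
  also have "\<dots> = (\<Sum>i\<le>n - c. f i)"
    by (rule sum.reindex_bij_witness[of _ "\<lambda>i. i + c" "\<lambda>i. i - c"]) (use True in auto)
  finally show ?thesis using True by simp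
qed (auto intro: sum.neutral)

text \<open>Summing over degrees adds a free direction to every cone. This serves both the unbounded
  direction in \<open>cone_decomposition\<close> and the count up to degree
  \<open>n\<close>.\<close>

lemma sum_cone_count: "(\<Sum>i\<le>n. cone_count L i) = cone_count (map (\<lambda>(c, b). (c, Suc b)) L) n"
proof (induction L)
  case (Cons p L)
  obtain c b where p: "p = (c, b)" by fastforce
  have "(\<Sum>i\<le>n. cone_count (p # L) i)
      = (\<Sum>i\<le>n. if c \<le> i then pcount b (i - c) else 0) + (\<Sum>i\<le>n. cone_count L i)"
    by (simp add: p sum.distrib)
  then show ?case using Cons sum_shift[of c "pcount b" n] sum_pcount[of b "n - c"] by (simp add: p)
qed simp

lemma cone_count_shift:
  "cone_count (map (\<lambda>(c, b). (c + i, b)) L) n = (if i \<le> n then cone_count L (n - i) else 0)"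
  by (induction L) (auto simp: add.commute)

lemma cone_count_concat: "cone_count (concat Ls) n = (\<Sum>L\<leftarrow>Ls. cone_count L n)"
  by (induction Ls) auto

text \<open>These \<open>A\<close> are the coordinate subspaces on which all monomials of
  \<open>U\<close> vanish.\<close>

definition free_set :: "'n mon set \<Rightarrow> 'n set \<Rightarrow> bool"
  where "free_set U A \<longleftrightarrow> (\<forall>m. keys m \<subseteq> A \<longrightarrow> m \<notin> U)"

text \<open>Stanley decomposition: slice along a new variable \<open>x\<close>; by Dickson's lemma the slices are
  eventually constant, and the constant tail contributes cones that are open in direction \<open>x\<close>.\<close>

lemma cone_decomposition:
  fixes U :: "'n::finite mon set"
  assumes "finite V" "up_closed U"
  shows "\<exists>L. (\<forall>p\<in>set L. snd p \<subseteq> V \<and> free_set U (snd p)) \<and>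
    (\<forall>n. mon_count V U n = cone_count (map (\<lambda>(c, A). (c, card A)) L) n)"
  using assms
proof (induction arbitrary: U)
  case empty
  have s: "{m. m = 0 \<and> mon_deg m = n \<and> m \<notin> U} = (if n = 0 \<and> 0 \<notin> U then {0} else {})" for n by auto
  show ?case
  proof (cases "0 \<in> U")
    case True
    then show ?thesis by (intro exI[of _ "[]"]) (simp add: mon_count_def s)
  next
    case False
    then show ?thesis by (intro exI[of _ "[(0, {})]"]) (simp add: mon_count_def s free_set_def)
  qed
next
  case (insert x V)
  define W where "W i = {m. m + single x i \<in> U}" for i
  have add_single: "m + single x j = (m + single x i) + single x (j - i)" if "i \<le> j" for m and i j :: nat
    using that single_add[of x i "j - i"] by (simp add: add.assoc)
  have upW: "up_closed (W i)" for i
    unfolding up_closed_def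
  proof (intro ballI allI)
    fix u w assume "u \<in> W i"
    moreover have "(u + w) + single x i = (u + single x i) + w" by (simp add: ac_simps)
    ultimately show "u + w \<in> W i" using insert.prems by (simp add: up_closed_def W_def)
  qed
  have incW: "incseq W" unfolding incseq_def
  proof (intro allI impI subsetI)
    fix i j m assume "i \<le> j" "m \<in> W i"
    then show "m \<in> W j" using insert.prems add_single[of i j m] by (simp add: up_closed_def W_def)
  qed
  obtain N where N: "\<And>n. n \<ge> N \<Longrightarrow> W n = W N" using up_closed_chain_stable[OF upW incW] by blast
  have "\<forall>i. \<exists>L. (\<forall>p\<in>set L. snd p \<subseteq> V \<and> free_set (W i) (snd p)) \<and>
    (\<forall>n. mon_count V (W i) n = cone_count (map (\<lambda>(c, A). (c, card A)) L) n)"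
    using insert.IH[OF upW] by blast
  then obtain L where L: "\<And>i p. p \<in> set (L i) \<Longrightarrow> snd p \<subseteq> V \<and> free_set (W i) (snd p)"
    "\<And>i n. mon_count V (W i) n = cone_count (map (\<lambda>(c, A). (c, card A)) (L i)) n" by metis
  define M where "M i = map (\<lambda>(c, A). (c, card A)) (L i)" for i
  define R where "R = concat (map (\<lambda>i. map (\<lambda>(c, A). (c + i, A)) (L i)) [0..<N])
    @ map (\<lambda>(c, A). (c + N, insert x A)) (L N)"
  have R1: "snd p \<subseteq> insert x V \<and> free_set U (snd p)" if "p \<in> set R" for p
  proof -
    have "(\<exists>i. \<exists>q\<in>set (L i). snd p = snd q) \<or> (\<exists>q\<in>set (L N). snd p = insert x (snd q))"
      using that by (auto simp: R_def case_prod_unfold) force+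
    then consider i c A where "(c, A) \<in> set (L i)" "snd p = A" | c A where "(c, A) \<in> set (L N)" "snd p = insert x A"
      by (metis prod.collapse)
    then show ?thesis
    proof cases
      case 1
      have "m \<in> W i" if "m \<in> U" for m using that insert.prems by (auto simp: W_def up_closed_def)
      then show ?thesis using L(1)[OF 1(1)] 1(2) unfolding free_set_def by auto
    next
      case 2
      have "m \<notin> U" if m: "keys m \<subseteq> insert x A" for m
      proof
        assume "m \<in> U"
        obtain m' j where eq: "m = m' + single x j" and "keys m' \<subseteq> A" using split_variable[OF m] .
        moreover have "m' \<in> W j" using \<open>m \<in> U\<close> eq by (simp add: W_def)
        \<comment> \<open>Before \<open>N\<close> the slices increase towards \<open>W N\<close>,
          afterwards they equal it; so a cone avoiding \<open>W N\<close> may be extended without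
          bound in direction \<open>x\<close>.\<close>
        then have "m' \<in> W N"
          using N[of j] incseqD[OF incW, of j N] by (cases "N \<le> j") auto
        ultimately show False using L(1)[OF 2(1)] by (auto simp: free_set_def)
      qed
      then show ?thesis using L(1)[OF 2(1)] 2(2) by (auto simp: free_set_def)
    qed
  qed
  have xA: "x \<notin> A" if "(c, A) \<in> set (L N)" for c A using L(1)[OF that] insert.hyps by auto
  have R2: "mon_count (insert x V) U n = cone_count (map (\<lambda>(c, A). (c, card A)) R) n" for n
  proof -
    have tail: "map (\<lambda>(c, A). (c, card A)) (map (\<lambda>(c, A). (c + N, insert x A)) (L N))
        = map (\<lambda>(c, b). (c + N, b)) (map (\<lambda>(c, b). (c, Suc b)) (M N))"
      using xA by (auto simp: M_def)
    have init: "map (\<lambda>(c, A). (c, card A)) (concat (map (\<lambda>i. map (\<lambda>(c, A). (c + i, A)) (L i)) [0..<N]))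
        = concat (map (\<lambda>i. map (\<lambda>(c, b). (c + i, b)) (M i)) [0..<N])"
      by (simp add: map_concat M_def case_prod_unfold comp_def)
    have "mon_count (insert x V) U n = (\<Sum>i\<le>n. mon_count V (W i) (n - i))"
      unfolding W_def by (rule mon_count_insert[OF insert.hyps(2)])
    also have "\<dots> = (\<Sum>i\<le>n. (if i < N then cone_count (M i) (n - i) else 0)
        + (if N \<le> i then cone_count (M N) (n - i) else 0))"
    proof (rule sum.cong[OF refl])
      fix i
      have "mon_count V (W i) (n - i) = cone_count (M N) (n - i)" if "N \<le> i"
        using N[OF that] L(2)[of N] by (simp add: M_def)
      then show "mon_count V (W i) (n - i) = (if i < N then cone_count (M i) (n - i) else 0)
          + (if N \<le> i then cone_count (M N) (n - i) else 0)"
        using L(2)[of i] by (auto simp: M_def)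
    qed
    also have "\<dots> = (\<Sum>i\<le>n. if i < N then cone_count (M i) (n - i) else 0)
        + (\<Sum>i\<le>n. if N \<le> i then cone_count (M N) (n - i) else 0)" by (rule sum.distrib)
    also have "(\<Sum>i\<le>n. if i < N then cone_count (M i) (n - i) else 0)
        = (\<Sum>i<N. if i \<le> n then cone_count (M i) (n - i) else 0)"
    proof -
      have "(\<Sum>i\<le>n. if i < N then cone_count (M i) (n - i) else 0) = (\<Sum>i\<in>{..n} \<inter> {..<N}. cone_count (M i) (n - i))"
        by (rule sum.mono_neutral_cong_right) auto
      also have "\<dots> = (\<Sum>i<N. if i \<le> n then cone_count (M i) (n - i) else 0)"
        by (rule sum.mono_neutral_cong_left) auto
      finally show ?thesis .
    qed
    also have "(\<Sum>i\<le>n. if N \<le> i then cone_count (M N) (n - i) else 0)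
        = (if N \<le> n then (\<Sum>i\<le>n - N. cone_count (M N) i) else 0)"
    proof (cases "N \<le> n")
      case True
      have "(\<Sum>i\<le>n. if N \<le> i then cone_count (M N) (n - i) else 0) = (\<Sum>i\<in>{N..n}. cone_count (M N) (n - i))"
        by (rule sum.mono_neutral_cong_right) auto
      also have "\<dots> = (\<Sum>i\<le>n - N. cone_count (M N) i)"
        by (rule sum.reindex_bij_witness[of _ "\<lambda>i. n - i" "\<lambda>i. n - i"]) (use True in auto)
      finally show ?thesis using True by simp
    qed (auto intro: sum.neutral)
    finally have "mon_count (insert x V) U n = (\<Sum>i<N. if i \<le> n then cone_count (M i) (n - i) else 0)
        + (if N \<le> n then (\<Sum>i\<le>n - N. cone_count (M N) i) else 0)" .
    then show ?thesis
      unfolding R_def map_append cone_count_append tail init cone_count_shift sum_cone_count[symmetric]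
      by (simp add: cone_count_concat cone_count_shift comp_def
          interv_sum_list_conv_sum_set_nat atLeast0LessThan)
  qed
  show ?case using R1 R2 by blast
qed

text \<open>Consecutive binomial coefficients have ratio \<open>(n + a + 1) / (a + 1)\<close>, which
  tends to \<open>1 / (a + 1)\<close> after division by \<open>n\<close>.\<close>

lemma pcount_asymp: "(\<lambda>n. real (pcount (Suc a) n) / real n ^ a) \<longlonglongrightarrow> 1 / fact a"
proof (induction a)
  case (Suc a)
  have eq: "real (pcount (Suc (Suc a)) n) / real n ^ Suc a
      = real (pcount (Suc a) n) / real n ^ a * ((1 + real (Suc a) / real n) / real (Suc a))" if "n > 0" for n
  proof -
    have "Suc a * ((n + Suc a) choose Suc a) = (n + Suc a) * ((n + a) choose a)"
      using Suc_times_binomial_eq[of "n + a" a] by simp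
    then have main: "real (Suc a) * real ((n + Suc a) choose Suc a) = (real n + real (Suc a)) * real ((n + a) choose a)"
      by (metis of_nat_add of_nat_mult)
    have aux: "A / (N * p) = B / p * ((1 + s / N) / s)"
      if "s * A = (N + s) * B" "s > 0" "N > 0" for A B N s p :: real
    proof -
      have "A / (N * p) = (s * A) / (s * (N * p))" using that(2) by simp
      also have "\<dots> = ((N + s) * B) / (s * (N * p))" by (simp only: that(1))
      also have "\<dots> = B / p * (((N + s) / N) / s)" by (simp add: mult_ac)
      also have "(N + s) / N = 1 + s / N" using that by (simp add: field_simps)
      finally show ?thesis .
    qed
    show ?thesis unfolding pcount_Suc power_Suc by (rule aux[OF main]) (use that in simp_all)
  qed
  have "(\<lambda>n. real (pcount (Suc a) n) / real n ^ a * ((1 + real (Suc a) / real n) / real (Suc a)))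
      \<longlonglongrightarrow> 1 / fact a * ((1 + 0) / real (Suc a))"
    by (intro tendsto_intros Suc.IH lim_const_over_n) simp
  then have "(\<lambda>n. real (pcount (Suc (Suc a)) n) / real n ^ Suc a) \<longlonglongrightarrow> 1 / fact a * ((1 + 0) / real (Suc a))"
  proof (rule Lim_transform_eventually)
    show "\<forall>\<^sub>F n in sequentially. real (pcount (Suc a) n) / real n ^ a * ((1 + real (Suc a) / real n) / real (Suc a))
        = real (pcount (Suc (Suc a)) n) / real n ^ Suc a"
      using eventually_gt_at_top[of 0] by eventually_elim (rule eq[symmetric])
  qed
  then show ?case by (simp add: field_simps)
qed simp

lemma cone_term_asymp:
  assumes "b \<le> Suc k"
  shows "(\<lambda>n. real (if c \<le> n then pcount b (n - c) else 0) / real n ^ k)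
    \<longlonglongrightarrow> (if b = Suc k then 1 / fact k else 0)"
proof (cases b)
  case 0
  have "\<forall>\<^sub>F n in sequentially. real (if c \<le> n then pcount b (n - c) else 0) / real n ^ k = 0"
    using eventually_gt_at_top[of c] by eventually_elim (simp add: 0)
  then show ?thesis using 0 by (simp add: tendsto_eventually)
next
  case (Suc a)
  then have ak: "a \<le> k" using assms by simp
  have "(\<lambda>n. real (pcount (Suc a) (n - c)) / real (n - c) ^ a) \<longlonglongrightarrow> 1 / fact a"
    using filterlim_compose[OF pcount_asymp filterlim_minus_const_nat_at_top] .
  moreover have "(\<lambda>n. (1 - real c / real n) ^ a) \<longlonglongrightarrow> (1 - 0) ^ a"
    by (intro tendsto_intros lim_const_over_n)
  \<comment> \<open>The limit \<open>0 ^ (k - a)\<close> is \<open>1\<close> for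
    \<open>a = k\<close> and \<open>0\<close> otherwise; this factor separates the cones of
    dimension \<open>Suc k\<close> from the smaller ones.\<close>
  moreover have "(\<lambda>n. (1 / real n) ^ (k - a)) \<longlonglongrightarrow> 0 ^ (k - a)"
    by (intro tendsto_intros lim_const_over_n)
  ultimately have "(\<lambda>n. real (pcount (Suc a) (n - c)) / real (n - c) ^ a * (1 - real c / real n) ^ a * (1 / real n) ^ (k - a))
      \<longlonglongrightarrow> 1 / fact a * (1 - 0) ^ a * 0 ^ (k - a)"
    by (intro tendsto_mult)
  moreover have "\<forall>\<^sub>F n in sequentially. real (pcount (Suc a) (n - c)) / real (n - c) ^ a * (1 - real c / real n) ^ a * (1 / real n) ^ (k - a)
      = real (if c \<le> n then pcount b (n - c) else 0) / real n ^ k"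
    using eventually_gt_at_top[of c]
  proof eventually_elim
    case (elim n)
    have "(1 - real c / real n) = real (n - c) / real n" using elim by (simp add: field_simps of_nat_diff)
    moreover have "real n ^ k = real n ^ a * real n ^ (k - a)" using ak by (simp flip: power_add)
    ultimately show ?case using elim Suc by (simp add: power_divide)
  qed
  ultimately have "(\<lambda>n. real (if c \<le> n then pcount b (n - c) else 0) / real n ^ k)
      \<longlonglongrightarrow> 1 / fact a * (1 - 0) ^ a * 0 ^ (k - a)"
    by (rule Lim_transform_eventually)
  moreover have "1 / fact a * (1 - 0) ^ a * 0 ^ (k - a) = (if b = Suc k then 1 / fact k else (0::real))"
    using ak Suc by (auto simp: power_0_left)
  ultimately show ?thesis by simp
qed

text \<open>Cones of smaller dimension vanish after the division, and the degree of the apex does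
  not affect the leading term.\<close>

lemma cone_count_asymp:
  assumes "\<forall>p\<in>set L. snd p \<le> Suc k"
  shows "(\<lambda>n. real (cone_count L n) / real n ^ k) \<longlonglongrightarrow> real (length (filter (\<lambda>p. snd p = Suc k) L)) / fact k"
  using assms
proof (induction L)
  case (Cons p L)
  obtain c b where p: "p = (c, b)" by fastforce
  have "(\<lambda>n. real (if c \<le> n then pcount b (n - c) else 0) / real n ^ k + real (cone_count L n) / real n ^ k)
      \<longlonglongrightarrow> (if b = Suc k then 1 / fact k else 0) + real (length (filter (\<lambda>p. snd p = Suc k) L)) / fact k"
    using Cons p by (intro tendsto_add cone_term_asymp) auto
  moreover have "real (cone_count (p # L) n) / real n ^ k
      = real (if c \<le> n then pcount b (n - c) else 0) / real n ^ k + real (cone_count L n) / real n ^ k" for n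
    by (simp add: p add_divide_distrib)
  moreover have "real (length (filter (\<lambda>p. snd p = Suc k) (p # L))) / fact k
      = (if b = Suc k then 1 / fact k else 0) + real (length (filter (\<lambda>p. snd p = Suc k) L)) / fact k"
    by (simp add: p add_divide_distrib)
  ultimately show ?case by simp
qed simp

section \<open>Growth of the number of monomials up to a given degree\<close>

definition aff_count :: "'n::finite mon set \<Rightarrow> nat \<Rightarrow> nat"
  where "aff_count U n = card {m. mon_deg m \<le> n \<and> m \<notin> U}"

lemma finite_aff_count_set [simp]: "finite {m :: 'n::finite mon. mon_deg m \<le> n \<and> Q m}"
  by (rule finite_subset[OF _ finite_mon_deg_le[of n]]) auto

lemma aff_count_antimono: "U \<subseteq> U' \<Longrightarrow> aff_count U' n \<le> aff_count U n"
  unfolding aff_count_def by (rule card_mono) auto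

lemma sum_mon_count: "(\<Sum>i\<le>n. mon_count V U i) = card {m. keys m \<subseteq> V \<and> mon_deg m \<le> n \<and> m \<notin> U}"
proof -
  have "{m. keys m \<subseteq> V \<and> mon_deg m \<le> n \<and> m \<notin> U} = (\<Union>i\<in>{..n}. {m. keys m \<subseteq> V \<and> mon_deg m = i \<and> m \<notin> U})"
    by auto
  moreover have "card (\<Union>i\<in>{..n}. {m. keys m \<subseteq> V \<and> mon_deg m = i \<and> m \<notin> U})
      = (\<Sum>i\<le>n. card {m. keys m \<subseteq> V \<and> mon_deg m = i \<and> m \<notin> U})"
    by (rule card_UN_disjoint) (auto simp: finite_mon_count_set)
  ultimately show ?thesis by (simp add: mon_count_def)
qed

lemma mon_count_empty: "finite A \<Longrightarrow> mon_count A {} n = pcount (card A) n"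
proof (induction A arbitrary: n rule: finite_induct)
  case empty
  have "{m. m = 0 \<and> mon_deg m = n} = (if n = 0 then {0} else {})" by auto
  then show ?case by (simp add: mon_count_def)
next
  case (insert x A)
  have "mon_count (insert x A) {} n = (\<Sum>i\<le>n. pcount (card A) (n - i))"
    using insert by (simp add: mon_count_insert)
  also have "\<dots> = (\<Sum>i\<le>n. pcount (card A) i)"
    by (rule sum.reindex_bij_witness[of _ "\<lambda>i. n - i" "\<lambda>i. n - i"]) auto
  finally show ?case using insert by (simp add: sum_pcount)
qed

text \<open>The dimension of the zero set of a monomial ideal, which is a union of coordinate
  subspaces.\<close>

definition free_dim :: "'n::finite mon set \<Rightarrow> nat"
  where "free_dim U = Max {card A | A. free_set U A}"

lemma finite_cards: "finite {card A | A. Q (A :: 'n::finite set)}"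
  by simp

lemma free_dim_ge: "free_set U A \<Longrightarrow> card A \<le> free_dim U"
  unfolding free_dim_def by (rule Max_ge[OF finite_cards]) auto

lemma free_dim_attained:
  assumes "0 \<notin> U"
  obtains A where "free_set U A" "card A = free_dim U"
proof -
  have "free_set U {}" using assms by (simp add: free_set_def)
  then have "{card A | A. free_set U A} \<noteq> {}" by blast
  then have "free_dim U \<in> {card A | A. free_set U A}"
    unfolding free_dim_def by (rule Max_in[OF finite_cards])
  then show ?thesis using that by auto
qed

text \<open>One number has three meanings: leading coefficient up to degree \<open>n\<close>,
  leading coefficient in exact degree \<open>n\<close>, and number of monomials left when there are
  finitely many. The last two match the two branches of \<open>quot_degree\<close>.\<close>

definition is_free_mult :: "'n::finite mon set \<Rightarrow> nat \<Rightarrow> bool"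
  where "is_free_mult U D \<longleftrightarrow> D \<ge> 1 \<and>
    (\<lambda>n. real (aff_count U n) / real n ^ free_dim U) \<longlonglongrightarrow> real D / fact (free_dim U) \<and>
    (free_dim U \<ge> 1 \<longrightarrow> (\<lambda>n. real (mon_count UNIV U n) / real n ^ (free_dim U - 1))
        \<longlonglongrightarrow> real D / fact (free_dim U - 1)) \<and>
    (free_dim U = 0 \<longrightarrow> finite (- U) \<and> card (- U) = D)"

definition free_mult :: "'n::finite mon set \<Rightarrow> nat"
  where "free_mult U = (SOME D. is_free_mult U D)"

text \<open>The coefficient \<open>D\<close> is the number of cones of maximal dimension in a cone decomposition.\<close>

lemma free_mult:
  fixes U :: "'n::finite mon set"
  assumes up: "up_closed U" and U: "0 \<notin> U"
  shows "is_free_mult U (free_mult U)"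
proof -
  let ?k = "free_dim U"
  obtain L where L: "\<And>p. p \<in> set L \<Longrightarrow> free_set U (snd p)"
    "\<And>n. mon_count UNIV U n = cone_count (map (\<lambda>(c, A). (c, card A)) L) n"
    using cone_decomposition[OF finite_UNIV up] by auto
  define M where "M = map (\<lambda>(c, A). (c, card A)) L"
  define M' where "M' = map (\<lambda>(c, b). (c, Suc b)) M"
  have Mle: "snd p \<le> ?k" if "p \<in> set M" for p
    using that free_dim_ge[OF L(1)] by (force simp: M_def)
  have aff: "aff_count U n = cone_count M' n" for n
    using sum_mon_count[of UNIV U n] L(2) sum_cone_count[of M n] by (simp add: aff_count_def M_def M'_def)
  define D where "D = length (filter (\<lambda>p. snd p = ?k) M)"
  have D': "length (filter (\<lambda>p. snd p = Suc ?k) M') = D"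
    by (simp add: D_def M'_def filter_map comp_def case_prod_unfold)
  have lim1: "(\<lambda>n. real (aff_count U n) / real n ^ ?k) \<longlonglongrightarrow> real D / fact ?k"
  proof -
    have "\<forall>p\<in>set M'. snd p \<le> Suc ?k" using Mle by (auto simp: M'_def)
    from cone_count_asymp[OF this] show ?thesis unfolding aff D' .
  qed
  \<comment> \<open>The monomials in a largest free set already grow like \<open>n ^ k / k!\<close>,
    which excludes \<open>D = 0\<close>.\<close>
  obtain A where A: "free_set U A" "card A = ?k" using free_dim_attained[OF U] .
  have "(\<lambda>n. real (pcount (Suc ?k) n) / real n ^ ?k) \<longlonglongrightarrow> 1 / fact ?k" by (rule pcount_asymp)
  moreover have "pcount (Suc ?k) n \<le> aff_count U n" for n
  proof -
    have "pcount (Suc ?k) n = (\<Sum>i\<le>n. mon_count A {} i)" using A by (simp add: mon_count_empty sum_pcount)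
    also have "\<dots> = card {m. keys m \<subseteq> A \<and> mon_deg m \<le> n}" using sum_mon_count[of A "{}" n] by simp
    also have "\<dots> \<le> aff_count U n" unfolding aff_count_def
      by (rule card_mono) (use A in \<open>auto simp: free_set_def\<close>)
    finally show ?thesis .
  qed
  then have "real (pcount (Suc ?k) n) / real n ^ ?k \<le> real (aff_count U n) / real n ^ ?k" for n
    by (intro divide_right_mono) auto
  ultimately have "1 / fact ?k \<le> real D / fact ?k" using lim1 by (intro LIMSEQ_le) auto
  then have D1: "D \<ge> 1" by (simp add: divide_le_cancel)
  have lim2: "(\<lambda>n. real (mon_count UNIV U n) / real n ^ (?k - 1)) \<longlonglongrightarrow> real D / fact (?k - 1)" if "?k \<ge> 1"
  proof -
    have "\<forall>p\<in>set M. snd p \<le> Suc (?k - 1)" using Mle that by fastforce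
    from cone_count_asymp[OF this] show ?thesis using that by (simp add: L(2) M_def[symmetric] D_def)
  qed
  \<comment> \<open>All cones are single monomials, so the count is constant from the largest apex
    degree \<open>N\<close> on, and no monomial of larger degree avoids \<open>U\<close>.\<close>
  have zero: "finite (- U) \<and> card (- U) = D" if k0: "?k = 0"
  proof -
    have b0: "snd p = 0" if "p \<in> set M" for p using Mle[OF that] k0 by simp
    have "filter (\<lambda>p. snd p = ?k) M = M" unfolding filter_id_conv k0 using b0 by blast
    then have DM: "D = length M" unfolding D_def by (rule arg_cong)
    define N where "N = Max (insert 0 (fst ` set M))"
    have cN: "fst p \<le> N" if "p \<in> set M" for p unfolding N_def using that by (intro Max_ge) auto
    have cone: "cone_count (map (\<lambda>(c, b). (c, Suc b)) R) n = length R"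
      if "\<forall>p\<in>set R. snd p = 0 \<and> fst p \<le> n" for R n
      using that by (induction R) auto
    have hN: "aff_count U n = D" if "n \<ge> N" for n
    proof -
      have "\<forall>p\<in>set M. snd p = 0 \<and> fst p \<le> n" using b0 cN that by (meson order_trans)
      from cone[OF this] show ?thesis unfolding aff M'_def DM .
    qed
    have "- U = {m. mon_deg m \<le> N \<and> m \<notin> U}"
    proof (intro equalityI subsetI)
      fix m assume m: "m \<in> - U"
      let ?S = "\<lambda>n. {m. mon_deg m \<le> n \<and> m \<notin> U}"
      have "?S N = ?S (N + mon_deg m)"
        using hN[of N] hN[of "N + mon_deg m"]
        by (intro card_subset_eq finite_aff_count_set) (auto simp: aff_count_def)
      moreover have "m \<in> ?S (N + mon_deg m)" using m by simp
      ultimately show "m \<in> {m. mon_deg m \<le> N \<and> m \<notin> U}" by blast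
    qed auto
    then show ?thesis using hN[of N] by (simp add: aff_count_def)
  qed
  have "is_free_mult U D" unfolding is_free_mult_def using D1 lim1 lim2 zero by blast
  then show ?thesis unfolding free_mult_def by (rule someI)
qed

text \<open>The count has order exactly \<open>n ^ free_dim U\<close> with a positive leading
  coefficient, so a bound of smaller order is impossible.\<close>

lemma free_dim_le_of_limit:
  fixes U :: "'n::finite mon set"
  assumes "up_closed U" "0 \<notin> U" and le: "\<And>n. real (aff_count U n) \<le> f n"
    and lim: "(\<lambda>n. f n / real n ^ k) \<longlonglongrightarrow> l"
  shows "free_dim U \<le> k"
proof (rule ccontr)
  assume "\<not> free_dim U \<le> k"
  then obtain j where j: "free_dim U = k + Suc j" using less_imp_Suc_add[of k "free_dim U"] by auto
  have "(\<lambda>n. f n / real n ^ k * (1 / real n) ^ Suc j) \<longlonglongrightarrow> l * 0 ^ Suc j"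
    by (intro tendsto_intros lim lim_const_over_n)
  moreover have "real (aff_count U n) / real n ^ free_dim U \<le> f n / real n ^ k * (1 / real n) ^ Suc j" for n
  proof -
    have "real (aff_count U n) / real n ^ free_dim U \<le> f n / real n ^ free_dim U"
      by (intro divide_right_mono le) simp
    moreover have "f n / real n ^ k * (1 / real n) ^ Suc j = f n / real n ^ free_dim U"
      unfolding j power_add by (simp add: power_divide mult_ac)
    ultimately show ?thesis by simp
  qed
  ultimately have "real (free_mult U) / fact (free_dim U) \<le> l * 0 ^ Suc j"
    using free_mult[OF assms(1,2)] unfolding is_free_mult_def by (intro LIMSEQ_le) auto
  then show False using free_mult[OF assms(1,2)] by (simp add: is_free_mult_def field_simps)
qed

text \<open>Absorbs the degree shift caused by multiplication with a fixed polynomial.\<close>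

lemma tendsto_shift_power:
  assumes "(\<lambda>n. f n / real n ^ k) \<longlonglongrightarrow> (l::real)"
  shows "(\<lambda>n. f (n - e) / real n ^ k) \<longlonglongrightarrow> l"
proof -
  have "(\<lambda>n. f (n - e) / real (n - e) ^ k) \<longlonglongrightarrow> l"
    using filterlim_compose[OF assms filterlim_minus_const_nat_at_top] .
  moreover have "(\<lambda>n. (1 - real e / real n) ^ k) \<longlonglongrightarrow> (1 - 0) ^ k"
    by (intro tendsto_intros lim_const_over_n)
  ultimately have "(\<lambda>n. f (n - e) / real (n - e) ^ k * (1 - real e / real n) ^ k) \<longlonglongrightarrow> l * (1 - 0) ^ k"
    by (rule tendsto_mult)
  moreover have "\<forall>\<^sub>F n in sequentially. f (n - e) / real (n - e) ^ k * (1 - real e / real n) ^ k = f (n - e) / real n ^ k"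
    using eventually_gt_at_top[of e]
  proof eventually_elim
    case (elim n)
    have "(1 - real e / real n) = real (n - e) / real n" using elim by (simp add: field_simps of_nat_diff)
    then show ?case using elim by (simp add: power_divide)
  qed
  ultimately show ?thesis using Lim_transform_eventually by fastforce
qed

text \<open>\<open>ideal_gen\<close> is an intersection of ideals; building elements one product at
  a time provides induction over the members of the ideal.\<close>

inductive_set ideal_span :: "'a::comm_ring_1 set \<Rightarrow> 'a set" for A where
  zero: "0 \<in> ideal_span A"
| add: "f \<in> ideal_span A \<Longrightarrow> p \<in> A \<Longrightarrow> f + g * p \<in> ideal_span A"

lemma is_ideal_ideal_span: "is_ideal (ideal_span A)"
  unfolding is_ideal_def
proof (intro conjI ballI allI)
  show "a + b \<in> ideal_span A" if "a \<in> ideal_span A" "b \<in> ideal_span A" for a b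
    using that(2,1)
  proof induction
    case (add f p g)
    then show ?case using ideal_span.add[of "a + f" A p g] by (simp add: add.assoc)
  qed simp
  show "r * a \<in> ideal_span A" if "a \<in> ideal_span A" for a r
    using that
  proof induction
    case (add f p g)
    then show ?case using ideal_span.add[of "r * f" A p "r * g"] by (simp add: algebra_simps)
  qed (simp add: ideal_span.zero)
qed (rule ideal_span.zero)

lemma ideal_span_superset: "A \<subseteq> ideal_span A"
proof
  fix a assume "a \<in> A"
  then show "a \<in> ideal_span A" using ideal_span.add[OF ideal_span.zero, of a A 1] by simp
qed

lemma ideal_span_least:
  assumes "is_ideal J" "A \<subseteq> J"
  shows "ideal_span A \<subseteq> J"
proof
  fix f assume "f \<in> ideal_span A"
  then show "f \<in> J" using assms by induction (auto intro: is_idealD)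
qed

lemma ideal_span_mono: "A \<subseteq> B \<Longrightarrow> ideal_span A \<subseteq> ideal_span B"
  using ideal_span_least[OF is_ideal_ideal_span] ideal_span_superset by blast

text \<open>The hypothesis says that membership of \<open>x + y\<close> in \<open>Z\<close> depends
  on \<open>x\<close> alone, as happens when \<open>a\<close> is homogeneous for the grading behind
  \<open>Z\<close>.\<close>

lemma part_mult_left:
  fixes g a :: "('n, 'k::field) mpoly"
  assumes "\<And>x y. x \<in> keys g \<Longrightarrow> y \<in> keys a \<Longrightarrow> x + y \<in> Z \<longleftrightarrow> x \<in> Z'"
  shows "part Z (g * a) = part Z' g * a"
proof -
  have g: "g = part Z' g + part (- Z') g" by (rule poly_mapping_eqI) (simp add: lookup_add)
  have "keys (part Z' g * a) \<subseteq> Z" "keys (part (- Z') g * a) \<inter> Z = {}"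
    using assms keys_mult[of "part Z' g" a] keys_mult[of "part (- Z') g" a] by (auto simp: keys_part)
  then have "part Z (part Z' g * a) = part Z' g * a" "part Z (part (- Z') g * a) = 0"
    by (simp_all add: part_id part_0)
  moreover have "g * a = part Z' g * a + part (- Z') g * a" using g by (metis distrib_right)
  ultimately show ?thesis by simp
qed

lemma sum_parts:
  assumes "finite C"
  shows "(\<Sum>c\<in>C. part {m. \<gamma> m = c} f) = part {m. \<gamma> m \<in> C} f"
  using assms by (intro poly_mapping_eqI) (simp add: lookup_sum)

text \<open>Compare leading components modulo the ideal.\<close>

lemma graded_primeI:
  fixes Q :: "('n, 'k::field) mpoly set" and \<gamma> :: "'n mon \<Rightarrow> 'g::cancel_comm_monoid_add"
    and prec :: "'g \<Rightarrow> 'g \<Rightarrow> bool"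
  assumes Q: "is_ideal Q" "Q \<noteq> UNIV"
    and \<gamma>: "\<And>u v. \<gamma> (u + v) = \<gamma> u + \<gamma> v"
    and irrefl: "\<And>a. \<not> prec a a"
    and trans: "\<And>a b c. prec a b \<Longrightarrow> prec b c \<Longrightarrow> prec a c"
    and total: "\<And>a b. a \<noteq> b \<Longrightarrow> prec a b \<or> prec b a"
    and prec_add: "\<And>a b c. prec a b \<Longrightarrow> prec (a + c) (b + c)"
    and graded: "\<And>f c. f \<in> Q \<Longrightarrow> part {m. \<gamma> m = c} f \<in> Q"
    and hom: "\<And>a b c d. keys a \<subseteq> {m. \<gamma> m = c} \<Longrightarrow> keys b \<subseteq> {m. \<gamma> m = d} \<Longrightarrow> a * b \<in> Q \<Longrightarrow> a \<in> Q \<or> b \<in> Q"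
  shows "is_prime Q"
  unfolding is_prime_def
proof (intro conjI allI impI)
  have lead: "\<exists>u f'. part {m. \<gamma> m = u} f \<notin> Q \<and> (\<forall>m\<in>keys f'. prec (\<gamma> m) u)
      \<and> f - (part {m. \<gamma> m = u} f + f') \<in> Q" if "f \<notin> Q" for f
  proof -
    \<comment> \<open>Components in \<open>Q\<close> are discarded first, so that the leading
      component among the remaining ones lies outside \<open>Q\<close>.\<close>
    define C where "C = {c \<in> \<gamma> ` keys f. part {m. \<gamma> m = c} f \<notin> Q}"
    have fin: "finite C" by (simp add: C_def)
    have rest: "part {m. \<gamma> m \<in> \<gamma> ` keys f - C} f \<in> Q"
      unfolding sum_parts[OF finite_Diff[OF finite_imageI[OF finite_keys]], symmetric]
      by (intro is_ideal_sum Q) (auto simp: C_def)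
    have "C \<noteq> {}"
    proof
      assume "C = {}"
      then have "part {m. \<gamma> m \<in> \<gamma> ` keys f} f \<in> Q" using rest by simp
      moreover have "part {m. \<gamma> m \<in> \<gamma> ` keys f} f = f" by (rule part_id) auto
      ultimately show False using that by simp
    qed
    with trans total fin obtain u where u: "u \<in> C" "\<And>x. x \<in> C \<Longrightarrow> x \<noteq> u \<Longrightarrow> prec x u"
      using finite_strict_max[of prec C] by blast
    define f' where "f' = part {m. \<gamma> m \<in> C - {u}} f"
    have "f - (part {m. \<gamma> m = u} f + f') = part {m. \<gamma> m \<in> \<gamma> ` keys f - C} f"
    proof (rule poly_mapping_eqI)
      fix m
      show "lookup (f - (part {m. \<gamma> m = u} f + f')) m = lookup (part {m. \<gamma> m \<in> \<gamma> ` keys f - C} f) m"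
      proof (cases "m \<in> keys f")
        case True
        then show ?thesis using u(1) by (auto simp: f'_def lookup_minus lookup_add)
      next
        case False
        then show ?thesis by (simp add: f'_def lookup_minus lookup_add in_keys_iff)
      qed
    qed
    moreover have "\<forall>m\<in>keys f'. prec (\<gamma> m) u" using u(2) by (auto simp: f'_def keys_part)
    moreover have "part {m. \<gamma> m = u} f \<notin> Q" using u(1) by (simp add: C_def)
    ultimately show ?thesis using rest by metis
  qed
  fix f g assume fg: "f * g \<in> Q"
  show "f \<in> Q \<or> g \<in> Q"
  proof (rule ccontr)
    assume "\<not> (f \<in> Q \<or> g \<in> Q)"
    then have fQ: "f \<notin> Q" and gQ: "g \<notin> Q" by auto
    obtain u f' where f: "part {m. \<gamma> m = u} f \<notin> Q" "\<forall>m\<in>keys f'. prec (\<gamma> m) u"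
      "f - (part {m. \<gamma> m = u} f + f') \<in> Q" using lead[OF fQ] by blast
    obtain v g' where g: "part {m. \<gamma> m = v} g \<notin> Q" "\<forall>m\<in>keys g'. prec (\<gamma> m) v"
      "g - (part {m. \<gamma> m = v} g + g') \<in> Q" using lead[OF gQ] by blast
    define a b where "a = part {m. \<gamma> m = u} f" and "b = part {m. \<gamma> m = v} g"
    have a: "\<And>m. m \<in> keys a \<Longrightarrow> \<gamma> m = u" and b: "\<And>m. m \<in> keys b \<Longrightarrow> \<gamma> m = v"
      by (auto simp: a_def b_def keys_part)
    \<comment> \<open>Modulo \<open>Q\<close> the factors become \<open>a + f'\<close> and
      \<open>b + g'\<close>, and the component of degree \<open>u + v\<close> of their product is
      \<open>a * b\<close>.\<close>
    have "f * g - (f - (a + f')) * g - (a + f') * (g - (b + g')) \<in> Q"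
      using fg is_idealD(4)[OF Q(1) f(3), of g] is_idealD(3)[OF Q(1) g(3), of "a + f'"] is_idealD(6)[OF Q(1)]
      unfolding a_def[symmetric] b_def[symmetric] by blast
    moreover have "f * g - (f - (a + f')) * g - (a + f') * (g - (b + g')) = a * b + (a * g' + f' * (b + g'))"
      by (simp add: algebra_simps)
    ultimately have "a * b + (a * g' + f' * (b + g')) \<in> Q" by metis
    then have "part {m. \<gamma> m = u + v} (a * b + (a * g' + f' * (b + g'))) \<in> Q" by (rule graded)
    moreover have "part {m. \<gamma> m = u + v} (a * b) = a * b"
      using keys_mult[of a b] a b by (intro part_id) (auto simp: \<gamma>)
    moreover have "part {m. \<gamma> m = u + v} (a * g') = 0"
    proof (rule part_0, rule equals0I)
      fix m assume "m \<in> keys (a * g') \<inter> {m. \<gamma> m = u + v}"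
      then obtain x y where xy: "x \<in> keys a" "y \<in> keys g'" "\<gamma> (x + y) = u + v" using keys_mult[of a g'] by auto
      then have "prec (\<gamma> y + u) (v + u)" using g(2) prec_add by blast
      then show False using xy a irrefl by (simp add: \<gamma> add.commute)
    qed
    moreover have "part {m. \<gamma> m = u + v} (f' * (b + g')) = 0"
    proof (rule part_0, rule equals0I)
      fix m assume "m \<in> keys (f' * (b + g')) \<inter> {m. \<gamma> m = u + v}"
      then obtain x y where xy: "x \<in> keys f'" "y \<in> keys (b + g')" "\<gamma> (x + y) = u + v"
        using keys_mult[of f' "b + g'"] by auto
      have "\<gamma> y = v \<or> prec (\<gamma> y) v" using xy(2) keys_add[of b g'] b g(2) by blast
      then have "\<gamma> y + u = v + u \<or> prec (\<gamma> y + u) (v + u)" using prec_add by blast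
      moreover have "prec (\<gamma> x + \<gamma> y) (u + \<gamma> y)" using xy(1) f(2) prec_add by blast
      ultimately have "prec (\<gamma> x + \<gamma> y) (u + v)" using trans by (metis add.commute)
      then show False using xy(3) irrefl by (simp add: \<gamma>)
    qed
    ultimately have "a * b \<in> Q" by simp
    moreover have "keys a \<subseteq> {m. \<gamma> m = u}" "keys b \<subseteq> {m. \<gamma> m = v}" using a b by auto
    ultimately have "a \<in> Q \<or> b \<in> Q" using hom by blast
    then show False using f(1) g(1) by (simp add: a_def b_def)
  qed
qed (use Q in auto)

section \<open>Algebraically independent variables and contracted primes\<close>

definition poly_in :: "'n set \<Rightarrow> ('n, 'k::field) mpoly set"
  where "poly_in A = {f. keys f \<subseteq> {m. keys m \<subseteq> A}}"

definition indep_vars :: "('n, 'k::field) mpoly set \<Rightarrow> 'n set \<Rightarrow> bool"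
  where "indep_vars J A \<longleftrightarrow> (\<forall>f\<in>J \<inter> poly_in A. f = 0)"

lemma poly_in_mult: "f \<in> poly_in A \<Longrightarrow> g \<in> poly_in A \<Longrightarrow> f * g \<in> poly_in A"
  unfolding poly_in_def
proof (intro CollectI subsetI)
  fix m i assume fg: "f \<in> {f. keys f \<subseteq> {m. keys m \<subseteq> A}}" "g \<in> {f. keys f \<subseteq> {m. keys m \<subseteq> A}}"
    and "m \<in> keys (f * g)" "i \<in> keys m"
  then obtain x y where xy: "x \<in> keys f" "y \<in> keys g" "m = x + y" using keys_mult[of f g] by auto
  then have "keys m \<subseteq> keys x \<union> keys y" using keys_add[of x y] by simp
  then show "i \<in> A" using \<open>i \<in> keys m\<close> xy fg by blast
qed

lemma poly_in_add: "f \<in> poly_in A \<Longrightarrow> g \<in> poly_in A \<Longrightarrow> f + g \<in> poly_in A"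
  using keys_add[of f g] by (auto simp: poly_in_def)

lemma one_in_poly_in: "1 \<in> poly_in A"
  by (simp add: poly_in_def)

lemma indep_vars_proper: "indep_vars J A \<Longrightarrow> J \<noteq> UNIV"
  using one_in_poly_in[of A] by (force simp: indep_vars_def)

lemma indep_vars_antimono: "indep_vars J A \<Longrightarrow> I \<subseteq> J \<Longrightarrow> indep_vars I A"
  by (auto simp: indep_vars_def)

lemma lookup_monom_mult: "lookup (monom_poly w * f) (w + m) = lookup f m"
  for f :: "('n, 'k::field) mpoly"
proof -
  have "monom_poly w * f = (\<Sum>k\<in>keys f. scale_poly (lookup f k) (monom_poly (w + k)))"
    by (subst (1) poly_expansion[OF finite_keys subset_refl, of f])
      (simp add: sum_distrib_left scale_poly_mult_right[symmetric] monom_poly_def mult_single)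
  also have "lookup \<dots> (w + m) = (\<Sum>k\<in>keys f. if m = k then lookup f k else 0)"
    by (simp add: lookup_sum mult_delta_right)
  also have "\<dots> = lookup f m" by (simp add: in_keys_iff)
  finally show ?thesis .
qed

lemma part_Compl_add: "part (- V) m + part V m = m"
  by (rule poly_mapping_eqI) (simp add: lookup_add)

text \<open>In the grading by exponents outside \<open>V\<close>, the component \<open>w\<close> is
  the free module over \<open>K[V]\<close> generated by the monomial \<open>w\<close>.\<close>

lemma homogeneous_factor:
  fixes f :: "('n, 'k::field) mpoly"
  assumes "keys f \<subseteq> {m. part (- V) m = w}"
  obtains c where "f = monom_poly w * c" "c \<in> poly_in V"
proof
  let ?c = "\<Sum>m\<in>keys f. scale_poly (lookup f m) (monom_poly (part V m)) :: ('n, 'k) mpoly"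
  have "monom_poly w * ?c = (\<Sum>m\<in>keys f. scale_poly (lookup f m) (monom_poly (w + part V m)))"
    by (simp add: sum_distrib_left scale_poly_mult_right[symmetric] monom_poly_def mult_single)
  also have "\<dots> = (\<Sum>m\<in>keys f. scale_poly (lookup f m) (monom_poly m))"
  proof (rule sum.cong[OF refl])
    fix m assume "m \<in> keys f"
    then have "part (- V) m = w" using assms by blast
    then have "w + part V m = m" using part_Compl_add[of V m] by simp
    then show "scale_poly (lookup f m) (monom_poly (w + part V m)) = scale_poly (lookup f m) (monom_poly m)" by simp
  qed
  also have "\<dots> = f" by (rule poly_expansion[symmetric]) auto
  finally show "f = monom_poly w * ?c" ..
  show "?c \<in> poly_in V"
    unfolding poly_in_def mem_Collect_eq by (rule keys_linear_combination) (simp add: keys_part)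
qed

definition contract_extend :: "'n set \<Rightarrow> ('n, 'k::field) mpoly set \<Rightarrow> ('n, 'k) mpoly set"
  where "contract_extend V P = ideal_span (P \<inter> poly_in V)"

context mon_order
begin

lemma monom_mult_cancel: "monom_poly w * f = monom_poly w * g \<longleftrightarrow> f = (g :: ('n, 'k::field) mpoly)"
  by (metis lookup_monom_mult poly_mapping_eqI)

text \<open>The generators lie in \<open>K[V]\<close> and have degree \<open>0\<close> in the
  grading by exponents outside \<open>V\<close>. Extracting the component \<open>w\<close> therefore
  acts on their multipliers, which become the monomial \<open>w\<close> times elements of
  \<open>K[V]\<close>.\<close>

lemma contract_extend_part:
  fixes P :: "('n, 'k::field) mpoly set"
  assumes P: "is_ideal P" and f: "f \<in> contract_extend V P"
  shows "\<exists>e\<in>P \<inter> poly_in V. part {m. part (- V) m = w} f = monom_poly w * e"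
  using f unfolding contract_extend_def
proof induction
  case zero
  then show ?case using is_idealD(1)[OF P] by (intro bexI[of _ 0]) (auto simp: part_0 poly_in_def)
next
  case (add f p g)
  then obtain e where e: "e \<in> P \<inter> poly_in V" "part {m. part (- V) m = w} f = monom_poly w * e" by blast
  obtain c where c: "part {m. part (- V) m = w} g = monom_poly w * c" "c \<in> poly_in V"
    using homogeneous_factor[of "part {m. part (- V) m = w} g" V w] by (auto simp: keys_part)
  have "part (- V) y = 0" if "y \<in> keys p" for y
    using that add by (intro part_0) (auto simp: poly_in_def)
  then have "part {m. part (- V) m = w} (g * p) = part {m. part (- V) m = w} g * p"
    by (intro part_mult_left) simp
  then have "part {m. part (- V) m = w} (f + g * p) = monom_poly w * (e + c * p)"
    using e c by (simp add: algebra_simps)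
  moreover have "e + c * p \<in> P \<inter> poly_in V"
    using e c add is_idealD(2,3)[OF P] poly_in_add[of e V "c * p"] poly_in_mult[of c V p] by auto
  ultimately show ?case by blast
qed

lemma contract_extend_subset: "is_ideal P \<Longrightarrow> contract_extend V P \<subseteq> P"
  unfolding contract_extend_def by (rule ideal_span_least) auto

text \<open>The grading records the exponents of the variables outside \<open>V\<close>.\<close>

lemma contract_extend_prime:
  fixes P :: "('n, 'k::field) mpoly set"
  assumes P: "is_prime P"
  shows "is_prime (contract_extend V P)"
proof (rule graded_primeI[where \<gamma>="part (- V)" and prec=lt])
  have iP: "is_ideal P" and pP: "\<And>a b. a * b \<in> P \<Longrightarrow> a \<in> P \<or> b \<in> P" using P by (auto simp: is_prime_def)
  show iQ: "is_ideal (contract_extend V P)" unfolding contract_extend_def by (rule is_ideal_ideal_span)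
  show "contract_extend V P \<noteq> UNIV" using contract_extend_subset[OF iP, of V] P
    unfolding is_prime_def by (metis top.extremum_uniqueI)
  have inQ: "monom_poly w * e \<in> contract_extend V P" if "e \<in> P \<inter> poly_in V" for w e
    unfolding contract_extend_def using that ideal_span_superset is_idealD(3)[OF is_ideal_ideal_span] by blast
  show "part {m. part (- V) m = c} f \<in> contract_extend V P" if "f \<in> contract_extend V P" for f c
    using contract_extend_part[OF iP that, of c] inQ by auto
  show "a \<in> contract_extend V P \<or> b \<in> contract_extend V P"
    if a: "keys a \<subseteq> {m. part (- V) m = c}" and b: "keys b \<subseteq> {m. part (- V) m = d}"
      and ab: "a * b \<in> contract_extend V P" for a b c d
  proof -
    obtain a' where a': "a = monom_poly c * a'" "a' \<in> poly_in V" using homogeneous_factor[OF a] .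
    obtain b' where b': "b = monom_poly d * b'" "b' \<in> poly_in V" using homogeneous_factor[OF b] .
    have eq: "a * b = monom_poly (c + d) * (a' * b')"
    proof -
      have "monom_poly (c + d) = (monom_poly c * monom_poly d :: ('n, 'k) mpoly)"
        by (simp add: monom_poly_def mult_single)
      then show ?thesis by (simp add: a' b' ac_simps)
    qed
    \<comment> \<open>As \<open>a * b\<close> is homogeneous, it equals the monomial
      \<open>c + d\<close> times some \<open>e\<close> in \<open>P\<close>. Cancelling the monomial
      gives \<open>a' * b' = e\<close>, and primality of \<open>P\<close> applies.\<close>
    have "part {m. part (- V) m = c + d} (a * b) = a * b"
      using a b keys_mult[of a b] by (intro part_id) fastforce
    then obtain e where "e \<in> P \<inter> poly_in V" "a * b = monom_poly (c + d) * e"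
      using contract_extend_part[OF iP ab, of "c + d"] by auto
    then have "a' * b' \<in> P" using eq monom_mult_cancel by (metis IntD1)
    then show ?thesis using pP inQ a' b' by blast
  qed
qed (auto intro: lt_trans lt_add dest: lt_total)

text \<open>Dependence of \<open>insert x A\<close> provides a nonzero \<open>f\<close> in
  \<open>P\<close> in these variables. If \<open>f\<close> came from \<open>P \<inter> K[V]\<close>,
  its coefficients as a polynomial in \<open>x\<close> would lie in \<open>P\<close> and involve
  only \<open>A\<close>, against the independence of \<open>A\<close>.\<close>

lemma contract_extend_strict:
  fixes P :: "('n, 'k::field) mpoly set"
  assumes P: "is_ideal P" and A: "indep_vars P A" "\<not> indep_vars P (insert x A)" "A \<subseteq> V" and x: "x \<notin> V"
  shows "contract_extend V P \<subset> contract_extend (insert x V) P"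
proof -
  obtain f where f: "f \<in> P" "f \<in> poly_in (insert x A)" "f \<noteq> 0" using A(2) by (auto simp: indep_vars_def)
  have "f \<in> poly_in (insert x V)" using f A(3) by (auto simp: poly_in_def)
  then have "f \<in> contract_extend (insert x V) P"
    unfolding contract_extend_def using f ideal_span_superset by blast
  moreover have "f \<notin> contract_extend V P"
  proof
    assume fV: "f \<in> contract_extend V P"
    let ?m = "init_mon lt f"
    let ?w = "part (- V) ?m"
    obtain e where e: "e \<in> P \<inter> poly_in V" "part {m. part (- V) m = ?w} f = monom_poly ?w * e"
      using contract_extend_part[OF P fV] by blast
    have "lookup (part {m. part (- V) m = ?w} f) ?m \<noteq> 0"
      using init_mon_in_keys[OF f(3)] by (simp add: in_keys_iff)
    then have "e \<noteq> 0" using e(2) by auto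
    moreover have "e \<in> poly_in A"
      unfolding poly_in_def
    proof (intro CollectI subsetI)
      fix m i assume m: "m \<in> keys e" and i: "i \<in> keys m"
      have "lookup (part {m. part (- V) m = ?w} f) (?w + m) \<noteq> 0"
        using m unfolding e(2) lookup_monom_mult by (simp add: in_keys_iff)
      then have "?w + m \<in> keys f" by (auto simp: in_keys_iff split: if_splits)
      then have "keys (?w + m) \<subseteq> insert x A" using f(2) by (auto simp: poly_in_def)
      moreover have "i \<in> keys (?w + m)" using i by (simp add: in_keys_iff lookup_add)
      moreover have "i \<in> V" using m i e(1) by (auto simp: poly_in_def)
      ultimately show "i \<in> A" using x by auto
    qed
    ultimately show False using e(1) A(1) by (auto simp: indep_vars_def)
  qed
  moreover have "contract_extend V P \<subseteq> contract_extend (insert x V) P"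
    unfolding contract_extend_def by (rule ideal_span_mono) (auto simp: poly_in_def)
  ultimately show ?thesis by blast
qed

end

context deg_order
begin

text \<open>The variables outside \<open>A\<close> join \<open>V\<close> one at a time. Each one
  enlarges the ideal strictly because \<open>A\<close> is maximal, and with all of them the ideal is
  \<open>P\<close>.\<close>

lemma chain_below_prime:
  fixes P :: "('n::finite, 'k::field) mpoly set"
  assumes P: "is_prime P" and A: "indep_vars P A" "\<And>x. x \<notin> A \<Longrightarrow> \<not> indep_vars P (insert x A)"
  shows "\<exists>p. prime_chain poly_ring (card (- A)) p \<and> p (card (- A)) = P"
proof -
  have iP: "is_ideal P" using P by (simp add: is_prime_def)
  have "\<exists>p. prime_chain poly_ring (card B) p \<and> p (card B) = contract_extend (A \<union> B) P"
    if "finite B" "B \<inter> A = {}" for B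
    using that
  proof (induction B)
    case empty
    show ?case
      by (intro exI[of _ "\<lambda>_. contract_extend A P"])
        (simp add: prime_chain_def primeideal_iff contract_extend_prime[OF P])
  next
    case (insert x B)
    then obtain p where p: "prime_chain poly_ring (card B) p" "p (card B) = contract_extend (A \<union> B) P"
      by auto
    define q where "q = p(Suc (card B) := contract_extend (insert x (A \<union> B)) P)"
    have "contract_extend (A \<union> B) P \<subset> contract_extend (insert x (A \<union> B)) P"
      using insert A by (intro contract_extend_strict[OF iP]) auto
    then have "prime_chain poly_ring (Suc (card B)) q" "q (Suc (card B)) = contract_extend (insert x (A \<union> B)) P"
      using p by (auto simp: q_def prime_chain_def primeideal_iff contract_extend_prime[OF P] le_Suc_eq less_Suc_eq)
    then show ?case using insert by (intro exI[of _ q]) simp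
  qed
  from this[of "- A"] obtain p where "prime_chain poly_ring (card (- A)) p" "p (card (- A)) = contract_extend UNIV P"
    by (auto simp: Compl_partition)
  moreover have "contract_extend UNIV P = P"
  proof -
    have "P \<inter> poly_in UNIV = P" by (auto simp: poly_in_def)
    then show ?thesis
      using contract_extend_subset[OF iP, of UNIV] ideal_span_superset[of P] by (simp add: contract_extend_def)
  qed
  ultimately show ?thesis by auto
qed

text \<open>A strictly increasing chain of ideals would have a chain of initial monomials that
  stabilizes, and nested ideals with equal initial monomials coincide.\<close>

lemma ideal_maximal:
  fixes S :: "('n, 'k::field) mpoly set set"
  assumes "S \<noteq> {}" and S: "\<And>J. J \<in> S \<Longrightarrow> is_ideal J"
  obtains M where "M \<in> S" "\<And>J. J \<in> S \<Longrightarrow> M \<subseteq> J \<Longrightarrow> J = M"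
proof (rule ccontr)
  assume "\<not> thesis"
  then have "\<forall>M. \<exists>J. M \<in> S \<longrightarrow> J \<in> S \<and> M \<subset> J" using that by blast
  then obtain nx where nx: "\<And>M. M \<in> S \<Longrightarrow> nx M \<in> S" "\<And>M. M \<in> S \<Longrightarrow> M \<subset> nx M" by metis
  obtain M0 where "M0 \<in> S" using assms(1) by blast
  define F where "F k = (nx ^^ k) M0" for k
  have FS: "F k \<in> S" for k by (induction k) (auto simp: F_def \<open>M0 \<in> S\<close> nx)
  have Fstep: "F k \<subset> F (Suc k)" for k using nx(2)[OF FS[of k]] by (simp add: F_def)
  have "incseq (\<lambda>k. init_mons lt (F k))"
    by (rule incseq_SucI) (use Fstep init_mons_mono in blast)
  moreover have "up_closed (init_mons lt (F k))" for k by (intro up_closed_init_mons S FS)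
  ultimately obtain N where N: "\<And>n. n \<ge> N \<Longrightarrow> init_mons lt (F n) = init_mons lt (F N)"
    using up_closed_chain_stable[of "\<lambda>k. init_mons lt (F k)"] by blast
  have "F N = F (Suc N)"
    using ideal_eq_of_init_mons_eq[OF S[OF FS] S[OF FS], of N "Suc N"] Fstep[of N] N[of "Suc N"] by auto
  then show False using Fstep[of N] by blast
qed

text \<open>The value does not depend on the order: by \<open>card_le_pdim\<close> and
  \<open>pdim_attained\<close> it is the largest number of variables independent modulo a proper
  ideal \<open>J\<close>.\<close>

definition pdim :: "('n, 'k::field) mpoly set \<Rightarrow> nat"
  where "pdim J = free_dim (init_mons lt J)"

definition pmult :: "('n, 'k::field) mpoly set \<Rightarrow> nat"
  where "pmult J = free_mult (init_mons lt J)"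

abbreviation hf :: "('n, 'k::field) mpoly set \<Rightarrow> nat \<Rightarrow> nat"
  where "hf J \<equiv> aff_count (init_mons lt J)"

lemma pmult:
  fixes J :: "('n, 'k::field) mpoly set"
  assumes "is_ideal J" "J \<noteq> UNIV"
  shows pmult_ge: "pmult J \<ge> 1"
    and hf_limit: "(\<lambda>n. real (hf J n) / real n ^ pdim J) \<longlonglongrightarrow> real (pmult J) / fact (pdim J)"
    and mon_count_limit: "pdim J \<ge> 1 \<Longrightarrow> (\<lambda>n. real (mon_count UNIV (init_mons lt J) n) / real n ^ (pdim J - 1))
        \<longlonglongrightarrow> real (pmult J) / fact (pdim J - 1)"
    and finite_init_mons: "pdim J = 0 \<Longrightarrow> finite (- init_mons lt J)"
    and card_init_mons: "pdim J = 0 \<Longrightarrow> card (- init_mons lt J) = pmult J"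
  using free_mult[OF up_closed_init_mons[OF assms(1)]] zero_in_init_mons_iff[OF assms(1)] assms(2)
  unfolding is_free_mult_def pdim_def pmult_def by blast+

lemma indep_vars_of_free_set:
  fixes J :: "('n, 'k::field) mpoly set"
  assumes "free_set (init_mons lt J) A"
  shows "indep_vars J A"
  unfolding indep_vars_def
proof (rule ballI, rule ccontr)
  fix f assume f: "f \<in> J \<inter> poly_in A" "f \<noteq> 0"
  then have "keys (init_mon lt f) \<subseteq> A" using init_mon_in_keys[OF f(2)] by (auto simp: poly_in_def)
  then show False using assms init_monsI f by (auto simp: free_set_def)
qed

text \<open>Monomials in independent variables are linearly independent modulo \<open>J\<close>, so
  \<open>hf J\<close> grows at least like \<open>n ^ card A\<close>.\<close>

lemma card_le_pdim:
  fixes J :: "('n, 'k::field) mpoly set"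
  assumes J: "is_ideal J" and A: "indep_vars J A"
  shows "card A \<le> pdim J"
proof -
  \<comment> \<open>The monomials outside \<open>U\<close> are exactly those in the variables of
    \<open>A\<close>.\<close>
  define U where "U = {m :: 'n mon. \<not> keys m \<subseteq> A}"
  have up: "up_closed U" "0 \<notin> U" by (auto simp: U_def up_closed_def in_keys_iff lookup_add subset_iff)
  have "free_set U A" by (auto simp: free_set_def U_def)
  have le: "aff_count U n \<le> hf J n" for n
  proof -
    let ?T = "{m. mon_deg m \<le> n \<and> m \<notin> U}"
    have "card ?T \<le> card {m. mon_deg m \<le> n \<and> m \<in> init_mons lt (UNIV :: ('n, 'k) mpoly set) - init_mons lt J}"
    proof (rule card_le_init_mons_diff[where b=monom_poly, OF J])
      show "is_ideal (UNIV :: ('n, 'k) mpoly set)" by (simp add: is_ideal_def)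
      fix c assume s: "(\<Sum>i\<in>?T. scale_poly (c i) (monom_poly i)) \<in> J"
      have "(\<Sum>i\<in>?T. scale_poly (c i) (monom_poly i)) \<in> poly_in A"
        unfolding poly_in_def mem_Collect_eq by (rule keys_linear_combination) (auto simp: U_def)
      then have "(\<Sum>i\<in>?T. scale_poly (c i) (monom_poly i)) = 0" using A s by (auto simp: indep_vars_def)
      then show "\<forall>i\<in>?T. c i = 0" by (rule sum_monom_eq_0D[OF finite_aff_count_set])
    qed auto
    then show ?thesis by (simp add: aff_count_def)
  qed
  have "J \<noteq> UNIV" using A by (rule indep_vars_proper)
  then have "free_dim U \<le> pdim J"
    by (intro free_dim_le_of_limit[OF up _ hf_limit[OF J]]) (simp add: le)
  then show ?thesis using free_dim_ge[OF \<open>free_set U A\<close>] by simp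
qed

lemma pdim_attained:
  fixes J :: "('n, 'k::field) mpoly set"
  assumes J: "is_ideal J" "J \<noteq> UNIV"
  obtains A where "indep_vars J A" "card A = pdim J"
  using free_dim_attained[of "init_mons lt J"] zero_in_init_mons_iff[OF J(1)] J(2) indep_vars_of_free_set
  unfolding pdim_def by metis

lemma pdim_antimono:
  fixes I J :: "('n, 'k::field) mpoly set"
  assumes "is_ideal I" "is_ideal J" "I \<subseteq> J" "J \<noteq> UNIV"
  shows "pdim J \<le> pdim I"
  using pdim_attained[OF assms(2,4)] card_le_pdim[OF assms(1)] indep_vars_antimono[OF _ assms(3)] by metis

lemma hf_antimono: "I \<subseteq> J \<Longrightarrow> hf J n \<le> hf I n"
  by (intro aff_count_antimono init_mons_mono)

lemma hf_split:
  assumes "I \<subseteq> J"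
  shows "card {m. mon_deg m \<le> n \<and> m \<in> init_mons lt J - init_mons lt I} + hf J n = hf I n"
proof -
  have "{m. mon_deg m \<le> n \<and> m \<notin> init_mons lt I}
      = {m. mon_deg m \<le> n \<and> m \<in> init_mons lt J - init_mons lt I} \<union> {m. mon_deg m \<le> n \<and> m \<notin> init_mons lt J}"
    using init_mons_mono[OF assms] by blast
  moreover have "card \<dots> = card {m. mon_deg m \<le> n \<and> m \<in> init_mons lt J - init_mons lt I}
      + card {m. mon_deg m \<le> n \<and> m \<notin> init_mons lt J}"
    by (rule card_Un_disjoint) auto
  ultimately show ?thesis by (simp add: aff_count_def)
qed

lemma sum_monom_mult:
  "(\<Sum>m\<in>T. scale_poly (c m) (monom_poly m * h)) = (\<Sum>m\<in>T. scale_poly (c m) (monom_poly m)) * h"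
  by (simp add: sum_distrib_right scale_poly_mult_left)

text \<open>Multiplication by \<open>h\<close> embeds \<open>S/(I : h)\<close> into \<open>J/I\<close>.\<close>

lemma hf_colon:
  fixes I J :: "('n, 'k::field) mpoly set"
  assumes IJ: "is_ideal I" "is_ideal J" "I \<subseteq> J" and h: "h \<in> J" "keys h \<subseteq> {m. mon_deg m \<le> e}"
  shows "hf {g. g * h \<in> I} n + hf J (n + e) \<le> hf I (n + e)"
proof -
  let ?P = "{g. g * h \<in> I}"
  let ?T = "{m. mon_deg m \<le> n \<and> m \<notin> init_mons lt ?P}"
  have "card ?T \<le> card {m. mon_deg m \<le> n + e \<and> m \<in> init_mons lt J - init_mons lt I}"
  proof (rule card_le_init_mons_diff[where b="\<lambda>m. monom_poly m * h", OF IJ])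
    show "monom_poly m * h \<in> J" for m using is_idealD(3)[OF IJ(2) h(1)] .
    show "keys (monom_poly m * h) \<subseteq> {m. mon_deg m \<le> n + e}" if "m \<in> ?T" for m
      using that by (intro keys_mult_deg_le h(2)) auto
    fix c assume "(\<Sum>m\<in>?T. scale_poly (c m) (monom_poly m * h)) \<in> I"
    then have "(\<Sum>m\<in>?T. scale_poly (c m) (monom_poly m)) \<in> ?P" by (simp add: sum_monom_mult)
    moreover have "keys (\<Sum>m\<in>?T. scale_poly (c m) (monom_poly m)) \<subseteq> - init_mons lt ?P"
      by (rule keys_linear_combination) auto
    then have "keys (\<Sum>m\<in>?T. scale_poly (c m) (monom_poly m)) \<inter> init_mons lt ?P = {}" by blast
    ultimately have "(\<Sum>m\<in>?T. scale_poly (c m) (monom_poly m)) = 0" by (rule init_mons_eq_0)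
    then show "\<forall>m\<in>?T. c m = 0" by (rule sum_monom_eq_0D[OF finite_aff_count_set])
  qed simp
  then show ?thesis using hf_split[OF IJ(3), of "n + e"] by (simp add: aff_count_def)
qed

lemma poly_deg_bound: "\<exists>e. keys f \<subseteq> {m :: 'n mon. mon_deg m \<le> e}"
  by (rule exI[of _ "Max (mon_deg ` keys f)"]) auto

text \<open>If the dimensions agreed, \<open>hf Q n\<close> would be at most
  \<open>hf P n - hf P (n - e)\<close>, with \<open>e\<close> bounding the degree of an element of
  \<open>Q - P\<close>. The leading terms of this difference cancel, whereas that of
  \<open>hf Q\<close> is positive.\<close>

lemma prime_pdim_strict:
  fixes P Q :: "('n, 'k::field) mpoly set"
  assumes P: "is_prime P" and Q: "is_ideal Q" "Q \<noteq> UNIV" and PQ: "P \<subset> Q"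
  shows "pdim Q < pdim P"
proof (rule ccontr)
  have iP: "is_ideal P" "P \<noteq> UNIV" using P by (auto simp: is_prime_def)
  assume "\<not> pdim Q < pdim P"
  then have k: "pdim Q = pdim P" using pdim_antimono[OF iP(1) Q(1) _ Q(2)] PQ by auto
  obtain f where f: "f \<in> Q" "f \<notin> P" using PQ by blast
  obtain e where e: "keys f \<subseteq> {m. mon_deg m \<le> e}" using poly_deg_bound by blast
  \<comment> \<open>Primality enters here: \<open>P : f = P\<close>, so \<open>S/P\<close> itself
    embeds into \<open>Q/P\<close> with degrees shifted by \<open>e\<close>.\<close>
  have "{g. g * f \<in> P} = P" using f(2) P by (auto simp: is_prime_def intro: is_idealD)
  then have le: "hf P n + hf Q (n + e) \<le> hf P (n + e)" for n
    using hf_colon[OF iP(1) Q(1) _ f(1) e, of n] PQ by auto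
  have 1: "(\<lambda>n. real (hf P n) / real n ^ pdim P - real (hf P (n - e)) / real n ^ pdim P) \<longlonglongrightarrow>
      real (pmult P) / fact (pdim P) - real (pmult P) / fact (pdim P)"
    by (intro tendsto_diff hf_limit iP tendsto_shift_power)
  have 2: "(\<lambda>n. real (hf Q n) / real n ^ pdim P) \<longlonglongrightarrow> real (pmult Q) / fact (pdim P)"
    using hf_limit[OF Q] k by simp
  have "\<forall>n\<ge>e. real (hf Q n) / real n ^ pdim P \<le> real (hf P n) / real n ^ pdim P - real (hf P (n - e)) / real n ^ pdim P"
  proof (intro allI impI)
    fix n assume "n \<ge> e"
    then have "real (hf Q n) \<le> real (hf P n) - real (hf P (n - e))" using le[of "n - e"] by simp
    then show "real (hf Q n) / real n ^ pdim P \<le> real (hf P n) / real n ^ pdim P - real (hf P (n - e)) / real n ^ pdim P"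
      by (simp add: diff_divide_distrib[symmetric] divide_right_mono)
  qed
  then have "real (pmult Q) / fact (pdim P) \<le> real (pmult P) / fact (pdim P) - real (pmult P) / fact (pdim P)"
    by (intro LIMSEQ_le[OF 2 1] exI)
  then show False using pmult_ge[OF Q] by (simp add: field_simps)
qed

lemma prime_chain_pdim:
  fixes p :: "nat \<Rightarrow> ('n, 'k::field) mpoly set"
  assumes "prime_chain poly_ring n p"
  shows "pdim (p n) + n \<le> pdim (p 0)"
  using assms
proof (induction n)
  case (Suc n)
  then have "prime_chain poly_ring n p" by (simp add: prime_chain_def)
  moreover have "pdim (p (Suc n)) < pdim (p n)"
    using Suc.prems by (intro prime_pdim_strict) (auto simp: prime_chain_def primeideal_iff is_prime_def)
  ultimately show ?case using Suc.IH by simp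
qed simp

lemma SUP_enat_eq:
  assumes "k \<in> S" "\<And>n. n \<in> S \<Longrightarrow> n \<le> k"
  shows "(SUP n\<in>S. enat n) = enat k"
  using assms by (intro antisym SUP_least SUP_upper) auto

lemma pdim_le_card: "is_ideal J \<Longrightarrow> J \<noteq> UNIV \<Longrightarrow> pdim (J :: ('n, 'k::field) mpoly set) \<le> card (UNIV :: 'n set)"
  by (metis pdim_attained card_mono finite_UNIV subset_UNIV finite)

theorem height_eq:
  fixes P :: "('n, 'k::field) mpoly set"
  assumes P: "is_prime P"
  shows "height poly_ring P = enat (card (UNIV :: 'n set) - pdim P)"
  unfolding height_def
proof (rule SUP_enat_eq)
  have iP: "is_ideal P" "P \<noteq> UNIV" using P by (auto simp: is_prime_def)
  obtain A where A: "indep_vars P A" "card A = pdim P" using pdim_attained[OF iP] .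
  \<comment> \<open>An independent set of largest size is also maximal under inclusion.\<close>
  have "\<not> indep_vars P (insert x A)" if "x \<notin> A" for x
    using card_le_pdim[OF iP(1), of "insert x A"] A(2) that by auto
  from chain_below_prime[OF P A(1) this]
  have "\<exists>p. prime_chain poly_ring (card (- A)) p \<and> p (card (- A)) = P" by blast
  moreover have "card (- A) = card (UNIV :: 'n set) - pdim P" using A(2) by (simp add: card_Diff_subset Compl_eq_Diff_UNIV)
  ultimately show "card (UNIV :: 'n set) - pdim P \<in> {n. \<exists>p. prime_chain poly_ring n p \<and> p n = P}" by simp
  fix n assume "n \<in> {n. \<exists>p. prime_chain poly_ring n p \<and> p n = P}"
  then obtain p where p: "prime_chain poly_ring n p" "p n = P" by blast
  have "is_prime (p 0)" using p(1) by (simp add: prime_chain_def primeideal_iff)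
  then have "pdim (p 0) \<le> card (UNIV :: 'n set)" by (intro pdim_le_card) (auto simp: is_prime_def)
  then show "n \<le> card (UNIV :: 'n set) - pdim P" using prime_chain_pdim[OF p(1)] p(2) by simp
qed

section \<open>Graded primes and chains above a graded ideal\<close>

lemma graded_ideal_gen_insert:
  fixes P :: "('n, 'k::field) mpoly set"
  assumes P: "graded_ideal P" and f: "keys f \<subseteq> {m. mon_deg m = c}"
  shows "graded_ideal (ideal_gen (P \<union> {f}))"
proof (rule graded_idealI[OF is_ideal_ideal_gen])
  note iP = graded_idealD[OF P]
  fix q d assume "q \<in> ideal_gen (P \<union> {f})"
  then obtain p g where q: "q = p + g * f" "p \<in> P" using ideal_gen_insert[OF iP(1)] by blast
  have "part {m. mon_deg m = d} (g * f) = part {m. mon_deg m + c = d} g * f"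
    by (rule part_mult_left) (use f in auto)
  then have "part {m. mon_deg m = d} q = part {m. mon_deg m = d} p + part {m. mon_deg m + c = d} g * f"
    by (simp add: q)
  then show "part {m. mon_deg m = d} q \<in> ideal_gen (P \<union> {f})"
    using iP(2)[OF q(2)] ideal_gen_insert[OF iP(1)] by blast
qed

text \<open>Take a graded ideal maximal among those containing \<open>J\<close> that meet
  \<open>K[A]\<close> in \<open>0\<close>. Only homogeneous elements can be adjoined without leaving
  the graded ideals, and by \<open>graded_primeI\<close> testing these suffices.\<close>

lemma graded_prime_above:
  fixes J :: "('n, 'k::field) mpoly set"
  assumes J: "graded_ideal J" and A: "indep_vars J A"
  obtains P where "graded_ideal P" "is_prime P" "J \<subseteq> P" "indep_vars P A"
proof -
  define S where "S = {P. graded_ideal P \<and> J \<subseteq> P \<and> indep_vars P A}"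
  have "J \<in> S" using J A by (simp add: S_def)
  moreover have "is_ideal P" if "P \<in> S" for P using that graded_idealD(1) by (auto simp: S_def)
  ultimately obtain M where M: "M \<in> S" "\<And>P. P \<in> S \<Longrightarrow> M \<subseteq> P \<Longrightarrow> P = M"
    using ideal_maximal[of S] by blast
  have gM: "graded_ideal M" "J \<subseteq> M" "indep_vars M A" using M(1) by (auto simp: S_def)
  note iM = graded_idealD[OF gM(1)]
  have wit: "\<exists>p g. p \<in> M \<and> p + g * a \<in> poly_in A \<and> p + g * a \<noteq> 0"
    if "keys a \<subseteq> {m. mon_deg m = c}" "a \<notin> M" for a c
  proof -
    let ?N = "ideal_gen (M \<union> {a})"
    have "M \<subseteq> ?N" "a \<in> ?N" using ideal_gen_superset[of "M \<union> {a}"] by auto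
    then have "?N \<notin> S" using M(2) that(2) by blast
    moreover have "graded_ideal ?N" by (rule graded_ideal_gen_insert[OF gM(1) that(1)])
    ultimately have "\<not> indep_vars ?N A" using \<open>M \<subseteq> ?N\<close> gM(2) by (auto simp: S_def)
    then obtain q where "q \<in> ?N" "q \<in> poly_in A" "q \<noteq> 0" by (auto simp: indep_vars_def)
    then show ?thesis unfolding ideal_gen_insert[OF iM(1)] by blast
  qed
  have "is_prime M"
  proof (rule graded_primeI[where \<gamma>=mon_deg and prec="(<)", OF iM(1) indep_vars_proper[OF gM(3)]])
    fix a b c d assume a: "keys a \<subseteq> {m. mon_deg m = c}" and b: "keys b \<subseteq> {m. mon_deg m = d}" and ab: "a * b \<in> M"
    show "a \<in> M \<or> b \<in> M"
    proof (rule ccontr)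
      assume "\<not> (a \<in> M \<or> b \<in> M)"
      then obtain p g q h where pg: "p \<in> M" "p + g * a \<in> poly_in A" "p + g * a \<noteq> 0"
        and qh: "q \<in> M" "q + h * b \<in> poly_in A" "q + h * b \<noteq> 0"
        using wit[OF a] wit[OF b] by blast
      \<comment> \<open>Adjoining \<open>a\<close> or \<open>b\<close> produces a nonzero element of
        \<open>K[A]\<close>. The product of the two elements lies in \<open>M\<close> as well as in
        \<open>K[A]\<close>, so it would have to be zero.\<close>
      have "(p + g * a) * (q + h * b) = p * (q + h * b) + (g * a) * q + (g * h) * (a * b)"
        by (simp add: algebra_simps)
      also have "\<dots> \<in> M"
        by (rule is_idealD(2)[OF iM(1) is_idealD(2)[OF iM(1) is_idealD(4)[OF iM(1) pg(1)]
              is_idealD(3)[OF iM(1) qh(1)]] is_idealD(3)[OF iM(1) ab]])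
      finally have "(p + g * a) * (q + h * b) \<in> M" .
      then have "(p + g * a) * (q + h * b) = 0"
        using gM(3) poly_in_mult[OF pg(2) qh(2)] by (auto simp: indep_vars_def)
      then show False using poly_no_zero_divisors[OF pg(3) qh(3)] by blast
    qed
  qed (use iM in auto)
  then show ?thesis using that gM by blast
qed

text \<open>Modulo \<open>P\<close>, elements of \<open>(P, f)\<close> of degree at most
  \<open>n + 1\<close> are combinations of \<open>f\<close> times standard monomials of degree at
  most \<open>n\<close>. So \<open>hf P\<close> grows by at most \<open>hf Q (n + 1)\<close> in that
  step, and summation costs one power of \<open>n\<close>.\<close>

lemma pdim_insert_linear:
  fixes P :: "('n, 'k::field) mpoly set"
  assumes P: "graded_ideal P" and f: "keys f \<subseteq> {m. mon_deg m = 1}" and ne: "ideal_gen (P \<union> {f}) \<noteq> UNIV"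
  shows "pdim P \<le> Suc (pdim (ideal_gen (P \<union> {f})))"
proof -
  note iP = graded_idealD[OF P]
  define Q where "Q = ideal_gen (P \<union> {f})"
  have iQ: "is_ideal Q" "Q \<noteq> UNIV" using is_ideal_ideal_gen ne by (auto simp: Q_def)
  have PQ: "P \<subseteq> Q" using ideal_gen_superset[of "P \<union> {f}"] by (auto simp: Q_def)
  have Pne: "P \<noteq> UNIV" using PQ iQ(2) by blast
  have step: "hf P (Suc n) \<le> hf Q (Suc n) + hf P n" for n
  proof -
    let ?T = "{m. mon_deg m \<le> n \<and> m \<notin> init_mons lt P}"
    have "card {m. mon_deg m \<le> Suc n \<and> m \<in> init_mons lt Q - init_mons lt P} \<le> card ?T"
    proof (rule init_mons_diff_card_le[where b="\<lambda>m. monom_poly m * f", OF iP(1)])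
      fix q assume q: "q \<in> Q" "keys q \<subseteq> {m. mon_deg m \<le> Suc n}"
      obtain p g where pg: "q = p + g * f" "p \<in> P" using q(1) ideal_gen_insert[OF iP(1)] by (auto simp: Q_def)
      \<comment> \<open>High degrees in \<open>p\<close> and \<open>g * f\<close> may cancel. Both
        can be truncated since \<open>P\<close> is graded and \<open>f\<close> is homogeneous of
        degree 1.\<close>
      define g' where "g' = part {m. mon_deg m \<le> n} g"
      define p' where "p' = part {m. mon_deg m \<le> Suc n} p"
      have "part {m. mon_deg m \<le> Suc n} (g * f) = g' * f"
        unfolding g'_def by (rule part_mult_left) (use f in auto)
      then have q': "q = p' + g' * f" using part_id[OF q(2)] by (simp add: pg(1) p'_def)
      have "p' = (\<Sum>d\<le>Suc n. part {m. mon_deg m = d} p)"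
        unfolding p'_def by (subst sum_parts) auto
      then have p'P: "p' \<in> P" using is_ideal_sum[OF iP(1)] iP(2)[OF pg(2)] by metis
      let ?r = "nf P g'"
      have kr: "keys ?r \<subseteq> ?T"
        using nf_deg[OF iP(1), of g' n] keys_nf[OF iP(1), of g'] by (auto simp: g'_def keys_part)
      have "?r * f = (\<Sum>m\<in>?T. scale_poly (lookup ?r m) (monom_poly m * f))"
        unfolding sum_monom_mult
        by (rule arg_cong[OF poly_expansion[OF finite_aff_count_set kr], of "\<lambda>x. x * f"])
      moreover have "q - ?r * f = p' + (g' - ?r) * f" by (simp add: q' algebra_simps)
      moreover have "p' + (g' - ?r) * f \<in> P"
        using p'P nf_cong[OF iP(1)] is_idealD(2,4)[OF iP(1)] by blast
      ultimately have "q - (\<Sum>m\<in>?T. scale_poly (lookup ?r m) (monom_poly m * f)) \<in> P" by argo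
      then show "\<exists>c. q - (\<Sum>m\<in>?T. scale_poly (c m) (monom_poly m * f)) \<in> P"
        by (intro exI[of _ "lookup ?r"])
    qed simp
    then show ?thesis using hf_split[OF PQ, of "Suc n"] by (simp add: aff_count_def)
  qed
  have mono: "hf Q n \<le> hf Q (Suc n)" for n unfolding aff_count_def by (rule card_mono) auto
  have bound: "hf P n \<le> Suc n * hf Q n" for n
  proof (induction n)
    case 0
    have "hf P 0 \<le> 1" unfolding aff_count_def by (rule card_le_Suc0_iff_eq[THEN iffD2, unfolded One_nat_def[symmetric]]) auto
    moreover have "0 \<notin> init_mons lt Q" using zero_in_init_mons_iff[OF iQ(1)] iQ(2) by simp
    then have "{m. mon_deg m \<le> 0 \<and> m \<notin> init_mons lt Q} = {0}" by auto
    then have "hf Q 0 = 1" by (simp add: aff_count_def)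
    ultimately show ?case by simp
  next
    case (Suc n)
    have "hf P (Suc n) \<le> hf Q (Suc n) + Suc n * hf Q n" using step[of n] Suc.IH by simp
    also have "\<dots> \<le> hf Q (Suc n) + Suc n * hf Q (Suc n)" using mono by (intro add_left_mono mult_left_mono) auto
    finally show ?case by simp
  qed
  let ?l = "pdim Q"
  have "(\<lambda>n. (1 + 1 / real n) * (real (hf Q n) / real n ^ ?l)) \<longlonglongrightarrow> (1 + 0) * (real (pmult Q) / fact ?l)"
    by (intro tendsto_intros hf_limit iQ lim_const_over_n)
  moreover have "\<forall>\<^sub>F n in sequentially. (1 + 1 / real n) * (real (hf Q n) / real n ^ ?l)
      = real (Suc n * hf Q n) / real n ^ Suc ?l"
    using eventually_gt_at_top[of 0]
  proof eventually_elim
    case (elim n)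
    then have "1 + 1 / real n = real (Suc n) / real n" by (simp add: field_simps)
    then show ?case by (simp only: of_nat_mult power_Suc times_divide_times_eq)
  qed
  ultimately have lim: "(\<lambda>n. real (Suc n * hf Q n) / real n ^ Suc ?l) \<longlonglongrightarrow> (1 + 0) * (real (pmult Q) / fact ?l)"
    by (rule Lim_transform_eventually)
  have "real (hf P n) \<le> real (Suc n * hf Q n)" for n using bound[of n] by (simp only: of_nat_le_iff)
  from free_dim_le_of_limit[OF up_closed_init_mons[OF iP(1)] _ this lim]
  show ?thesis using zero_in_init_mons_iff[OF iP(1)] Pne by (simp add: pdim_def Q_def)
qed

text \<open>A variable from the independent set is a linear form outside the graded prime
  \<open>P\<close>. Adjoining it lowers the dimension by at most one, which leaves room for a chain
  of length \<open>k\<close> above.\<close>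

lemma chain_above:
  fixes J :: "('n, 'k::field) mpoly set"
  assumes "graded_ideal J" "J \<noteq> UNIV" "k \<le> pdim J"
  shows "\<exists>p. prime_chain poly_ring k p \<and> J \<subseteq> p 0"
  using assms
proof (induction k arbitrary: J)
  case 0
  obtain A where "indep_vars J A" using pdim_attained[OF graded_idealD(1)[OF 0(1)] 0(2)] by blast
  then obtain P where "is_prime P" "J \<subseteq> P" using graded_prime_above[OF 0(1)] by metis
  then show ?case by (intro exI[of _ "\<lambda>_. P"]) (simp add: prime_chain_def primeideal_iff)
next
  case (Suc k)
  obtain A where A: "indep_vars J A" "card A = pdim J"
    using pdim_attained[OF graded_idealD(1)[OF Suc.prems(1)] Suc.prems(2)] by blast
  obtain P where P: "graded_ideal P" "is_prime P" "J \<subseteq> P" "indep_vars P A"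
    using graded_prime_above[OF Suc.prems(1) A(1)] .
  have dP: "Suc k \<le> pdim P" using card_le_pdim[OF graded_idealD(1)[OF P(1)] P(4)] A(2) Suc.prems(3) by simp
  have "A \<noteq> {}" using A(2) Suc.prems(3) by auto
  then obtain x where x: "x \<in> A" by blast
  define f where "f = (monom_poly (single x 1) :: ('n, 'k) mpoly)"
  have f1: "keys f \<subseteq> {m. mon_deg m = 1}" by (simp add: f_def)
  have "f \<in> poly_in A" using x by (simp add: f_def poly_in_def)
  moreover have "f \<noteq> 0" unfolding f_def by (rule monom_poly_nonzero)
  ultimately have fP: "f \<notin> P" using P(4) by (auto simp: indep_vars_def)
  let ?Q = "ideal_gen (P \<union> {f})"
  \<comment> \<open>Multiples of a linear form have no constant term, so \<open>1\<close> in
    \<open>?Q\<close> would force \<open>1\<close> into the graded ideal \<open>P\<close>.\<close>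
  have "?Q \<noteq> UNIV"
  proof
    assume "?Q = UNIV"
    then obtain p g where pg: "1 = p + g * f" "p \<in> P"
      using ideal_gen_insert[OF graded_idealD(1)[OF P(1)]] by blast
    have "part {m. mon_deg m = 0} (g * f) = part {} g * f"
      by (rule part_mult_left) (use f1 in \<open>auto simp del: mon_deg_eq_0_iff\<close>)
    also have "\<dots> = 0" by (simp add: part_0)
    finally have "part {m. mon_deg m = 0} (p + g * f) = part {m. mon_deg m = 0} p" by simp
    moreover have "part {m. mon_deg m = 0} (1 :: ('n, 'k) mpoly) = 1" by (rule part_id) simp
    ultimately have "1 = part {m. mon_deg m = 0} p" using pg(1) by simp
    then have "1 \<in> P" using graded_idealD(2)[OF P(1) pg(2)] by metis
    then show False using P(2) is_ideal_UNIV_iff by (auto simp: is_prime_def)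
  qed
  moreover have "k \<le> pdim ?Q" using pdim_insert_linear[OF P(1) f1 \<open>?Q \<noteq> UNIV\<close>] dP by simp
  ultimately obtain p where p: "prime_chain poly_ring k p" "?Q \<subseteq> p 0"
    using Suc.IH[OF graded_ideal_gen_insert[OF P(1) f1]] by blast
  have "P \<subset> p 0" using p(2) ideal_gen_superset[of "P \<union> {f}"] fP by blast
  then have "prime_chain poly_ring (Suc k) (case_nat P p)"
    using p(1) P(2) unfolding prime_chain_def
    by (auto simp: primeideal_iff split: nat.split)
  then show ?case using P(3) by (intro exI[of _ "case_nat P p"]) simp
qed

end

subsection \<open>Krull dimension of graded quotients\<close>

lemma quot_coset_eq_iff:
  assumes "is_ideal (J :: 'a::comm_ring_1 set)"
  shows "J +>\<^bsub>ring_of_type_algebra\<^esub> f = J +>\<^bsub>ring_of_type_algebra\<^esub> g \<longleftrightarrow> f - g \<in> J"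
proof -
  have c: "J +>\<^bsub>ring_of_type_algebra\<^esub> f = {j + f | j. j \<in> J}" for f
    by (auto simp: a_r_coset_def r_coset_def)
  show ?thesis
  proof
    assume "J +>\<^bsub>ring_of_type_algebra\<^esub> f = J +>\<^bsub>ring_of_type_algebra\<^esub> g"
    moreover have "0 + f \<in> J +>\<^bsub>ring_of_type_algebra\<^esub> f" unfolding c using is_idealD(1)[OF assms] by blast
    ultimately show "f - g \<in> J" unfolding c by auto
  next
    assume fg: "f - g \<in> J"
    have "{j + f | j. j \<in> J} \<subseteq> {j + g | j. j \<in> J}" if "f - g \<in> J" for f g
    proof clarify
      fix j assume "j \<in> J"
      then have "j + (f - g) \<in> J" "j + f = (j + (f - g)) + g" using is_idealD(2)[OF assms] that by auto
      then show "\<exists>i. j + f = i + g \<and> i \<in> J" by blast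
    qed
    moreover have "g - f \<in> J" using is_idealD(5)[OF assms fg] by simp
    ultimately show "J +>\<^bsub>ring_of_type_algebra\<^esub> f = J +>\<^bsub>ring_of_type_algebra\<^esub> g"
      unfolding c using fg by blast
  qed
qed

lemma carrier_Quot:
  fixes J :: "'a::comm_ring_1 set"
  shows "carrier (ring_of_type_algebra Quot J) = range (\<lambda>f. J +>\<^bsub>ring_of_type_algebra\<^esub> f)"
  unfolding FactRing_def A_RCOSETS_defs a_r_coset_def by auto

lemma quot_hom:
  fixes J :: "'a::comm_ring_1 set"
  assumes "is_ideal J"
  defines "R \<equiv> ring_of_type_algebra :: 'a ring"
  shows "(J +>\<^bsub>R\<^esub> f) \<oplus>\<^bsub>R Quot J\<^esub> (J +>\<^bsub>R\<^esub> g) = J +>\<^bsub>R\<^esub> (f + g)"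
    and "(J +>\<^bsub>R\<^esub> f) \<otimes>\<^bsub>R Quot J\<^esub> (J +>\<^bsub>R\<^esub> g) = J +>\<^bsub>R\<^esub> (f * g)"
    and "\<zero>\<^bsub>R Quot J\<^esub> = J +>\<^bsub>R\<^esub> 0"
proof -
  have I: "ideal J R" using assms by (simp add: ideal_iff)
  interpret h: ring_hom_ring R "R Quot J" "(+>\<^bsub>R\<^esub>) J" by (rule ideal.rcos_ring_hom_ring[OF I])
  show "(J +>\<^bsub>R\<^esub> f) \<oplus>\<^bsub>R Quot J\<^esub> (J +>\<^bsub>R\<^esub> g) = J +>\<^bsub>R\<^esub> (f + g)"
    using h.hom_add[of f g] by (simp add: R_def)
  show "(J +>\<^bsub>R\<^esub> f) \<otimes>\<^bsub>R Quot J\<^esub> (J +>\<^bsub>R\<^esub> g) = J +>\<^bsub>R\<^esub> (f * g)"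
    using h.hom_mult[of f g] by (simp add: R_def)
  show "\<zero>\<^bsub>R Quot J\<^esub> = J +>\<^bsub>R\<^esub> 0" using h.hom_zero by (simp add: R_def)
qed

lemma prime_of_quot_prime:
  fixes J :: "'a::comm_ring_1 set"
  assumes J: "is_ideal J" and q: "primeideal q (ring_of_type_algebra Quot J)"
  shows "is_prime {f. J +>\<^bsub>ring_of_type_algebra\<^esub> f \<in> q}" and "J \<subseteq> {f. J +>\<^bsub>ring_of_type_algebra\<^esub> f \<in> q}"
proof -
  let ?R = "ring_of_type_algebra :: 'a ring"
  interpret q: primeideal q "?R Quot J" by (rule q)
  note h = quot_hom[OF J]
  have c: "J +>\<^bsub>?R\<^esub> f \<in> carrier (?R Quot J)" for f by (simp add: carrier_Quot)
  have z: "J +>\<^bsub>?R\<^esub> 0 \<in> q" using additive_subgroup.zero_closed[OF q.is_additive_subgroup] by (simp add: h(3))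
  show "is_prime {f. J +>\<^bsub>?R\<^esub> f \<in> q}"
    unfolding is_prime_def is_ideal_def
  proof (safe, goal_cases)
    case 1 show ?case by (rule z)
  next
    case (2 a b) then show ?case using additive_subgroup.a_closed[OF q.is_additive_subgroup, of "J +>\<^bsub>?R\<^esub> a" "J +>\<^bsub>?R\<^esub> b"] by (simp add: h(1))
  next
    case (3 a r) then show ?case using q.I_l_closed[OF _ c] by (simp add: h(2)[symmetric])
  next
    case 4
    then have "q = carrier (?R Quot J)" using q.a_subset by (auto simp: carrier_Quot)
    then show False using q.I_notcarr by simp
  next
    case (5 a b)
    then show ?case using q.I_prime[OF c c, of a b] by (simp add: h(2))
  qed
  show "J \<subseteq> {f. J +>\<^bsub>?R\<^esub> f \<in> q}"
  proof
    fix f assume "f \<in> J"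
    then have "J +>\<^bsub>?R\<^esub> f = J +>\<^bsub>?R\<^esub> 0" using quot_coset_eq_iff[OF J, of f 0] by simp
    then show "f \<in> {f. J +>\<^bsub>?R\<^esub> f \<in> q}" using z by simp
  qed
qed

lemma quot_prime_of_prime:
  fixes J :: "'a::comm_ring_1 set"
  assumes J: "is_ideal J" and P: "is_prime P" "J \<subseteq> P"
  shows "primeideal ((+>\<^bsub>ring_of_type_algebra\<^esub>) J ` P) (ring_of_type_algebra Quot J)"
    and "J +>\<^bsub>ring_of_type_algebra\<^esub> f \<in> (+>\<^bsub>ring_of_type_algebra\<^esub>) J ` P \<longleftrightarrow> f \<in> P"
proof -
  let ?R = "ring_of_type_algebra :: 'a ring"
  have iP: "is_ideal P" "P \<noteq> UNIV" "\<And>a b. a * b \<in> P \<Longrightarrow> a \<in> P \<or> b \<in> P" using P by (auto simp: is_prime_def)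
  show mem: "J +>\<^bsub>?R\<^esub> f \<in> (+>\<^bsub>?R\<^esub>) J ` P \<longleftrightarrow> f \<in> P" for f
  proof
    assume "J +>\<^bsub>?R\<^esub> f \<in> (+>\<^bsub>?R\<^esub>) J ` P"
    then obtain g where "g \<in> P" "J +>\<^bsub>?R\<^esub> f = J +>\<^bsub>?R\<^esub> g" by blast
    then have "g \<in> P" "f - g \<in> P" using quot_coset_eq_iff[OF J] P(2) by auto
    then have "g + (f - g) \<in> P" by (rule is_idealD(2)[OF iP(1)])
    then show "f \<in> P" by simp
  qed blast
  show "primeideal ((+>\<^bsub>?R\<^esub>) J ` P) (?R Quot J)"
  proof (rule primeidealI)
    show "ideal ((+>\<^bsub>?R\<^esub>) J ` P) (?R Quot J)"
      using ring.ring_ideal_imp_quot_ideal[OF ring_from_type_algebra] J iP(1) by (simp add: ideal_iff)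
    show "cring (?R Quot J)"
      using ideal.quotient_is_cring[of J ?R] J cring_from_type_algebra by (auto simp: ideal_iff)
    show "carrier (?R Quot J) \<noteq> (+>\<^bsub>?R\<^esub>) J ` P"
    proof
      assume eq: "carrier (?R Quot J) = (+>\<^bsub>?R\<^esub>) J ` P"
      obtain x where "x \<notin> P" using iP(2) by blast
      moreover have "J +>\<^bsub>?R\<^esub> x \<in> carrier (?R Quot J)" by (simp add: carrier_Quot)
      ultimately show False using mem eq by blast
    qed
    fix a b assume "a \<in> carrier (?R Quot J)" "b \<in> carrier (?R Quot J)" and ab: "a \<otimes>\<^bsub>?R Quot J\<^esub> b \<in> (+>\<^bsub>?R\<^esub>) J ` P"
    then obtain f g where "a = J +>\<^bsub>?R\<^esub> f" "b = J +>\<^bsub>?R\<^esub> g" by (auto simp: carrier_Quot)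
    then show "a \<in> (+>\<^bsub>?R\<^esub>) J ` P \<or> b \<in> (+>\<^bsub>?R\<^esub>) J ` P"
      using ab iP(3)[of f g] quot_hom(2)[OF J, of f g] mem by auto
  qed
qed

context deg_order
begin

text \<open>Chains in the quotient correspond to chains of primes containing \<open>J\<close>. The
  upper bound concerns arbitrary such chains; gradedness enters through the chain built in
  \<open>chain_above\<close>.\<close>

theorem krull_dim_quot:
  fixes J :: "('n, 'k::field) mpoly set"
  assumes J: "graded_ideal J" "J \<noteq> UNIV"
  shows "krull_dim (poly_ring Quot J) = enat (pdim J)"
  unfolding krull_dim_def
proof (rule SUP_enat_eq)
  note iJ = graded_idealD(1)[OF J(1)]
  obtain p where p: "prime_chain poly_ring (pdim J) p" "J \<subseteq> p 0" using chain_above[OF J order_refl] by blast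
  have Jp: "J \<subseteq> p i" if "i \<le> pdim J" for i
    using that
  proof (induction i)
    case (Suc i)
    have "p i \<subset> p (Suc i)" using p(1) Suc.prems by (simp add: prime_chain_def)
    then show ?case using Suc by auto
  qed (use p in simp)
  let ?q = "\<lambda>i. (+>\<^bsub>poly_ring\<^esub>) J ` p i"
  have "prime_chain (poly_ring Quot J) (pdim J) ?q"
    unfolding prime_chain_def
  proof (intro conjI allI impI)
    show "primeideal (?q i) (poly_ring Quot J)" if "i \<le> pdim J" for i
      using quot_prime_of_prime(1)[OF iJ _ Jp[OF that]] p(1) that by (simp add: prime_chain_def primeideal_iff)
    fix i assume i: "i < pdim J"
    then have "p i \<subset> p (Suc i)" using p(1) by (simp add: prime_chain_def)
    then obtain f where "p i \<subseteq> p (Suc i)" "f \<in> p (Suc i)" "f \<notin> p i" by blast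
    moreover have "is_prime (p i)" using p(1) i by (simp add: prime_chain_def primeideal_iff)
    ultimately show "?q i \<subset> ?q (Suc i)"
      using quot_prime_of_prime(2)[OF iJ _ Jp[of i], of f] i by (auto simp: image_mono)
  qed
  then show "pdim J \<in> {n. \<exists>p. prime_chain (poly_ring Quot J) n p}" by blast
  fix n assume "n \<in> {n. \<exists>p. prime_chain (poly_ring Quot J) n p}"
  then obtain q where q: "prime_chain (poly_ring Quot J) n q" by blast
  define p' where "p' i = {f. J +>\<^bsub>poly_ring\<^esub> f \<in> q i}" for i
  have pr: "is_prime (p' i)" "J \<subseteq> p' i" if "i \<le> n" for i
    using prime_of_quot_prime[OF iJ, of "q i"] q that by (auto simp: prime_chain_def p'_def)
  have "prime_chain poly_ring n p'"
    unfolding prime_chain_def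
  proof (intro conjI allI impI)
    show "primeideal (p' i) poly_ring" if "i \<le> n" for i using pr that by (simp add: primeideal_iff)
    fix i assume i: "i < n"
    then have "q i \<subset> q (Suc i)" "primeideal (q (Suc i)) (poly_ring Quot J)" using q by (auto simp: prime_chain_def)
    \<comment> \<open>An element separating two primes of the quotient is a coset, so it has a
      representative in the polynomial ring.\<close>
    then obtain c where c: "c \<in> q (Suc i)" "c \<notin> q i" "c \<in> carrier (poly_ring Quot J)"
      using additive_subgroup.a_subset[OF ideal.axioms(1)[OF primeideal.axioms(1)]] by blast
    then obtain f where "c = J +>\<^bsub>poly_ring\<^esub> f" by (auto simp: carrier_Quot)
    then show "p' i \<subset> p' (Suc i)" using c \<open>q i \<subset> q (Suc i)\<close> by (auto simp: p'_def)
  qed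
  then have "n \<le> pdim (p' 0)" using prime_chain_pdim by fastforce
  also have "\<dots> \<le> pdim J"
    using pr[of 0] by (intro pdim_antimono iJ) (auto simp: is_prime_def)
  finally show "n \<le> pdim J" .
qed

theorem quot_degree_eq:
  fixes J :: "('n, 'k::field) mpoly set"
  assumes J: "graded_ideal J" "J \<noteq> UNIV"
  shows "quot_degree J = real (pmult J)"
proof (cases "pdim J = 0")
  case True
  note iJ = graded_idealD(1)[OF J(1)]
  have "quot_dim UNIV J = pmult J"
    using quot_dim_UNIV_eq[OF iJ finite_init_mons[OF iJ J(2) True]] card_init_mons[OF iJ J(2) True] by simp
  then show ?thesis by (simp add: quot_degree_def krull_dim_quot[OF J] True)
next
  case False
  note iJ = graded_idealD(1)[OF J(1)]
  have "(\<lambda>d. real (hilbert_fun J d) / real d ^ (pdim J - 1)) \<longlonglongrightarrow> real (pmult J) / fact (pdim J - 1)"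
    using mon_count_limit[OF iJ J(2)] False by (simp add: hilbert_fun_eq[OF J(1)] mon_count_def)
  then have "lim (\<lambda>d. real (hilbert_fun J d) / real d ^ (pdim J - 1)) = real (pmult J) / fact (pdim J - 1)"
    by (rule limI)
  then show ?thesis using False by (simp add: quot_degree_def krull_dim_quot[OF J])
qed

text \<open>If \<open>I : h\<close> is maximal among the ideals \<open>I : (g h0)\<close> that meet \<open>K[A]\<close> in \<open>0\<close>, and \<open>a b\<close> lies
  in it but \<open>a\<close> and \<open>b\<close> do not, then by maximality \<open>I : (h a)\<close> contains some nonzero \<open>c\<close> in \<open>K[A]\<close>,
  so that \<open>a\<close> lies in the strictly larger ideal \<open>I : (h c)\<close>, which still meets \<open>K[A]\<close> in \<open>0\<close>.\<close>

lemma colon_prime_exists: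
  fixes I :: "('n, 'k::field) mpoly set"
  assumes I: "is_ideal I" and A: "indep_vars {g. g * h0 \<in> I} A"
  obtains h where "is_prime {g. g * (h * h0) \<in> I}" "indep_vars {g. g * (h * h0) \<in> I} A"
proof -
  define S where "S = {Q. \<exists>h. Q = {g. g * (h * h0) \<in> I} \<and> indep_vars Q A}"
  have "{g. g * (1 * h0) \<in> I} \<in> S" using A unfolding S_def by (intro CollectI exI[of _ 1]) simp
  moreover have "is_ideal Q" if "Q \<in> S" for Q using that is_ideal_colon[OF I] by (auto simp: S_def)
  ultimately obtain P where P: "P \<in> S" "\<And>Q. Q \<in> S \<Longrightarrow> P \<subseteq> Q \<Longrightarrow> Q = P"
    using ideal_maximal[of S] by blast
  then obtain h where h: "P = {g. g * (h * h0) \<in> I}" "indep_vars P A" by (auto simp: S_def)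
  have "is_prime P"
    unfolding is_prime_def
  proof (intro conjI allI impI)
    show "is_ideal P" unfolding h(1) by (rule is_ideal_colon[OF I])
    show "P \<noteq> UNIV" by (rule indep_vars_proper[OF h(2)])
    fix a b assume ab: "a * b \<in> P"
    show "a \<in> P \<or> b \<in> P"
    proof (rule ccontr)
      assume "\<not> (a \<in> P \<or> b \<in> P)"
      then have aP: "a \<notin> P" and bP: "b \<notin> P" by auto
      have sub: "P \<subseteq> {g. g * ((h * c) * h0) \<in> I}" for c
      proof
        fix g assume "g \<in> P"
        then have "c * (g * (h * h0)) \<in> I" using is_idealD(3)[OF I] by (simp add: h(1))
        then show "g \<in> {g. g * ((h * c) * h0) \<in> I}" by (simp add: ac_simps)
      qed
      have "b \<in> {g. g * ((h * a) * h0) \<in> I}" using ab by (simp add: h(1) ac_simps)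
      then have "{g. g * ((h * a) * h0) \<in> I} \<noteq> P" using bP by blast
      then have "{g. g * ((h * a) * h0) \<in> I} \<notin> S" using P(2)[OF _ sub] by blast
      then have "\<not> indep_vars {g. g * ((h * a) * h0) \<in> I} A" by (auto simp: S_def)
      then obtain c where c: "c * ((h * a) * h0) \<in> I" "c \<in> poly_in A" "c \<noteq> 0" by (auto simp: indep_vars_def)
      let ?Q = "{g. g * ((h * c) * h0) \<in> I}"
      have "indep_vars ?Q A"
        unfolding indep_vars_def
      proof
        fix g assume g: "g \<in> ?Q \<inter> poly_in A"
        \<comment> \<open>Since \<open>K[A]\<close> is a domain, multiplying \<open>h\<close> by a
          nonzero \<open>c\<close> in \<open>K[A]\<close> keeps the intersection zero.\<close>
        then have "g * c \<in> P \<inter> poly_in A" using c(2) poly_in_mult by (auto simp: h(1) ac_simps)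
        then have "g * c = 0" using h(2) by (auto simp: indep_vars_def)
        then show "g = 0" using poly_no_zero_divisors[of g c] c(3) by blast
      qed
      then have "?Q \<in> S" by (auto simp: S_def)
      then have "?Q = P" using P(2) sub by blast
      moreover have "a \<in> ?Q" using c(1) by (simp add: ac_simps)
      ultimately show False using aP by blast
    qed
  qed
  then show ?thesis using that h by blast
qed

section \<open>Associated primes of unmixed ideals\<close>

lemma assoc_primesI: "is_prime {g. g * h \<in> I} \<Longrightarrow> {g. g * h \<in> I} \<in> assoc_primes I"
  by (auto simp: assoc_primes_def primeideal_iff)

text \<open>Unmixedness compares associated primes with one another.
  \<open>colon_prime_exists\<close> supplies one that keeps a largest independent set of
  \<open>I\<close> and so has the dimension of \<open>I\<close>; equal heights transfer this to all
  others.\<close>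

lemma unmixed_assoc_pdim:
  fixes I :: "('n, 'k::field) mpoly set"
  assumes un: "unmixed I" and P: "P \<in> assoc_primes I"
  shows "pdim P = pdim I"
proof -
  have I: "is_ideal I" "I \<noteq> UNIV" using un by (auto simp: unmixed_def ideal_iff)
  obtain A where A: "indep_vars I A" "card A = pdim I" using pdim_attained[OF I] .
  then have "indep_vars {g. g * 1 \<in> I} A" by simp
  then obtain h where h: "is_prime {g. g * (h * 1) \<in> I}" "indep_vars {g. g * (h * 1) \<in> I} A"
    using colon_prime_exists[OF I(1)] by blast
  define Q where "Q = {g. g * (h * 1) \<in> I}"
  have Q: "Q \<in> assoc_primes I" "is_prime Q" "indep_vars Q A"
    using assoc_primesI h unfolding Q_def by blast+
  have PI: "is_prime P" "is_ideal P" "P \<noteq> UNIV" using P by (auto simp: assoc_primes_def primeideal_iff is_prime_def)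
  have QI: "is_ideal Q" "Q \<noteq> UNIV" using Q(2) by (auto simp: is_prime_def)
  have "I \<subseteq> Q"
  proof
    fix f assume "f \<in> I"
    then show "f \<in> Q" unfolding Q_def mem_Collect_eq by (rule is_idealD(4)[OF I(1)])
  qed
  then have "pdim Q \<le> pdim I" by (rule pdim_antimono[OF I(1) QI(1) _ QI(2)])
  moreover have "card A \<le> pdim Q" by (rule card_le_pdim[OF QI(1) Q(3)])
  ultimately have "pdim Q = pdim I" using A(2) by linarith
  moreover have "height poly_ring P = height poly_ring Q" using un P Q(1) unfolding unmixed_def by blast
  then have "card (UNIV :: 'n set) - pdim P = card (UNIV :: 'n set) - pdim Q"
    unfolding height_eq[OF PI(1)] height_eq[OF Q(2)] by (simp only: enat.inject)
  \<comment> \<open>Subtraction on naturals cancels here because both dimensions are at most the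
    number of variables.\<close>
  then have "pdim P = pdim Q" using pdim_le_card[OF PI(2,3)] pdim_le_card[OF QI] by simp
  ultimately show ?thesis by simp
qed

text \<open>Independence of the empty set of variables means properness, so
  \<open>colon_prime_exists\<close> applies with \<open>A\<close> empty.\<close>

lemma colon_assoc_prime:
  fixes I :: "('n, 'k::field) mpoly set"
  assumes I: "is_ideal I" and f: "f \<notin> I"
  obtains h where "{g. g * (h * f) \<in> I} \<in> assoc_primes I" "is_prime {g. g * (h * f) \<in> I}"
proof -
  have "indep_vars {g. g * f \<in> I} {}"
    unfolding indep_vars_def
  proof (rule ballI, rule ccontr)
    fix g assume g: "g \<in> {g. g * f \<in> I} \<inter> poly_in {}" "g \<noteq> 0"
    have k: "keys g \<subseteq> {0}" using g(1) by (auto simp: poly_in_def)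
    have geq: "g = scale_poly (lookup g 0) 1"
      by (rule poly_mapping_eqI) (use k in \<open>auto simp: lookup_one when_def in_keys_iff\<close>)
    have gc: "g * f = scale_poly (lookup g 0) f"
      using arg_cong[OF geq, of "\<lambda>x. x * f"] by (simp only: scale_poly_mult_left[symmetric] mult_1)
    have "lookup g 0 \<noteq> 0"
    proof
      assume "lookup g 0 = 0"
      then have "g = 0" using geq by (simp only: pvs.scale_zero_left)
      then show False using g(2) by blast
    qed
    then have "scale_poly (inverse (lookup g 0)) (g * f) = f" unfolding gc by simp
    then have "f \<in> I" using is_ideal_scale[OF I, of "g * f" "inverse (lookup g 0)"] g(1) by simp
    then show False using f by simp
  qed
  then show ?thesis using colon_prime_exists[OF I] assoc_primesI that by metis
qed

text \<open>An \<open>f\<close> in \<open>I : J\<close> outside \<open>I\<close> is killed by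
  \<open>J\<close> modulo \<open>I\<close>, and so is its multiple \<open>h * f\<close>, whose
  annihilator \<open>P\<close> is an associated prime. Thus
  \<open>I \<subseteq> J \<subseteq> P\<close>, where both ends have the same dimension.\<close>

lemma unmixed_colon_pdim:
  fixes I J :: "('n, 'k::field) mpoly set"
  assumes un: "unmixed I" and J: "is_ideal J" "I \<subseteq> J" "colon I J \<noteq> I"
  shows "J \<noteq> UNIV" and "pdim J = pdim I"
proof -
  have I: "is_ideal I" "I \<noteq> UNIV" using un by (auto simp: unmixed_def ideal_iff)
  have "I \<subseteq> colon I J" using is_idealD(4)[OF I(1)] by (auto simp: colon_def)
  then obtain f where f: "f \<in> colon I J" "f \<notin> I" using J(3) by blast
  obtain h where h: "{g. g * (h * f) \<in> I} \<in> assoc_primes I" "is_prime {g. g * (h * f) \<in> I}"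
    using colon_assoc_prime[OF I(1) f(2)] .
  define P where "P = {g. g * (h * f) \<in> I}"
  have P: "is_ideal P" "P \<noteq> UNIV" "pdim P = pdim I"
    using h(2) unmixed_assoc_pdim[OF un h(1)] by (auto simp: P_def is_prime_def)
  have JP: "J \<subseteq> P"
  proof
    fix g assume "g \<in> J"
    then have "h * (f * g) \<in> I" using f(1) is_idealD(3)[OF I(1)] by (auto simp: colon_def)
    then show "g \<in> P" by (simp add: P_def ac_simps)
  qed
  then show "J \<noteq> UNIV" using P(2) by blast
  then show "pdim J = pdim I"
    using pdim_antimono[OF I(1) J(1,2)] pdim_antimono[OF J(1) P(1) JP P(2)] P(3) by simp
qed

lemma pmult_mono:
  fixes I J :: "('n, 'k::field) mpoly set"
  assumes "is_ideal I" "I \<noteq> UNIV" "is_ideal J" "J \<noteq> UNIV" "pdim I = pdim J" "\<And>n. hf J n \<le> hf I n"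
  shows "pmult J \<le> pmult I"
proof -
  have "real (pmult J) / fact (pdim J) \<le> real (pmult I) / fact (pdim J)"
  proof (rule LIMSEQ_le)
    show "(\<lambda>n. real (hf J n) / real n ^ pdim J) \<longlonglongrightarrow> real (pmult J) / fact (pdim J)"
      by (rule hf_limit[OF assms(3,4)])
    show "(\<lambda>n. real (hf I n) / real n ^ pdim J) \<longlonglongrightarrow> real (pmult I) / fact (pdim J)"
      using hf_limit[OF assms(1,2)] assms(5) by simp
    show "\<exists>N. \<forall>n\<ge>N. real (hf J n) / real n ^ pdim J \<le> real (hf I n) / real n ^ pdim J"
      using assms(6) by (intro exI allI impI divide_right_mono) auto
  qed
  then show ?thesis by (simp add: divide_le_cancel)
qed

text \<open>Unmixedness enters here: a nonzero submodule \<open>J/I\<close> contains a copy of \<open>S/P\<close> with \<open>P\<close>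
  associated, hence has full dimension and contributes to the degree.\<close>

lemma unmixed_pmult_strict:
  fixes I J :: "('n, 'k::field) mpoly set"
  assumes un: "unmixed I" and J: "is_ideal J" "J \<noteq> UNIV" "I \<subset> J" and dim: "pdim J = pdim I"
  shows "pmult J < pmult I"
proof -
  have I: "is_ideal I" "I \<noteq> UNIV" using un by (auto simp: unmixed_def ideal_iff)
  obtain f where f: "f \<in> J" "f \<notin> I" using J(3) by blast
  obtain h where h: "{g. g * (h * f) \<in> I} \<in> assoc_primes I" "is_prime {g. g * (h * f) \<in> I}"
    using colon_assoc_prime[OF I(1) f(2)] .
  define P where "P = {g. g * (h * f) \<in> I}"
  have P: "is_ideal P" "P \<noteq> UNIV" "pdim P = pdim I"
    using h(2) unmixed_assoc_pdim[OF un h(1)] by (auto simp: P_def is_prime_def)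
  have hf: "h * f \<in> J" using is_idealD(3)[OF J(1) f(1)] .
  obtain e where e: "keys (h * f) \<subseteq> {m. mon_deg m \<le> e}" using poly_deg_bound by blast
  have le: "hf P n + hf J (n + e) \<le> hf I (n + e)" for n
    using hf_colon[OF I(1) J(1) _ hf e, of n] J(3) by (auto simp: P_def)
  \<comment> \<open>All three dimensions agree, so leading coefficients add up;
    \<open>pmult P \<ge> 1\<close> then makes the inequality strict.\<close>
  have "real (pmult P) / fact (pdim I) + real (pmult J) / fact (pdim I) \<le> real (pmult I) / fact (pdim I)"
  proof (rule LIMSEQ_le)
    show "(\<lambda>n. real (hf P (n - e)) / real n ^ pdim I + real (hf J n) / real n ^ pdim I)
        \<longlonglongrightarrow> real (pmult P) / fact (pdim I) + real (pmult J) / fact (pdim I)"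
      using hf_limit[OF P(1,2)] hf_limit[OF J(1,2)] P(3) dim
      by (intro tendsto_add tendsto_shift_power) simp_all
    show "(\<lambda>n. real (hf I n) / real n ^ pdim I) \<longlonglongrightarrow> real (pmult I) / fact (pdim I)"
      by (rule hf_limit[OF I])
    show "\<exists>N. \<forall>n\<ge>N. real (hf P (n - e)) / real n ^ pdim I + real (hf J n) / real n ^ pdim I
        \<le> real (hf I n) / real n ^ pdim I"
    proof (intro exI allI impI)
      fix n assume "n \<ge> e"
      then have "real (hf P (n - e)) + real (hf J n) \<le> real (hf I n)" using le[of "n - e"] by simp
      then show "real (hf P (n - e)) / real n ^ pdim I + real (hf J n) / real n ^ pdim I
          \<le> real (hf I n) / real n ^ pdim I"
        unfolding add_divide_distrib[symmetric] by (rule divide_right_mono) simp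
    qed
  qed
  then have "(real (pmult P) + real (pmult J)) / fact (pdim I) \<le> real (pmult I) / fact (pdim I)"
    by (simp add: add_divide_distrib)
  then have "pmult P + pmult J \<le> pmult I" by (simp add: divide_le_cancel flip: of_nat_add)
  then show ?thesis using pmult_ge[OF P(1,2)] by simp
qed

end

subsection \<open>The minimum distance and footprint functions\<close>

definition deg_refine :: "('n::finite mon \<Rightarrow> 'n mon \<Rightarrow> bool) \<Rightarrow> 'n mon \<Rightarrow> 'n mon \<Rightarrow> bool"
  where "deg_refine lt u v \<longleftrightarrow> mon_deg u < mon_deg v \<or> mon_deg u = mon_deg v \<and> lt u v"

lemma deg_order_deg_refine:
  assumes "monomial_order lt"
  shows "deg_order (deg_refine lt)"
proof -
  interpret mon_order lt by standard (rule assms)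
  show ?thesis
  proof
    show "monomial_order (deg_refine lt)"
      unfolding monomial_order_def
    proof (intro conjI allI impI)
      show "irreflp (deg_refine lt)" by (auto simp: irreflp_def deg_refine_def)
      show "transp (deg_refine lt)" by (rule transpI) (auto simp: deg_refine_def intro: lt_trans)
      show "totalp (deg_refine lt)"
        by (rule totalpI) (use lt_total in \<open>auto simp: deg_refine_def\<close>)
      show "deg_refine lt 0 u" if "u \<noteq> 0" for u
      proof -
        have "mon_deg u \<noteq> 0" using that by simp
        then have "0 < mon_deg u" by (rule neq0_conv[THEN iffD1])
        then show ?thesis unfolding deg_refine_def mon_deg_zero by blast
      qed
      show "deg_refine lt (u + w) (v + w)" if "deg_refine lt u v" for u v w
        using that lt_add by (auto simp: deg_refine_def)
    qed
    show "mon_deg u \<le> mon_deg v" if "deg_refine lt u v" for u v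
      using that by (auto simp: deg_refine_def)
  qed
qed

text \<open>The initial monomial of \<open>f\<close> is also that of a homogeneous component of \<open>f\<close>.\<close>

lemma init_mons_subset_of_deg_agree:
  fixes I :: "('n::finite, 'k::field) mpoly set"
  assumes "mon_order lt" "mon_order lt'" and I: "graded_ideal I"
    and agree: "\<And>u v. mon_deg u = mon_deg v \<Longrightarrow> lt u v \<Longrightarrow> lt' u v"
  shows "init_mons lt I \<subseteq> init_mons lt' I"
proof -
  interpret a: mon_order lt by (rule assms)
  interpret b: mon_order lt' by (rule assms)
  have "init_mon lt f \<in> init_mons lt' I" if f: "f \<in> I" "f \<noteq> 0" for f
  proof -
    let ?m = "init_mon lt f"
    let ?g = "part {m. mon_deg m = mon_deg ?m} f"
    have m: "?m \<in> keys ?g" using a.init_mon_in_keys[OF f(2)] by (simp add: keys_part)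
    have "init_mon lt' ?g = ?m"
    proof (rule b.init_mon_eqI[OF m])
      fix x assume "x \<in> keys ?g" "x \<noteq> ?m"
      then show "lt' x ?m" using a.init_mon_max[OF f(2), of x] agree by (simp add: keys_part)
    qed
    moreover have "?g \<in> I" by (rule graded_idealD(2)[OF I f(1)])
    moreover have "?g \<noteq> 0" using m by auto
    ultimately show ?thesis using b.init_monsI by metis
  qed
  then show ?thesis unfolding init_mons_def[of lt] by blast
qed

lemma init_mons_deg_refine:
  fixes I :: "('n::finite, 'k::field) mpoly set"
  assumes lt: "monomial_order lt" and I: "graded_ideal I"
  shows "init_mons (deg_refine lt) I = init_mons lt I"
proof -
  have "mon_order lt" by standard (rule lt)
  moreover have "mon_order (deg_refine lt)" using deg_order_deg_refine[OF lt] by (rule deg_order.axioms)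
  ultimately show ?thesis
    using I by (intro equalityI init_mons_subset_of_deg_agree) (auto simp: deg_refine_def)
qed

text \<open>The order enters \<open>footprint\<close> only through the initial ideal, which permits
  the passage to the refined order.\<close>

lemma footprint_cong: "init_ideal lt I = init_ideal lt' I \<Longrightarrow> footprint lt I d r = footprint lt' I d r"
  unfolding footprint_def fp_sets_def std_monoms_def by (simp only:)

lemma graded_ideal_gen_homog:
  assumes I: "graded_ideal I" and F: "\<And>f. f \<in> F \<Longrightarrow> \<exists>d. f \<in> homog d"
  shows "graded_ideal (ideal_gen (I \<union> F))"
proof (rule graded_idealI[OF is_ideal_ideal_gen])
  have iI: "is_ideal (ideal_gen (I \<union> F))" by (rule is_ideal_ideal_gen)
  have sub: "I \<union> F \<subseteq> ideal_gen (I \<union> F)" by (rule ideal_gen_superset)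
  \<comment> \<open>Passing to \<open>ideal_span\<close> allows induction over the products that
    make up an element.\<close>
  have "ideal_gen (I \<union> F) = ideal_span (I \<union> F)"
    using ideal_gen_least[OF is_ideal_ideal_span ideal_span_superset] ideal_span_least[OF iI sub] by blast
  moreover have "part {m. mon_deg m = e} f \<in> ideal_gen (I \<union> F)" if "f \<in> ideal_span (I \<union> F)" for f e
    using that
  proof (induction arbitrary: e)
    case zero
    then show ?case using is_idealD(1)[OF iI] by (simp add: part_0)
  next
    case (add f p g)
    have "part {m. mon_deg m = e} (g * p) \<in> ideal_gen (I \<union> F)"
    proof (cases "p \<in> I")
      case True
      then show ?thesis
        using graded_idealD(2)[OF I is_idealD(3)[OF graded_idealD(1)[OF I] True]] sub by blast
    next
      case False
      then obtain c where c: "p \<in> homog c" using F add.hyps by blast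
      have "part {m. mon_deg m = e} (g * p) = part {m. mon_deg m + c = e} g * p"
        by (rule part_mult_left) (use c in \<open>auto simp: homog_iff\<close>)
      then show ?thesis using is_idealD(3)[OF iI] sub False add.hyps by auto
    qed
    then show ?case using is_idealD(2)[OF iI add.IH] by simp
  qed
  ultimately show "part {m. mon_deg m = e} f \<in> ideal_gen (I \<union> F)" if "f \<in> ideal_gen (I \<union> F)" for f e
    using that by blast
qed

lemma colon_antimono: "A \<subseteq> B \<Longrightarrow> colon I B \<subseteq> colon I A"
  by (auto simp: colon_def)

lemma colon_superset: "is_ideal I \<Longrightarrow> I \<subseteq> colon I A"
  by (auto simp: colon_def is_idealD(4))

text \<open>Turns the condition on \<open>F\<close> in \<open>gmd_sets\<close> into one on the ideal
  \<open>(I, F)\<close> whose degree is taken.\<close>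

lemma colon_ideal_gen_Un:
  assumes "is_ideal I"
  shows "colon I (ideal_gen (I \<union> F)) = colon I (ideal_gen F)"
  unfolding colon_ideal_gen[OF assms] using is_idealD(3)[OF assms] by (auto simp: colon_def)

lemma gmd_setsD:
  assumes "is_ideal I" "F \<in> gmd_sets I d r"
  shows "F \<subseteq> homog d" "finite F" "card F = r" "indep_mod I F" "colon I (ideal_gen (I \<union> F)) \<noteq> I"
  using assms by (auto simp: gmd_sets_def colon_ideal_gen_Un)

lemma indep_mod_notin: "indep_mod I F \<Longrightarrow> f \<in> F \<Longrightarrow> f \<notin> I"
  unfolding indep_mod_def by (drule spec[of _ "{f}"], drule spec[of _ "\<lambda>_. 1"]) auto

lemma indep_mod_subset: "indep_mod I F \<Longrightarrow> G \<subseteq> F \<Longrightarrow> indep_mod I G"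
  unfolding indep_mod_def by blast

context deg_order
begin

lemma unmixed_extension:
  fixes I :: "('n, 'k::field) mpoly set"
  assumes I: "graded_ideal I" "unmixed I" and F: "F \<subseteq> homog d" "colon I (ideal_gen (I \<union> F)) \<noteq> I"
  shows "graded_ideal (ideal_gen (I \<union> F))" "ideal_gen (I \<union> F) \<noteq> UNIV" "pdim (ideal_gen (I \<union> F)) = pdim I"
    "quot_degree (ideal_gen (I \<union> F)) = real (pmult (ideal_gen (I \<union> F)))"
proof -
  show 1: "graded_ideal (ideal_gen (I \<union> F))" using F(1) by (intro graded_ideal_gen_homog I) blast
  have "I \<subseteq> ideal_gen (I \<union> F)" using ideal_gen_superset by blast
  then show 2: "ideal_gen (I \<union> F) \<noteq> UNIV" and "pdim (ideal_gen (I \<union> F)) = pdim I"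
    using unmixed_colon_pdim[OF I(2) is_ideal_ideal_gen _ F(2)] by blast+
  show "quot_degree (ideal_gen (I \<union> F)) = real (pmult (ideal_gen (I \<union> F)))"
    by (rule quot_degree_eq[OF 1 2])
qed

lemma pmult_extension_antimono:
  fixes I :: "('n, 'k::field) mpoly set"
  assumes I: "graded_ideal I" "unmixed I"
    and F: "F \<subseteq> homog d" "colon I (ideal_gen (I \<union> F)) \<noteq> I"
    and G: "G \<subseteq> homog e" "colon I (ideal_gen (I \<union> G)) \<noteq> I"
    and sub: "ideal_gen (I \<union> F) \<subseteq> ideal_gen (I \<union> G)"
  shows "pmult (ideal_gen (I \<union> G)) \<le> pmult (ideal_gen (I \<union> F))"
  using unmixed_extension(2,3)[OF I F] unmixed_extension(2,3)[OF I G]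
  by (intro pmult_mono is_ideal_ideal_gen hf_antimono sub) auto

abbreviation gmd_mults :: "('n, 'k::field) mpoly set \<Rightarrow> nat \<Rightarrow> nat \<Rightarrow> nat set"
  where "gmd_mults I d r \<equiv> (\<lambda>F. pmult (ideal_gen (I \<union> F))) ` gmd_sets I d r"

text \<open>Over an infinite field \<open>gmd_sets\<close> may be infinite, where \<open>Max\<close>
  has no meaning in general. The degrees are natural numbers bounded by \<open>pmult I\<close>, so
  only finitely many values occur.\<close>

lemma gmd_eq:
  fixes I :: "('n, 'k::field) mpoly set"
  assumes I: "graded_ideal I" "unmixed I"
  shows "gmd I d r = real (pmult I) -
    (if gmd_sets I d r = {} then 0 else real (Max (gmd_mults I d r)))"
    and "finite (gmd_mults I d r)"
proof -
  have iI: "is_ideal I" "I \<noteq> UNIV" using I(2) by (auto simp: unmixed_def ideal_iff)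
  have deg: "quot_degree (ideal_gen (I \<union> F)) = real (pmult (ideal_gen (I \<union> F)))"
    if "F \<in> gmd_sets I d r" for F
    using unmixed_extension(4)[OF I gmd_setsD(1)[OF iI(1) that] gmd_setsD(5)[OF iI(1) that]] .
  have "pmult (ideal_gen (I \<union> F)) \<le> pmult I" if "F \<in> gmd_sets I d r" for F
    using unmixed_extension(2,3)[OF I gmd_setsD(1)[OF iI(1) that] gmd_setsD(5)[OF iI(1) that]]
      ideal_gen_superset[of "I \<union> F"]
    by (intro pmult_mono iI is_ideal_ideal_gen hf_antimono) auto
  then show fin: "finite (gmd_mults I d r)"
    by (intro finite_subset[OF _ finite_atMost[of "pmult I"]]) auto
  have "Max ((\<lambda>F. quot_degree (ideal_gen (I \<union> F))) ` gmd_sets I d r)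
      = real (Max (gmd_mults I d r))" if "gmd_sets I d r \<noteq> {}"
  proof -
    have "(\<lambda>F. quot_degree (ideal_gen (I \<union> F))) ` gmd_sets I d r
        = real ` gmd_mults I d r"
      unfolding image_image using deg by (rule image_cong[OF refl])
    then show ?thesis using mono_Max_commute[of real, OF _ fin] that by (simp add: mono_def)
  qed
  then show "gmd I d r = real (pmult I) -
    (if gmd_sets I d r = {} then 0 else real (Max (gmd_mults I d r)))"
    using quot_degree_eq[OF I(1) iI(2)] by (simp add: gmd_def)
qed

lemma gmd_ge_one:
  fixes I :: "('n, 'k::field) mpoly set"
  assumes I: "graded_ideal I" "unmixed I" and r: "r \<ge> 1"
  shows "gmd I d r \<ge> 1"
proof -
  have iI: "is_ideal I" "I \<noteq> UNIV" using I(2) by (auto simp: unmixed_def ideal_iff)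
  show ?thesis
  proof (cases "gmd_sets I d r = {}")
    case True
    then show ?thesis using gmd_eq(1)[OF I] pmult_ge[OF iI] by simp
  next
    case False
    have "pmult (ideal_gen (I \<union> F)) < pmult I" if F: "F \<in> gmd_sets I d r" for F
    proof -
      note D = gmd_setsD[OF iI(1) F]
      have "F \<noteq> {}" using D(3) r by auto
      then obtain f where "f \<in> F" "f \<notin> I" using indep_mod_notin[OF D(4)] by blast
      then have "I \<subset> ideal_gen (I \<union> F)" using ideal_gen_superset[of "I \<union> F"] by blast
      then show ?thesis
        using unmixed_extension(2,3)[OF I D(1,5)] by (intro unmixed_pmult_strict I is_ideal_ideal_gen)
    qed
    then have "Max (gmd_mults I d r) < pmult I"
      using False gmd_eq(2)[OF I] by (subst Max_less_iff) auto
    then show ?thesis using gmd_eq(1)[OF I, of d r] False by simp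
  qed
qed

text \<open>A smaller ideal of the same dimension has at least the same degree, so each candidate
  for the maximum at \<open>(d, r)\<close> is dominated by one at \<open>(e, s)\<close>.\<close>

lemma gmd_le_gmdI:
  fixes I :: "('n, 'k::field) mpoly set"
  assumes I: "graded_ideal I" "unmixed I"
    and step: "\<And>F. F \<in> gmd_sets I d r \<Longrightarrow> \<exists>G\<in>gmd_sets I e s. ideal_gen (I \<union> G) \<subseteq> ideal_gen (I \<union> F)"
  shows "gmd I e s \<le> gmd I d r"
proof (cases "gmd_sets I d r = {}")
  case True
  then show ?thesis using gmd_eq(1)[OF I] by simp
next
  case False
  have iI: "is_ideal I" using I(1) by (rule graded_idealD)
  have ne: "gmd_sets I e s \<noteq> {}" using step False by blast
  have "Max (gmd_mults I d r)
      \<le> Max (gmd_mults I e s)"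
  proof (subst Max_le_iff)
    show "\<forall>x\<in>gmd_mults I d r.
        x \<le> Max (gmd_mults I e s)"
    proof clarify
      fix F assume F: "F \<in> gmd_sets I d r"
      obtain G where G: "G \<in> gmd_sets I e s" "ideal_gen (I \<union> G) \<subseteq> ideal_gen (I \<union> F)" using step[OF F] by blast
      have "pmult (ideal_gen (I \<union> F)) \<le> pmult (ideal_gen (I \<union> G))"
        by (rule pmult_extension_antimono[OF I gmd_setsD(1,5)[OF iI G(1)] gmd_setsD(1,5)[OF iI F] G(2)])
      also have "\<dots> \<le> Max (gmd_mults I e s)"
        by (rule Max_ge[OF gmd_eq(2)[OF I]]) (use G(1) in blast)
      finally show "pmult (ideal_gen (I \<union> F)) \<le> Max (gmd_mults I e s)" .
    qed
  qed (use False gmd_eq(2)[OF I] in auto)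
  then show ?thesis using gmd_eq(1)[OF I] False ne by simp
qed

text \<open>Dropping an element of \<open>F\<close> can only enlarge the colon ideal and shrink
  \<open>(I, F)\<close>.\<close>

lemma gmd_le_Suc:
  fixes I :: "('n, 'k::field) mpoly set"
  assumes I: "graded_ideal I" "unmixed I"
  shows "gmd I d r \<le> gmd I d (r + 1)"
proof (rule gmd_le_gmdI[OF I])
  fix F assume F: "F \<in> gmd_sets I d (r + 1)"
  have iI: "is_ideal I" using I(1) by (rule graded_idealD)
  note D = gmd_setsD[OF iI F]
  have "F \<noteq> {}" using D(3) by auto
  then obtain f where f: "f \<in> F" by blast
  let ?G = "F - {f}"
  have "colon I (ideal_gen F) \<subseteq> colon I (ideal_gen ?G)"
    unfolding colon_ideal_gen[OF iI] by (rule colon_antimono) blast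
  moreover have "I \<subseteq> colon I (ideal_gen F)" by (rule colon_superset[OF iI])
  moreover have "colon I (ideal_gen F) \<noteq> I" using F by (simp add: gmd_sets_def)
  ultimately have "?G \<in> gmd_sets I d r"
    using D f indep_mod_subset[OF D(4), of ?G] by (auto simp: gmd_sets_def)
  moreover have "ideal_gen (I \<union> ?G) \<subseteq> ideal_gen (I \<union> F)"
    using ideal_gen_superset[of "I \<union> F"] by (intro ideal_gen_least is_ideal_ideal_gen) blast
  ultimately show "\<exists>G\<in>gmd_sets I d r. ideal_gen (I \<union> G) \<subseteq> ideal_gen (I \<union> F)" by blast
qed

text \<open>Replace \<open>F\<close> by \<open>h F\<close>: regularity preserves linear independence
  modulo \<open>I\<close>, the colon ideal can only grow, and \<open>(I, h F)\<close> lies in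
  \<open>(I, F)\<close>.\<close>

lemma gmd_le_of_regular:
  fixes I :: "('n, 'k::field) mpoly set"
  assumes I: "graded_ideal I" "unmixed I" and h: "h \<in> homog 1" "colon I {h} = I"
  shows "gmd I (d + 1) r \<le> gmd I d r"
proof (rule gmd_le_gmdI[OF I])
  fix F assume F: "F \<in> gmd_sets I d r"
  have iI: "is_ideal I" using I(1) by (rule graded_idealD)
  have "I \<noteq> UNIV" using I(2) by (simp add: unmixed_def)
  note D = gmd_setsD[OF iI F]
  have reg: "f \<in> I" if "h * f \<in> I" for f
  proof -
    have "f \<in> colon I {h}" using that by (simp add: colon_def mult.commute)
    then show ?thesis using h(2) by blast
  qed
  have h0: "h \<noteq> 0" using reg is_idealD(1)[OF iI] \<open>I \<noteq> UNIV\<close> by auto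
  have inj: "inj_on ((*) h) F"
  proof (rule inj_onI)
    fix x y assume "h * x = h * y"
    then have "h * (x - y) = 0" by (simp add: right_diff_distrib)
    then show "x = y" using poly_no_zero_divisors[OF h0, of "x - y"] by auto
  qed
  let ?G = "(*) h ` F"
  have 1: "?G \<subseteq> homog (d + 1)"
  proof clarify
    fix f assume "f \<in> F"
    then have "f \<in> homog d" using D(1) by blast
    then have "keys (h * f) \<subseteq> {m. mon_deg m = d + 1}"
      using h(1) keys_mult[of h f] by (fastforce simp: homog_iff)
    then show "h * f \<in> homog (d + 1)" by (simp add: homog_iff)
  qed
  have 2: "indep_mod I ?G"
    unfolding indep_mod_def
  proof (intro allI impI)
    fix T and c :: "_ \<Rightarrow> 'k" assume T: "finite T \<and> T \<subseteq> ?G \<and> (\<Sum>b\<in>T. scale_poly (c b) b) \<in> I"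
    then obtain S where S: "S \<subseteq> F" "T = (*) h ` S" by (meson subset_imageE)
    have "(\<Sum>b\<in>T. scale_poly (c b) b) = (\<Sum>f\<in>S. scale_poly (c (h * f)) (h * f))"
      unfolding S(2) by (subst sum.reindex[OF inj_on_subset[OF inj S(1)]]) simp
    also have "\<dots> = h * (\<Sum>f\<in>S. scale_poly (c (h * f)) f)"
      by (simp add: sum_distrib_left scale_poly_mult_right)
    finally have "(\<Sum>f\<in>S. scale_poly (c (h * f)) f) \<in> I" using T reg by simp
    moreover have "finite S" using S(1) D(2) finite_subset by blast
    ultimately have "\<forall>f\<in>S. c (h * f) = 0"
      using D(4)[unfolded indep_mod_def, THEN spec, THEN spec, of S "\<lambda>f. c (h * f)"] S(1) by simp
    then show "\<forall>b\<in>T. c b = 0" using S(2) by blast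
  qed
  have "colon I F \<noteq> I" using F by (simp add: gmd_sets_def colon_ideal_gen[OF iI])
  moreover have "colon I F \<subseteq> colon I ?G"
  proof
    fix g assume g: "g \<in> colon I F"
    have "g * (h * f) \<in> I" if "f \<in> F" for f
    proof -
      have "h * (g * f) \<in> I" using g that is_idealD(3)[OF iI] by (simp add: colon_def)
      then show ?thesis by (simp add: ac_simps)
    qed
    then show "g \<in> colon I ?G" by (auto simp: colon_def)
  qed
  ultimately have 3: "colon I (ideal_gen ?G) \<noteq> I"
    using colon_superset[OF iI, of F] unfolding colon_ideal_gen[OF iI] by blast
  have "card ?G = r" using card_image[OF inj] D(3) by simp
  then have "?G \<in> gmd_sets I (d + 1) r" using 1 2 3 D(2) by (simp add: gmd_sets_def)
  moreover have "ideal_gen (I \<union> ?G) \<subseteq> ideal_gen (I \<union> F)"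
    using ideal_gen_superset[of "I \<union> F"] is_idealD(3)[OF is_ideal_ideal_gen[of "I \<union> F"]]
    by (intro ideal_gen_least is_ideal_ideal_gen) blast
  ultimately show "\<exists>G\<in>gmd_sets I (d + 1) r. ideal_gen (I \<union> G) \<subseteq> ideal_gen (I \<union> F)" by blast
qed

lemma init_ideal_facts:
  fixes I :: "('n, 'k::field) mpoly set"
  assumes "is_ideal I"
  shows "graded_ideal (init_ideal lt I)" "init_mons lt (init_ideal lt I) = init_mons lt I"
    "pdim (init_ideal lt I) = pdim I" "pmult (init_ideal lt I) = pmult I"
  using graded_mon_ideal[OF up_closed_init_mons[OF assms]]
  by (simp_all add: init_ideal_eq[OF assms] pdim_def pmult_def)

lemma finite_fp_sets: "finite (fp_sets lt I d r)"
proof (rule finite_subset)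
  show "fp_sets lt I d r \<subseteq> Pow (monom_poly ` {m. mon_deg m = d})"
    by (auto simp: fp_sets_def std_monoms_def)
qed simp

lemma fp_setsD:
  fixes I :: "('n, 'k::field) mpoly set"
  assumes "is_ideal I" "M \<in> fp_sets lt I d r"
  shows "M \<subseteq> homog d" "card M = r" "M \<inter> init_ideal lt I = {}"
    "colon (init_ideal lt I) (ideal_gen (init_ideal lt I \<union> M)) \<noteq> init_ideal lt I"
  using assms(2) colon_ideal_gen_Un[OF graded_idealD(1)[OF init_ideal_facts(1)[OF assms(1)]], of M]
  by (auto simp: fp_sets_def std_monoms_def homog_iff)

text \<open>The monomials of \<open>M\<close> are standard, so adjoining them enlarges the initial
  ideal properly and its multiplicity, which is that of \<open>I\<close>, drops.\<close>

lemma footprint_ge_one: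
  fixes I :: "('n, 'k::field) mpoly set"
  assumes I: "graded_ideal I" "I \<noteq> UNIV" and un: "unmixed (init_ideal lt I)" and r: "r \<ge> 1"
  shows "footprint lt I d r \<ge> 1"
proof -
  note iI = graded_idealD(1)[OF I(1)]
  note J = init_ideal_facts[OF iI]
  have "quot_degree (ideal_gen (init_ideal lt I \<union> M)) \<le> real (pmult I) - 1" if M: "M \<in> fp_sets lt I d r" for M
  proof -
    note D = fp_setsD[OF iI M]
    note E = unmixed_extension[OF J(1) un D(1,4)]
    have "M \<noteq> {}" using D(2) r by auto
    then have "init_ideal lt I \<subset> ideal_gen (init_ideal lt I \<union> M)"
      using D(3) ideal_gen_superset[of "init_ideal lt I \<union> M"] by blast
    then have "pmult (ideal_gen (init_ideal lt I \<union> M)) < pmult (init_ideal lt I)"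
      using E(2,3) by (intro unmixed_pmult_strict un is_ideal_ideal_gen)
    then show ?thesis using E(4) J(4) by simp
  qed
  then have le: "Max ((\<lambda>M. quot_degree (ideal_gen (init_ideal lt I \<union> M))) ` fp_sets lt I d r) \<le> real (pmult I) - 1"
    if "fp_sets lt I d r \<noteq> {}"
    using that by (subst Max_le_iff) (auto simp: finite_fp_sets)
  show ?thesis
  proof (cases "fp_sets lt I d r = {}")
    case True
    then show ?thesis using quot_degree_eq[OF I] pmult_ge[OF iI I(2)] by (simp add: footprint_def)
  next
    case False
    from le[OF False] show ?thesis using quot_degree_eq[OF I] False by (simp add: footprint_def)
  qed
qed

text \<open>Reducing \<open>F\<close> modulo \<open>I\<close> gives an \<open>r\<close>-dimensional space of polynomials supported on standard
  monomials; \<open>M\<close> consists of \<open>r\<close> of its initial monomials.\<close>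

lemma fp_set_of_gmd_set:
  fixes I :: "('n, 'k::field) mpoly set"
  assumes I: "graded_ideal I" and F: "F \<in> gmd_sets I d r"
  obtains M where "M \<in> fp_sets lt I d r"
    "init_mons lt (ideal_gen (init_ideal lt I \<union> M)) \<subseteq> init_mons lt (ideal_gen (I \<union> F))"
proof -
  note iI = graded_idealD[OF I]
  note D = gmd_setsD[OF iI(1) F]
  \<comment> \<open>The component of degree \<open>d\<close> keeps the representatives homogeneous,
    as \<open>M\<close> has to consist of monomials of degree \<open>d\<close>.\<close>
  define rd where "rd f = part {m. mon_deg m = d} (nf I f)" for f :: "('n, 'k) mpoly"
  have rd_cong: "f - rd f \<in> I" if "f \<in> F" for f
  proof -
    have "f - rd f = part {m. mon_deg m = d} (f - nf I f)"
      using D(1) that by (auto simp: rd_def part_minus part_id homog_iff subset_iff)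
    then show ?thesis using iI(2)[OF nf_cong[OF iI(1)]] by metis
  qed
  have keys_rd: "keys (rd f) \<subseteq> {m. mon_deg m = d \<and> m \<notin> init_mons lt I}" for f
    using keys_nf[OF iI(1), of f] by (auto simp: rd_def keys_part)
  define V where "V = range (\<lambda>c. \<Sum>f\<in>F. scale_poly (c f) (rd f))"
  define Y where "Y = init_mons lt V"
  have keysV: "keys v \<subseteq> {m. mon_deg m = d \<and> m \<notin> init_mons lt I}" if vV: "v \<in> V" for v
  proof -
    obtain c where v: "v = (\<Sum>f\<in>F. scale_poly (c f) (rd f))" using vV by (auto simp: V_def)
    show ?thesis unfolding v by (intro keys_linear_combination keys_rd)
  qed
  have Y: "Y \<subseteq> {m. mon_deg m = d \<and> m \<notin> init_mons lt I}"
  proof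
    fix m assume "m \<in> Y"
    then obtain v where "v \<in> V" "v \<noteq> 0" "m = init_mon lt v" by (auto simp: Y_def init_mons_def)
    then show "m \<in> {m. mon_deg m = d \<and> m \<notin> init_mons lt I}" using keysV init_mon_in_keys by blast
  qed
  have finY: "finite Y" by (rule finite_subset[OF Y]) (rule finite_subset[OF _ finite_mon_deg_eq[of d]], blast)
  \<comment> \<open>A nonzero element of \<open>V\<close> has its initial monomial in
    \<open>Y\<close>, so its coefficients at \<open>Y\<close> determine it; independence of
    \<open>F\<close> modulo \<open>I\<close> carries over to the family \<open>rd\<close>.\<close>
  have "card F \<le> card Y"
  proof (rule card_le_by_coeffs[where b=rd, OF D(2) finY])
    fix c assume z: "\<And>m. m \<in> Y \<Longrightarrow> lookup (\<Sum>f\<in>F. scale_poly (c f) (rd f)) m = 0"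
    let ?v = "\<Sum>f\<in>F. scale_poly (c f) (rd f)"
    have vV: "?v \<in> V" by (auto simp: V_def)
    have "?v = 0"
    proof (rule ccontr)
      assume ne: "?v \<noteq> 0"
      then have "init_mon lt ?v \<in> Y" using vV by (auto simp: Y_def intro: init_monsI)
      from z[OF this] show False using init_mon_in_keys[OF ne] unfolding in_keys_iff by blast
    qed
    moreover have "(\<Sum>f\<in>F. scale_poly (c f) f) - ?v = (\<Sum>f\<in>F. scale_poly (c f) (f - rd f))"
      by (simp add: pvs.scale_right_diff_distrib sum_subtractf)
    moreover have "(\<Sum>f\<in>F. scale_poly (c f) (f - rd f)) \<in> I"
      by (intro is_ideal_sum is_ideal_scale iI(1) rd_cong)
    ultimately have "(\<Sum>f\<in>F. scale_poly (c f) f) \<in> I" by (metis diff_zero)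
    then show "\<forall>f\<in>F. c f = 0" using D(2,4) by (auto simp: indep_mod_def)
  qed
  then obtain N where N: "N \<subseteq> Y" "card N = r" using D(3) by (metis obtain_subset_with_card_n)
  have finN: "finite N" using N(1) finY finite_subset by blast
  let ?M = "monom_poly ` N :: ('n, 'k) mpoly set"
  have IF: "I \<subseteq> ideal_gen (I \<union> F)" "F \<subseteq> ideal_gen (I \<union> F)" using ideal_gen_superset[of "I \<union> F"] by auto
  note iJ = is_ideal_ideal_gen[of "I \<union> F"]
  have rdJ: "rd f \<in> ideal_gen (I \<union> F)" if "f \<in> F" for f
  proof -
    have "f - (f - rd f) \<in> ideal_gen (I \<union> F)" using that rd_cong IF is_idealD(6)[OF iJ] by blast
    then show ?thesis by simp
  qed
  then have VJ: "V \<subseteq> ideal_gen (I \<union> F)"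
    by (auto simp: V_def intro!: is_ideal_sum is_ideal_scale iJ)
  have "colon I F \<noteq> I" using F by (simp add: gmd_sets_def colon_ideal_gen[OF iI(1)])
  then obtain g where g: "g \<in> colon I F" "g \<notin> I" using colon_superset[OF iI(1), of F] by blast
  \<comment> \<open>Passing to the normal form of a witness for the colon condition makes its
    initial monomial standard. Since \<open>g' * v\<close> lies in \<open>I\<close> for
    \<open>v\<close> in \<open>V\<close>, this monomial multiplies each initial monomial of
    \<open>V\<close> into the initial ideal.\<close>
  define g' where "g' = nf I g"
  have g'0: "g' \<noteq> 0" using g(2) nf_eq_0_iff[OF iI(1)] by (simp add: g'_def)
  have g'U: "init_mon lt g' \<notin> init_mons lt I"
    using keys_nf[OF iI(1), of g] init_mon_in_keys[OF g'0] by (auto simp: g'_def)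
  have g'V: "g' * v \<in> I" if vV: "v \<in> V" for v
  proof -
    have "g' * rd f \<in> I" if f: "f \<in> F" for f
    proof -
      have "g * f - (g - g') * f - g' * (f - rd f) \<in> I"
        using g(1) f nf_cong[OF iI(1), of g] rd_cong[OF f] is_idealD(3,4,6)[OF iI(1)]
        by (auto simp: colon_def g'_def)
      moreover have "g * f - (g - g') * f - g' * (f - rd f) = g' * rd f" by (simp add: algebra_simps)
      ultimately show ?thesis by metis
    qed
    moreover obtain c where "v = (\<Sum>f\<in>F. scale_poly (c f) (rd f))" using vV by (auto simp: V_def)
    then have "g' * v = (\<Sum>f\<in>F. scale_poly (c f) (g' * rd f))"
      by (simp add: sum_distrib_left scale_poly_mult_right)
    ultimately show ?thesis by (auto intro!: is_ideal_sum is_ideal_scale iI(1))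
  qed
  note inI = init_ideal_eq[OF iI(1)]
  have "monom_poly (init_mon lt g') \<in> colon (init_ideal lt I) ?M"
  proof -
    have "init_mon lt g' + m \<in> init_mons lt I" if mN: "m \<in> N" for m
    proof -
      obtain v where v: "v \<in> V" "v \<noteq> 0" "m = init_mon lt v" using mN N(1) by (auto simp: Y_def init_mons_def)
      then show ?thesis
        using init_monsI[OF g'V[OF v(1)] poly_no_zero_divisors[OF g'0 v(2)]] init_mon_mult[OF g'0 v(2)] by simp
    qed
    then have "keys (monom_poly (init_mon lt g') * monom_poly m :: ('n, 'k) mpoly) \<subseteq> init_mons lt I" if "m \<in> N" for m
      using that keys_mult[of "monom_poly (init_mon lt g') :: ('n, 'k) mpoly" "monom_poly m"] by auto
    then show ?thesis by (auto simp: colon_def inI mon_ideal_def)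
  qed
  moreover have "monom_poly (init_mon lt g') \<notin> init_ideal lt I" using g'U by (simp add: inI mon_ideal_def)
  ultimately have "colon (init_ideal lt I) ?M \<noteq> init_ideal lt I" by metis
  then have "colon (init_ideal lt I) (ideal_gen ?M) \<noteq> init_ideal lt I"
    by (simp add: colon_ideal_gen graded_idealD(1)[OF init_ideal_facts(1)[OF iI(1)]])
  moreover have "?M \<subseteq> std_monoms lt I d"
    using N(1) Y by (auto simp: std_monoms_def inI mon_ideal_def)
  moreover have "card ?M = r" using N(2) card_image[OF inj_on_subset[OF inj_monom_poly subset_UNIV]] by metis
  ultimately have MF: "?M \<in> fp_sets lt I d r" using finN by (simp add: fp_sets_def)
  let ?W = "init_mons lt (ideal_gen (I \<union> F))"
  \<comment> \<open>Both \<open>I\<close> and \<open>V\<close> lie in \<open>(I, F)\<close>, so all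
    generators on the left are initial monomials of \<open>(I, F)\<close> or combinations of
    such.\<close>
  have "ideal_gen (init_ideal lt I \<union> ?M) \<subseteq> mon_ideal ?W"
  proof (rule ideal_gen_least)
    show "is_ideal (mon_ideal ?W :: ('n, 'k) mpoly set)" by (intro is_ideal_mon_ideal up_closed_init_mons iJ)
    have "init_mons lt I \<subseteq> ?W" "Y \<subseteq> ?W" using IF(1) VJ by (auto simp: Y_def intro: init_mons_mono[THEN subsetD])
    then show "init_ideal lt I \<union> ?M \<subseteq> mon_ideal ?W" using N(1) by (auto simp: inI mon_ideal_def)
  qed
  then have "init_mons lt (ideal_gen (init_ideal lt I \<union> ?M)) \<subseteq> ?W"
    using init_mons_mono init_mons_mon_ideal by metis
  then show ?thesis using that MF by blast
qed

lemma footprint_le_gmd: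
  fixes I :: "('n, 'k::field) mpoly set"
  assumes I: "graded_ideal I" "unmixed I"
  shows "footprint lt I d r \<le> gmd I d r"
proof -
  note iI = graded_idealD(1)[OF I(1)]
  have pI: "I \<noteq> UNIV" using I(2) by (simp add: unmixed_def)
  note J = init_ideal_facts[OF iI]
  have q: "quot_degree I = real (pmult I)" by (rule quot_degree_eq[OF I(1) pI])
  \<comment> \<open>Needed when \<open>gmd_sets\<close> is empty and nothing is subtracted on the
    right. The colon condition excludes the unit ideal, so the degree is a multiplicity.\<close>
  have nonneg: "0 \<le> quot_degree (ideal_gen (init_ideal lt I \<union> M))"
    if M: "M \<in> fp_sets lt I d r" for M
  proof (cases "ideal_gen (init_ideal lt I \<union> M) = UNIV")
    case False
    have "graded_ideal (ideal_gen (init_ideal lt I \<union> M))"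
      using fp_setsD(1)[OF iI M] by (intro graded_ideal_gen_homog J(1)) blast
    from quot_degree_eq[OF this False] show ?thesis by simp
  next
    case True
    have "colon (init_ideal lt I) UNIV = init_ideal lt I"
      using colon_superset[OF graded_idealD(1)[OF J(1)], of UNIV]
      by (auto simp: colon_def) (metis UNIV_I mult.right_neutral)
    then show ?thesis using fp_setsD(4)[OF iI M] True by simp
  qed
  show ?thesis
  proof (cases "gmd_sets I d r = {}")
    case True
    have "0 \<le> Max ((\<lambda>M. quot_degree (ideal_gen (init_ideal lt I \<union> M))) ` fp_sets lt I d r)"
      if "fp_sets lt I d r \<noteq> {}"
      using that nonneg by (subst Max_ge_iff) (auto simp: finite_fp_sets)
    then show ?thesis using gmd_eq(1)[OF I, of d r] True q by (auto simp: footprint_def)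
  next
    case False
    have "Max (gmd_mults I d r) \<in> gmd_mults I d r"
      using False gmd_eq(2)[OF I] by (intro Max_in) auto
    then obtain F where F: "F \<in> gmd_sets I d r"
      "Max (gmd_mults I d r) = pmult (ideal_gen (I \<union> F))" by blast
    note D = gmd_setsD[OF iI F(1)]
    note E = unmixed_extension[OF I D(1,5)]
    obtain M where M: "M \<in> fp_sets lt I d r"
      "init_mons lt (ideal_gen (init_ideal lt I \<union> M)) \<subseteq> init_mons lt (ideal_gen (I \<union> F))"
      using fp_set_of_gmd_set[OF I(1) F(1)] .
    let ?N = "ideal_gen (init_ideal lt I \<union> M)"
    let ?G = "ideal_gen (I \<union> F)"
    have iN: "is_ideal ?N" and iG: "is_ideal ?G" by (rule is_ideal_ideal_gen)+
    have gN: "graded_ideal ?N" using fp_setsD(1)[OF iI M(1)] by (intro graded_ideal_gen_homog J(1)) blast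
    have pN: "?N \<noteq> UNIV"
      using M(2) zero_in_init_mons_iff[OF iN] zero_in_init_mons_iff[OF iG] E(2) by blast
    have le: "hf ?G n \<le> hf ?N n" for n by (rule aff_count_antimono[OF M(2)])
    \<comment> \<open>Fewer initial monomials leave more free sets; this is the lower half of the
      squeeze on the dimension of \<open>?N\<close>.\<close>
    have "pdim ?G \<le> pdim ?N"
    proof -
      obtain A where A: "free_set (init_mons lt ?G) A" "card A = pdim ?G"
        using free_dim_attained zero_in_init_mons_iff[OF iG] E(2) unfolding pdim_def by metis
      then have "free_set (init_mons lt ?N) A" using M(2) by (auto simp: free_set_def)
      then show ?thesis using free_dim_ge A(2) unfolding pdim_def by metis
    qed
    moreover have "pdim ?N \<le> pdim (init_ideal lt I)"
      using ideal_gen_superset[of "init_ideal lt I \<union> M"] graded_idealD(1)[OF J(1)] pN iN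
      by (intro pdim_antimono) auto
    ultimately have "pdim ?N = pdim ?G" using E(3) J(3) by simp
    then have "pmult ?G \<le> pmult ?N" using E(2) pN iN iG le by (intro pmult_mono) auto
    then have "real (pmult ?G) \<le> quot_degree ?N" using quot_degree_eq[OF gN pN] by simp
    also have "\<dots> \<le> Max ((\<lambda>M. quot_degree (ideal_gen (init_ideal lt I \<union> M))) ` fp_sets lt I d r)"
      using M(1) by (intro Max_ge) (auto simp: finite_fp_sets)
    finally show ?thesis
      using gmd_eq(1)[OF I, of d r] False F(2) q M(1) by (auto simp: footprint_def)
  qed
qed

end

theorem theorem3p9:
  fixes I :: "('n::finite, 'k::field) mpoly set"
    and lt :: "'n mon \<Rightarrow> 'n mon \<Rightarrow> bool"
    and d r :: nat
  assumes "graded_ideal I" and "I \<noteq> {0}" and "unmixed I"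
    and "monomial_order lt"
    and "d \<ge> 1" and "r \<ge> 1"
  shows "(r \<le> hilbert_fun I d \<longrightarrow> footprint lt I d r \<le> gmd I d r)
    \<and> gmd I d r \<ge> 1
    \<and> (unmixed (init_ideal lt I) \<longrightarrow> footprint lt I d r \<ge> 1)
    \<and> gmd I d r \<le> gmd I d (r + 1)
    \<and> ((\<exists>h\<in>homog 1. colon I {h} = I) \<longrightarrow>
         gmd I d r \<ge> gmd I (d + 1) r \<and> gmd I (d + 1) r \<ge> 1)"
proof -
  let ?lt = "deg_refine lt"
  interpret a: mon_order lt by standard (rule assms(4))
  interpret b: deg_order ?lt by (rule deg_order_deg_refine[OF assms(4)])
  note iI = graded_idealD(1)[OF assms(1)]
  have eq: "init_ideal lt I = init_ideal ?lt I"
    unfolding a.init_ideal_eq[OF iI] b.init_ideal_eq[OF iI] init_mons_deg_refine[OF assms(4,1)] ..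
  have fp: "footprint lt I d r = footprint ?lt I d r" by (rule footprint_cong[OF eq])
  have "I \<noteq> UNIV" using assms(3) by (simp add: unmixed_def)
  then show ?thesis
    unfolding fp eq
    using b.footprint_le_gmd[OF assms(1,3)] b.gmd_ge_one[OF assms(1,3,6)]
      b.footprint_ge_one[OF assms(1) _ _ assms(6)] b.gmd_le_Suc[OF assms(1,3)]
      b.gmd_le_of_regular[OF assms(1,3)]
    by auto
qed

end
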